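(* Let $z_1,\dots,z_n\in\mathbb{C}$ be distinct, let $m_1,\dots,m_n,k\in\mathbb{C}$ with $\kappa:=k+2\neq0$, and put $m_{n+1}=m_1+\dots+m_n-2$, $U=\mathbb{C}\setminus\{z_1,\dots,z_n\}$. Let $V_j=V(m_j,k-m_j)$ be the $\widehat{\mathfrak{sl}_2}$-Verma module with generating vector $v_j$, and $V_j^*$ its contragradient module, $j=1,\dots,n+1$. Define linear maps $$\eta^1:\Omega^1(U)\to\bigotimes_{j=1}^{n+1}V_j^*,\qquad \eta^0:\Omega^0(U)\to\mathfrak{sl}_2(U)\otimes\bigotimes_{j=1}^{n+1}V_j^*$$ on bases as follows. For $1\le p\le n$ and $a>0$, $$\eta^1:\ \frac{dt}{(t-z_p)^a}\mapsto-\kappa\,(v_1)^*\otimes\dots\otimes\left(\frac{f}{T^{a-1}}v_p\right)^*\otimes\dots\otimes(v_{n+1})^*,$$ $$\eta^1:\ t^{a-1}dt\mapsto\kappa\,(v_1)^*\otimes\dots\otimes(v_n)^*\otimes\left(\frac{e}{T^a}v_{n+1}\right)^*;$$ for $1\le p\le n$ and $a>0$, $$\eta^0:\ \frac{1}{(t-z_p)^a}\mapsto\frac{f}{(t-z_p)^a}\otimes(v_1)^*\otimes\dots\otimes(v_{n+1})^*-\sum_{l=1}^{a}\Bigg[\frac{e}{(t-z_p)^l}\otimes(v_1)^*\otimes\dots\otimes2\sum_{\substack{i+j=a-l\\ i\ge j\ge0}}\left(\frac{f}{T^i}\frac{f}{T^j}v_p\right)^*\otimes\dots\otimes(v_{n+1})^*+\frac{h}{(t-z_p)^l}\otimes(v_1)^*\otimes\dots\otimes\left(\frac{f}{T^{a-l}}v_p\right)^*\otimes\dots\otimes(v_{n+1})^*\Bigg];$$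 and for $a\ge0$, $$\eta^0:\ t^a\mapsto ft^a\otimes(v_1)^*\otimes\dots\otimes(v_{n+1})^*-\sum_{l=0}^{a-2}\Bigg[et^l\otimes(v_1)^*\otimes\dots\otimes(v_n)^*\otimes2\sum_{\substack{i+j=a-l\\ i\ge j\ge1}}\left(\frac{e}{T^i}\frac{e}{T^j}v_{n+1}\right)^*+ht^{l+1}\otimes(v_1)^*\otimes\dots\otimes(v_n)^*\otimes\left(\frac{e}{T^{a-l-1}}v_{n+1}\right)^*\Bigg].$$ (In the formulas involving $z_p$, the distinguished factor is in the $p$-th position and all other factors are $(v_j)^*$.) Then $\eta=(\eta^0,\eta^1)$ is a homomorphism of complexes $\eta:\Omega^\bullet(U)[1]\to C_\bullet\big(\mathfrak{sl}_2(U);\bigotimes_{j=1}^{n+1}V_j^*\big)$, namely $$\mathrm{d}\,\eta^0=\eta^1\,\partial,$$ and this homomorphism is injective.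
   Context: Twisted de Rham complex. $\Omega^p(U)$, $p=0,1$, is the space of rational differential $p$-forms on $\mathbb{C}$ (coordinate $t$) regular on $U$. The complex $\Omega^\bullet(U)$ is $0\to\Omega^0(U)\xrightarrow{\partial}\Omega^1(U)\to0$ with $\partial=d+\alpha\wedge\cdot$, $\alpha=-\frac1\kappa\sum_{i=1}^n m_i\frac{dt}{t-z_i}$. A basis of $\Omega^0(U)$ is given by $(t-z_i)^{-a}$ ($1\le i\le n$, $a\in\mathbb{Z}_{>0}$) and $t^a$ ($a\in\mathbb{Z}_{\ge0}$); a basis of $\Omega^1(U)$ is given by $(t-z_i)^{-a}dt$ ($1\le i\le n$, $a\in\mathbb{Z}_{>0}$) and $t^adt$ ($a\in\mathbb{Z}_{\ge0}$). $\Omega^\bullet(U)[1]$ is the same complex with $\Omega^p(U)$ placed in degree $p-1$. Affine Lie algebra. $\mathfrak{sl}_2$ has standard generators $e,f,h$: $[e,f]=h$, $[h,e]=2e$, $[h,f]=-2f$. $\widehat{\mathfrak{sl}_2}=\mathfrak{sl}_2[T,T^{-1}]\oplus\mathbb{C}c$ with $c$ central and $[xT^i,yT^j]=[x,y]T^{i+j}+i\,\mathrm{tr}(xy)\delta_{i+j,0}c$. Write $\frac{x}{T^i}=xT^{-i}$. Chevalley generators: $e_1=e$, $f_1=f$, $h_1=h$, $e_2=fT$, $f_2=eT^{-1}$, $h_2=c-h$. The automorphism $\pi$ of $\widehat{\mathfrak{sl}_2}$ is given by $c\mapsto c$, $eT^i\mapsto fT^i$, $fT^i\mapsto eT^i$,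 $hT^i\mapsto-hT^i$. Modules. The central element $c$ acts on all modules by $k$. $V(m,k-m)$ is the Verma module generated by $v$ subject to $e_1v=e_2v=0$, $h_1v=mv$, $h_2v=(k-m)v$. It is $\mathbb{Z}_{\ge0}^2$-graded: $f_{i_1}\cdots f_{i_q}v$ has degree $(p_1,p_2)$, where $p_i$ is the number of $i$'s among $i_1,\dots,i_q\in\{1,2\}$. The contragradient module of $V=V(m,k-m)$ is $V^*=\bigoplus_\gamma V_\gamma^*$ (graded dual) with action determined by $\langle f_i\phi,x\rangle=\langle\phi,e_ix\rangle$, $\langle e_i\phi,x\rangle=\langle\phi,f_ix\rangle$, $i=1,2$. Bases. For $\gamma=(p_1,p_2)$ with $p_1>p_2$, fix in $V_\gamma$ the PBW basis of vectors $\frac{f}{T^{i_1}}\cdots\frac{f}{T^{i_r}}\frac{h}{T^{j_1}}\cdots\frac{h}{T^{j_s}}\frac{e}{T^{l_1}}\cdots\frac{e}{T^{l_q}}v$, and for $p_1<p_2$ the PBW basis of vectors $\frac{e}{T^{l_1}}\cdots\frac{e}{T^{l_q}}\frac{h}{T^{j_1}}\cdots\frac{h}{T^{j_s}}\frac{f}{T^{i_1}}\cdots\frac{f}{T^{i_r}}v$, with $0\le i_r\le\dots\le i_1$, $1\le j_s\le\dots\le j_1$, $1\le l_q\le\dots\le l_1$, $\sum i_u+\sum j_u+\sum l_u+r-q=p_1$, $\sum i_u+\sum j_u+\sum l_u=p_2$. In degree $(0,0)$ the basis is $\{v\}$. For a basis vector $w$ of $V_\gamma$, $(w)^*\in V_\gamma^*$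 denotes the corresponding dual basis element. Empty sums are zero. Lie algebra of functions. $\mathfrak{sl}_2(U)$ is the Lie algebra of $\mathfrak{sl}_2$-valued rational functions on $\mathbb{P}^1$ regular on $U=\mathbb{P}^1\setminus\{z_1,\dots,z_n,z_{n+1}=\infty\}$, with pointwise bracket, i.e. $\mathfrak{sl}_2\otimes\Omega^0(U)$; one writes $xu$ for $x\otimes u$. It acts on $\bigotimes_{j=1}^{n+1}V_j^*$ by $$(x\otimes u)\cdot(w_1\otimes\dots\otimes w_{n+1})=\sum_{j=1}^n w_1\otimes\dots\otimes[x\otimes u]^{(z_j)}w_j\otimes\dots\otimes w_{n+1}+w_1\otimes\dots\otimes w_n\otimes\pi\big([x\otimes u]^{(\infty)}\big)w_{n+1},$$ where $[x\otimes u]^{(z_j)}$ is the Laurent expansion of $x\otimes u$ at $t=z_j$ in the local coordinate $T=t-z_j$, and $[x\otimes u]^{(\infty)}$ is the Laurent expansion at $t=\infty$ in the local coordinate $T=1/t$; the actions of these series are well defined since for every $w\in V_j^*$ and $x\in\mathfrak{sl}_2$ one has $xT^iw=0$ for $i\gg0$. Chain complex. For a Lie algebra $\mathfrak{g}$ and a $\mathfrak{g}$-module $W$, $C_\bullet(\mathfrak{g},W)$ is the standard (Chevalley–Eilenberg) chain complex $C_p(\mathfrak{g},W)=\wedge^p\mathfrak{g}\otimes W$ with differential $\mathrm{d}$; its last differential $\mathrm{d}:\mathfrak{g}\otimes W\to W$ is $g\otimes w\mapsto gw$. Here $C_p$ is placed in degree $-p$, so that $\mathrm{d}$ has degree $1$.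 The map $\eta^1$ is the component of $\eta$ in degree $0$, $\eta^0$ is the component in degree $-1$, and all other components are zero. *)

theory Defs
  imports
    "HOL-Computational_Algebra.Computational_Algebra"
    "HOL-Computational_Algebra.Field_as_Ring"
    "HOL-Library.Poly_Mapping"
    "HOL-Library.FuncSet"
    "HOL-Library.Set_Algebras"
begin

subsection \<open>Free complex vector spaces\<close>

text \<open>
  \<^typ>\<open>'a \<Rightarrow>\<^sub>0 complex\<close> is the free complex vector space on the set of basis symbols
  \<^typ>\<open>'a\<close>.  A quotient of it by a subspace \<open>R\<close> consists of the cosets \<open>x +o R\<close>.
\<close>

definition pm_scale :: "complex \<Rightarrow> ('a \<Rightarrow>\<^sub>0 complex) \<Rightarrow> ('a \<Rightarrow>\<^sub>0 complex)" where
  "pm_scale c x = Poly_Mapping.map ((*) c) x"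

lemma lookup_pm_scale [simp]:
  "Poly_Mapping.lookup (pm_scale c x) a = c * Poly_Mapping.lookup x a"
  by (simp add: pm_scale_def Poly_Mapping.map.rep_eq when_def)

global_interpretation pm: vector_space "pm_scale :: complex \<Rightarrow> ('a \<Rightarrow>\<^sub>0 complex) \<Rightarrow> _"
  by standard (auto intro!: poly_mapping_eqI simp: lookup_add algebra_simps)

text \<open>The linear extension of a map given on the basis symbols.\<close>

definition pm_lift :: "('a \<Rightarrow> ('b \<Rightarrow>\<^sub>0 complex)) \<Rightarrow> ('a \<Rightarrow>\<^sub>0 complex) \<Rightarrow> ('b \<Rightarrow>\<^sub>0 complex)" where
  "pm_lift h x = (\<Sum>a\<in>Poly_Mapping.keys x. pm_scale (Poly_Mapping.lookup x a) (h a))"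

text \<open>
  With concatenation as the monoid operation on words, \<^typ>\<open>'a list \<Rightarrow>\<^sub>0 complex\<close> carries
  the convolution product, i.e. it is the free associative unital algebra on \<^typ>\<open>'a\<close>,
  which is the tensor algebra of the vector space \<^typ>\<open>'a \<Rightarrow>\<^sub>0 complex\<close>.
\<close>

instantiation list :: (type) monoid_add
begin
definition zero_list :: "'a list" where "zero_list = []"
definition plus_list :: "'a list \<Rightarrow> 'a list \<Rightarrow> 'a list" where "plus_list = (@)"
instance by standard (auto simp: zero_list_def plus_list_def)
end

definition tensor_incl :: "('a \<Rightarrow>\<^sub>0 complex) \<Rightarrow> ('a list \<Rightarrow>\<^sub>0 complex)" where
  "tensor_incl = pm_lift (\<lambda>a. Poly_Mapping.single [a] 1)"

subsection \<open>The affine Lie algebra\<close>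

datatype sl2 = sl_e | sl_f | sl_h

fun sl2_bracket :: "sl2 \<Rightarrow> sl2 \<Rightarrow> (sl2 \<Rightarrow>\<^sub>0 complex)" where
  "sl2_bracket sl_e sl_f = Poly_Mapping.single sl_h 1"
| "sl2_bracket sl_f sl_e = Poly_Mapping.single sl_h (-1)"
| "sl2_bracket sl_h sl_e = Poly_Mapping.single sl_e 2"
| "sl2_bracket sl_e sl_h = Poly_Mapping.single sl_e (-2)"
| "sl2_bracket sl_h sl_f = Poly_Mapping.single sl_f (-2)"
| "sl2_bracket sl_f sl_h = Poly_Mapping.single sl_f 2"
| "sl2_bracket sl_e sl_e = 0"
| "sl2_bracket sl_f sl_f = 0"
| "sl2_bracket sl_h sl_h = 0"

text \<open>
  The trace form \<open>tr(xy)\<close> in the defining representation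
  \<open>e = E\<^sub>1\<^sub>2\<close>, \<open>f = E\<^sub>2\<^sub>1\<close>, \<open>h = E\<^sub>1\<^sub>1 - E\<^sub>2\<^sub>2\<close>.
\<close>

fun sl2_trace :: "sl2 \<Rightarrow> sl2 \<Rightarrow> complex" where
  "sl2_trace sl_e sl_f = 1"
| "sl2_trace sl_f sl_e = 1"
| "sl2_trace sl_h sl_h = 2"
| "sl2_trace _ _ = 0"

text \<open>\<open>Loop a i\<close> stands for \<open>a T\<^sup>i\<close>, and \<open>Central\<close> for \<open>c\<close>.\<close>

datatype aff_basis = Loop sl2 int | Central

type_synonym affine = "aff_basis \<Rightarrow>\<^sub>0 complex"

definition loop :: "sl2 \<Rightarrow> int \<Rightarrow> affine" where
  "loop a i = Poly_Mapping.single (Loop a i) 1"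

definition central :: affine where
  "central = Poly_Mapping.single Central 1"

fun basis_bracket :: "aff_basis \<Rightarrow> aff_basis \<Rightarrow> affine" where
  "basis_bracket (Loop a i) (Loop b j) =
     pm_lift (\<lambda>x. loop x (i + j)) (sl2_bracket a b)
     + (if i + j = 0 then pm_scale (of_int i * sl2_trace a b) central else 0)"
| "basis_bracket Central _ = 0"
| "basis_bracket _ Central = 0"

definition affine_bracket :: "affine \<Rightarrow> affine \<Rightarrow> affine" where
  "affine_bracket x y = pm_lift (\<lambda>a. pm_lift (\<lambda>b. basis_bracket a b) y) x"

definition chev_e :: "nat \<Rightarrow> affine" where
  "chev_e i = (if i = 1 then loop sl_e 0 else loop sl_f 1)"
definition chev_f :: "nat \<Rightarrow> affine" where
  "chev_f i = (if i = 1 then loop sl_f 0 else loop sl_e (-1))"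
definition chev_h :: "nat \<Rightarrow> affine" where
  "chev_h i = (if i = 1 then loop sl_h 0 else central - loop sl_h 0)"

subsection \<open>Verma modules\<close>

type_synonym words = "aff_basis list \<Rightarrow>\<^sub>0 complex"

text \<open>
  The Verma module \<open>V(m, k - m)\<close> is the quotient of the tensor algebra \<^typ>\<open>words\<close> of the
  affine Lie algebra by the subspace \<open>verma_rel k m\<close>: the two-sided ideal defining the universal
  enveloping algebra, plus the left ideal generated by the defining relations of the generating
  vector \<open>v\<close>.  An element \<open>x\<close> of \<^typ>\<open>words\<close> represents the vector \<open>x v\<close>.
  The relation \<open>c v = k v\<close> follows, since \<open>c = h\<^sub>1 + h\<^sub>2\<close>.
\<close>

definition verma_rel :: "complex \<Rightarrow> complex \<Rightarrow> words set" where
  "verma_rel k m = pm.span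
     ({a * (tensor_incl x * tensor_incl y - tensor_incl y * tensor_incl x
            - tensor_incl (affine_bracket x y)) * b | a b x y. True}
      \<union> {a * tensor_incl (chev_e i) | a i. i \<in> {1, 2}}
      \<union> {a * tensor_incl (chev_h 1) - pm_scale m a | a. True}
      \<union> {a * tensor_incl (chev_h 2) - pm_scale (k - m) a | a. True})"

text \<open>Representatives of the homogeneous component of degree \<open>(p\<^sub>1, p\<^sub>2)\<close>.\<close>

definition verma_piece :: "nat \<times> nat \<Rightarrow> words set" where
  "verma_piece \<gamma> = pm.span {prod_list (map (\<lambda>i. tensor_incl (chev_f i)) is) | is.
     set is \<subseteq> {1, 2} \<and> count_list is 1 = fst \<gamma> \<and> count_list is 2 = snd \<gamma>}"

subsection \<open>Contragradient modules\<close>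

text \<open>
  Linear functionals on the Verma module are linear functionals on \<^typ>\<open>words\<close> that vanish on
  \<open>verma_rel k m\<close>.  The homogeneous components being finite-dimensional, the graded dual
  consists of the functionals which are nonzero on finitely many of them only.
\<close>

type_synonym functional = "words \<Rightarrow> complex"

definition verma_dual :: "complex \<Rightarrow> complex \<Rightarrow> functional set" where
  "verma_dual k m = {\<phi>. Vector_Spaces.linear pm_scale (*) \<phi> \<and> (\<forall>x\<in>verma_rel k m. \<phi> x = 0)
     \<and> finite {\<gamma>. \<exists>x\<in>verma_piece \<gamma>. \<phi> x \<noteq> 0}}"

text \<open>
  The anti-automorphism exchanging \<open>e\<^sub>i\<close> and \<open>f\<^sub>i\<close>.  As these elements generate the affine Lie
  algebra, it gives the action on the contragradient module (see the lemmas below).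
\<close>

fun basis_anti :: "aff_basis \<Rightarrow> aff_basis" where
  "basis_anti (Loop sl_e i) = Loop sl_f (-i)"
| "basis_anti (Loop sl_f i) = Loop sl_e (-i)"
| "basis_anti (Loop sl_h i) = Loop sl_h (-i)"
| "basis_anti Central = Central"

definition affine_anti :: "affine \<Rightarrow> affine" where
  "affine_anti = pm_lift (\<lambda>b. Poly_Mapping.single (basis_anti b) 1)"

definition contra_act :: "affine \<Rightarrow> functional \<Rightarrow> functional" where
  "contra_act g \<phi> = (\<lambda>x. \<phi> (tensor_incl (affine_anti g) * x))"

subsection \<open>PBW bases and dual basis vectors\<close>

definition pbw_indices :: "nat \<Rightarrow> nat \<Rightarrow> nat list \<Rightarrow> nat list \<Rightarrow> nat list \<Rightarrow> bool" where
  "pbw_indices p1 p2 is js ls \<longleftrightarrow>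
     sorted_wrt (\<ge>) is \<and> sorted_wrt (\<ge>) js \<and> sorted_wrt (\<ge>) ls \<and>
     (\<forall>j\<in>set js. 1 \<le> j) \<and> (\<forall>l\<in>set ls. 1 \<le> l) \<and>
     sum_list is + sum_list js + sum_list ls + length is = p1 + length ls \<and>
     sum_list is + sum_list js + sum_list ls = p2"

definition down :: "sl2 \<Rightarrow> nat \<Rightarrow> aff_basis" where
  "down a i = Loop a (- int i)"

text \<open>
  Words \<open>w\<close> such that the vectors \<open>w v\<close> form the PBW basis of the component of the given
  degree.  No basis is fixed in the degrees \<open>(p, p)\<close> with \<open>p > 0\<close>.
\<close>

definition pbw :: "nat \<times> nat \<Rightarrow> aff_basis list set" where
  "pbw = (\<lambda>(p1, p2).
     if p2 < p1 then {map (down sl_f) is @ map (down sl_h) js @ map (down sl_e) ls | is js ls.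
       pbw_indices p1 p2 is js ls}
     else if p1 < p2 then {map (down sl_e) ls @ map (down sl_h) js @ map (down sl_f) is | is js ls.
       pbw_indices p1 p2 is js ls}
     else if p1 = 0 then {[]}
     else {})"

text \<open>The dual basis vector \<open>(w v)\<^sup>*\<close> of the PBW basis vector given by the word \<open>w\<close>.\<close>

definition dual_vec :: "complex \<Rightarrow> complex \<Rightarrow> aff_basis list \<Rightarrow> functional" where
  "dual_vec k m w = (THE \<phi>. \<phi> \<in> verma_dual k m \<and> (\<exists>\<gamma>. w \<in> pbw \<gamma> \<and>
     (\<forall>w'\<in>pbw \<gamma>. \<phi> (Poly_Mapping.single w' 1) = (if w' = w then 1 else 0)) \<and>
     (\<forall>\<gamma>'. \<gamma>' \<noteq> \<gamma> \<longrightarrow> (\<forall>x\<in>verma_piece \<gamma>'. \<phi> x = 0))))"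

subsection \<open>Rational functions and the twisted de Rham complex\<close>

type_synonym ratfun = "complex poly fract"

definition rat_scale :: "complex \<Rightarrow> ratfun \<Rightarrow> ratfun" where
  "rat_scale c u = to_fract [:c:] * u"

global_interpretation rat: vector_space rat_scale
proof
  fix a b :: complex and x y :: ratfun
  have *: "to_fract [:a + b:] = to_fract [:a:] + to_fract [:b:]"
    by (metis add_pCons add_0 to_fract_add)
  have **: "to_fract [:a * b:] = to_fract [:a:] * to_fract [:b:]"
    by (simp flip: to_fract_mult)
  show "rat_scale a (x + y) = rat_scale a x + rat_scale a y"
    by (simp add: rat_scale_def algebra_simps)
  show "rat_scale (a + b) x = rat_scale a x + rat_scale b x"
    unfolding rat_scale_def * by (simp add: algebra_simps)
  show "rat_scale a (rat_scale b x) = rat_scale (a * b) x"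
    unfolding rat_scale_def ** by (simp add: algebra_simps)
  show "rat_scale 1 x = x"
    by (simp add: rat_scale_def flip: one_pCons)
qed

text \<open>
  The points are \<open>z 1, \<dots>, z n\<close>.  A rational 1-form \<open>u dt\<close> is represented by its coefficient
  \<open>u\<close>, so that \<open>\<partial> u\<close> becomes \<open>u' + \<alpha> u\<close>.
\<close>

definition Omega0 :: "nat \<Rightarrow> (nat \<Rightarrow> complex) \<Rightarrow> ratfun set" where
  "Omega0 n z = {u. \<exists>p q. u = Fract p q \<and> q \<noteq> 0 \<and> (\<forall>t. t \<notin> z ` {1..n} \<longrightarrow> poly q t \<noteq> 0)}"

definition Omega1 :: "nat \<Rightarrow> (nat \<Rightarrow> complex) \<Rightarrow> ratfun set" where
  "Omega1 n z = Omega0 n z"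

definition rat_deriv :: "ratfun \<Rightarrow> ratfun" where
  "rat_deriv u = (case quot_of_fract u of (p, q) \<Rightarrow> Fract (pderiv p * q - p * pderiv q) (q ^ 2))"

definition pole :: "complex \<Rightarrow> nat \<Rightarrow> ratfun" where
  "pole c a = Fract 1 ([:- c, 1:] ^ a)"

definition mono_t :: "nat \<Rightarrow> ratfun" where
  "mono_t a = to_fract (monom 1 a)"

definition alpha :: "nat \<Rightarrow> (nat \<Rightarrow> complex) \<Rightarrow> (nat \<Rightarrow> complex) \<Rightarrow> complex \<Rightarrow> ratfun" where
  "alpha n z m \<kappa> = rat_scale (- 1 / \<kappa>) (\<Sum>i=1..n. rat_scale (m i) (pole (z i) 1))"

definition dR :: "nat \<Rightarrow> (nat \<Rightarrow> complex) \<Rightarrow> (nat \<Rightarrow> complex) \<Rightarrow> complex \<Rightarrow> ratfun \<Rightarrow> ratfun" where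
  "dR n z m \<kappa> u = rat_deriv u + alpha n z m \<kappa> * u"

text \<open>
  \<open>Pole p a\<close> with \<open>a > 0\<close> indexes the basis element \<open>(t - z\<^sub>p)\<^sup>-\<^sup>a\<close>, \<open>Mono a\<close> the element \<open>t\<^sup>a\<close>.
\<close>

datatype rat_index = Pole nat nat | Mono nat

definition rat_indices :: "nat \<Rightarrow> rat_index set" where
  "rat_indices n = {Pole p a | p a. p \<in> {1..n} \<and> 0 < a} \<union> range Mono"

fun rat_basis :: "(nat \<Rightarrow> complex) \<Rightarrow> rat_index \<Rightarrow> ratfun" where
  "rat_basis z (Pole p a) = pole (z p) a"
| "rat_basis z (Mono a) = mono_t a"

text \<open>The linear extension of a map given on this basis.\<close>

definition rat_lift ::
  "nat \<Rightarrow> (nat \<Rightarrow> complex) \<Rightarrow> (rat_index \<Rightarrow> ('b \<Rightarrow>\<^sub>0 complex)) \<Rightarrow> ratfun \<Rightarrow> ('b \<Rightarrow>\<^sub>0 complex)" where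
  "rat_lift n z h u =
     (let c = (\<lambda>i. rat.representation (rat_basis z ` rat_indices n) u (rat_basis z i))
      in \<Sum>i | i \<in> rat_indices n \<and> c i \<noteq> 0. pm_scale (c i) (h i))"

subsection \<open>The Lie algebra of rational functions and its action\<close>

text \<open>An \<open>sl\<^sub>2\<close>-valued rational function is given by its coordinates with respect to \<open>e, f, h\<close>.\<close>

type_synonym sl2_fun = "sl2 \<Rightarrow> ratfun"

definition sl2_U :: "nat \<Rightarrow> (nat \<Rightarrow> complex) \<Rightarrow> sl2_fun set" where
  "sl2_U n z = {g. \<forall>a. g a \<in> Omega0 n z}"

definition sl2_tensor :: "sl2 \<Rightarrow> ratfun \<Rightarrow> sl2_fun" where
  "sl2_tensor a u = (\<lambda>b. if b = a then u else 0)"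

text \<open>The Laurent series in \<open>T\<close> obtained by substituting \<open>t = \<tau>\<close>.\<close>

definition laurent_subst :: "complex fls \<Rightarrow> ratfun \<Rightarrow> complex fls" where
  "laurent_subst \<tau> u = (case quot_of_fract u of (p, q) \<Rightarrow>
     poly (map_poly fls_const p) \<tau> / poly (map_poly fls_const q) \<tau>)"

definition expand_at :: "complex \<Rightarrow> ratfun \<Rightarrow> complex fls" where
  "expand_at c = laurent_subst (fls_const c + fls_X)"

definition expand_infinity :: "ratfun \<Rightarrow> complex fls" where
  "expand_infinity = laurent_subst fls_X_inv"

text \<open>
  \<open>sl\<^sub>2\<close>-valued Laurent series act on the contragradient module; for elements of
  \<open>verma_dual k m\<close> only finitely many terms of the sum are nonzero.
\<close>

definition series_act :: "(sl2 \<Rightarrow> complex fls) \<Rightarrow> functional \<Rightarrow> functional" where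
  "series_act A \<phi> = (\<lambda>x. \<Sum>a\<in>{sl_e, sl_f, sl_h}.
     Sum_any (\<lambda>i. fls_nth (A a) i * contra_act (loop a i) \<phi> x))"

definition pi_series :: "(sl2 \<Rightarrow> complex fls) \<Rightarrow> (sl2 \<Rightarrow> complex fls)" where
  "pi_series A = (\<lambda>a. case a of sl_e \<Rightarrow> A sl_f | sl_f \<Rightarrow> A sl_e | sl_h \<Rightarrow> - A sl_h)"

subsection \<open>Tensor products and the last differential of the chain complex\<close>

text \<open>
  The tensor product of \<open>V\<^sub>1\<^sup>*, \<dots>, V\<^sub>n\<^sub>+\<^sub>1\<^sup>*\<close> is the free vector space on the families
  \<open>(w\<^sub>1, \<dots>, w\<^sub>n\<^sub>+\<^sub>1)\<close> modulo multilinearity; its tensor product with the Lie algebra \<open>sl2_U n z\<close>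
  is likewise the free vector space on the pairs of a Lie algebra element and a family, modulo
  linearity in each of the \<open>n + 2\<close> entries.
\<close>

type_synonym family = "nat \<Rightarrow> functional"

definition families :: "nat \<Rightarrow> complex \<Rightarrow> (nat \<Rightarrow> complex) \<Rightarrow> family set" where
  "families n k m = (\<Pi>\<^sub>E j\<in>{1..n+1}. verma_dual k (m j))"

definition rel_C0 :: "nat \<Rightarrow> complex \<Rightarrow> (nat \<Rightarrow> complex) \<Rightarrow> (family \<Rightarrow>\<^sub>0 complex) set" where
  "rel_C0 n k m = pm.span
     ({Poly_Mapping.single (w(j := (\<lambda>x. a x + b x))) 1
         - Poly_Mapping.single (w(j := a)) 1 - Poly_Mapping.single (w(j := b)) 1 | w j a b.
         w \<in> families n k m \<and> j \<in> {1..n+1} \<and> a \<in> verma_dual k (m j) \<and> b \<in> verma_dual k (m j)}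
      \<union> {Poly_Mapping.single (w(j := (\<lambda>x. c * a x))) 1 - Poly_Mapping.single (w(j := a)) c | w j a c.
         w \<in> families n k m \<and> j \<in> {1..n+1} \<and> a \<in> verma_dual k (m j)})"

definition C0 :: "nat \<Rightarrow> complex \<Rightarrow> (nat \<Rightarrow> complex) \<Rightarrow> (family \<Rightarrow>\<^sub>0 complex) set set" where
  "C0 n k m = {x +o rel_C0 n k m | x. Poly_Mapping.keys x \<subseteq> families n k m}"

definition rel_C1 :: "nat \<Rightarrow> (nat \<Rightarrow> complex) \<Rightarrow> complex \<Rightarrow> (nat \<Rightarrow> complex) \<Rightarrow>
    (sl2_fun \<times> family \<Rightarrow>\<^sub>0 complex) set" where
  "rel_C1 n z k m = pm.span
     ({Poly_Mapping.single ((\<lambda>a. g a + g' a), w) 1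
         - Poly_Mapping.single (g, w) 1 - Poly_Mapping.single (g', w) 1 | g g' w.
         g \<in> sl2_U n z \<and> g' \<in> sl2_U n z \<and> w \<in> families n k m}
      \<union> {Poly_Mapping.single ((\<lambda>a. rat_scale c (g a)), w) 1 - Poly_Mapping.single (g, w) c | g c w.
         g \<in> sl2_U n z \<and> w \<in> families n k m}
      \<union> {Poly_Mapping.single (g, w(j := (\<lambda>x. a x + b x))) 1
         - Poly_Mapping.single (g, w(j := a)) 1 - Poly_Mapping.single (g, w(j := b)) 1 | g w j a b.
         g \<in> sl2_U n z \<and> w \<in> families n k m \<and> j \<in> {1..n+1}
         \<and> a \<in> verma_dual k (m j) \<and> b \<in> verma_dual k (m j)}
      \<union> {Poly_Mapping.single (g, w(j := (\<lambda>x. c * a x))) 1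
         - Poly_Mapping.single (g, w(j := a)) c | g w j a c.
         g \<in> sl2_U n z \<and> w \<in> families n k m \<and> j \<in> {1..n+1} \<and> a \<in> verma_dual k (m j)})"

definition C1 :: "nat \<Rightarrow> (nat \<Rightarrow> complex) \<Rightarrow> complex \<Rightarrow> (nat \<Rightarrow> complex) \<Rightarrow>
    (sl2_fun \<times> family \<Rightarrow>\<^sub>0 complex) set set" where
  "C1 n z k m = {x +o rel_C1 n z k m | x. Poly_Mapping.keys x \<subseteq> sl2_U n z \<times> families n k m}"

definition fun_act :: "nat \<Rightarrow> (nat \<Rightarrow> complex) \<Rightarrow> sl2_fun \<Rightarrow> family \<Rightarrow> (family \<Rightarrow>\<^sub>0 complex)" where
  "fun_act n z g w =
     (\<Sum>j=1..n. Poly_Mapping.single (w(j := series_act (\<lambda>a. expand_at (z j) (g a)) (w j))) 1)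
     + Poly_Mapping.single
         (w(n+1 := series_act (pi_series (\<lambda>a. expand_infinity (g a))) (w (n+1)))) 1"

text \<open>The differential \<open>g \<otimes> w \<mapsto> g w\<close>, extended linearly and passed to the quotients.\<close>

definition dCE :: "nat \<Rightarrow> (nat \<Rightarrow> complex) \<Rightarrow> complex \<Rightarrow> (nat \<Rightarrow> complex) \<Rightarrow>
    (sl2_fun \<times> family \<Rightarrow>\<^sub>0 complex) set \<Rightarrow> (family \<Rightarrow>\<^sub>0 complex) set" where
  "dCE n z k m X = the_elem ((\<lambda>x. pm_lift (\<lambda>(g, w). fun_act n z g w) x +o rel_C0 n k m) ` X)"

subsection \<open>The homomorphism\<close>

text \<open>The family \<open>(v\<^sub>1)\<^sup>*, \<dots>, (v\<^sub>n\<^sub>+\<^sub>1)\<^sup>*\<close>.\<close>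

definition vacuum :: "nat \<Rightarrow> complex \<Rightarrow> (nat \<Rightarrow> complex) \<Rightarrow> family" where
  "vacuum n k m = (\<lambda>j\<in>{1..n+1}. dual_vec k (m j) [])"

fun eta1_basis :: "nat \<Rightarrow> complex \<Rightarrow> (nat \<Rightarrow> complex) \<Rightarrow> rat_index \<Rightarrow> (family \<Rightarrow>\<^sub>0 complex)" where
  "eta1_basis n k m (Pole p a) =
     Poly_Mapping.single ((vacuum n k m)(p := dual_vec k (m p) [down sl_f (a - 1)])) (- (k + 2))"
| "eta1_basis n k m (Mono a) =
     Poly_Mapping.single ((vacuum n k m)(n+1 := dual_vec k (m (n+1)) [down sl_e (a + 1)])) (k + 2)"

fun eta0_basis :: "nat \<Rightarrow> (nat \<Rightarrow> complex) \<Rightarrow> complex \<Rightarrow> (nat \<Rightarrow> complex) \<Rightarrow> rat_index \<Rightarrow>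
    (sl2_fun \<times> family \<Rightarrow>\<^sub>0 complex)" where
  "eta0_basis n z k m (Pole p a) =
     Poly_Mapping.single (sl2_tensor sl_f (pole (z p) a), vacuum n k m) 1
     - (\<Sum>l=1..a.
          Poly_Mapping.single (sl2_tensor sl_e (pole (z p) l),
            (vacuum n k m)(p := (\<lambda>x. 2 * (\<Sum>(i, j)\<in>{(i, j). i + j = a - l \<and> j \<le> i}.
               dual_vec k (m p) [down sl_f i, down sl_f j] x)))) 1
          + Poly_Mapping.single (sl2_tensor sl_h (pole (z p) l),
            (vacuum n k m)(p := dual_vec k (m p) [down sl_f (a - l)])) 1)"
| "eta0_basis n z k m (Mono a) =
     Poly_Mapping.single (sl2_tensor sl_f (mono_t a), vacuum n k m) 1
     - (\<Sum>l | l + 2 \<le> a.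
          Poly_Mapping.single (sl2_tensor sl_e (mono_t l),
            (vacuum n k m)(n+1 := (\<lambda>x. 2 * (\<Sum>(i, j)\<in>{(i, j). i + j = a - l \<and> j \<le> i \<and> 1 \<le> j}.
               dual_vec k (m (n+1)) [down sl_e i, down sl_e j] x)))) 1
          + Poly_Mapping.single (sl2_tensor sl_h (mono_t (l + 1)),
            (vacuum n k m)(n+1 := dual_vec k (m (n+1)) [down sl_e (a - l - 1)])) 1)"

definition eta1 :: "nat \<Rightarrow> (nat \<Rightarrow> complex) \<Rightarrow> complex \<Rightarrow> (nat \<Rightarrow> complex) \<Rightarrow> ratfun \<Rightarrow>
    (family \<Rightarrow>\<^sub>0 complex) set" where
  "eta1 n z k m u = rat_lift n z (eta1_basis n k m) u +o rel_C0 n k m"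

definition eta0 :: "nat \<Rightarrow> (nat \<Rightarrow> complex) \<Rightarrow> complex \<Rightarrow> (nat \<Rightarrow> complex) \<Rightarrow> ratfun \<Rightarrow>
    (sl2_fun \<times> family \<Rightarrow>\<^sub>0 complex) set" where
  "eta0 n z k m u = rat_lift n z (eta0_basis n z k m) u +o rel_C1 n z k m"

text \<open>
  Linear maps from a space of rational functions to a quotient space of cosets; sums of cosets
  are sums of sets.
\<close>

definition linear_to_cosets :: "ratfun set \<Rightarrow> ('b \<Rightarrow>\<^sub>0 complex) set set \<Rightarrow>
    (ratfun \<Rightarrow> ('b \<Rightarrow>\<^sub>0 complex) set) \<Rightarrow> bool" where
  "linear_to_cosets S C h \<longleftrightarrow> h \<in> S \<rightarrow> C \<and>
     (\<forall>c. \<forall>u\<in>S. \<forall>u'\<in>S. h (rat_scale c u + u') = pm_scale c ` h u + h u')"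

subsection \<open>The contragradient action\<close>

text \<open>
  The action defined above satisfies the defining equations of the contragradient action on the
  Chevalley generators, and it is a Lie algebra action.
\<close>

lemma pm_lift_superset:
  assumes "finite A" "Poly_Mapping.keys x \<subseteq> A"
  shows "pm_lift h x = (\<Sum>a\<in>A. pm_scale (Poly_Mapping.lookup x a) (h a))"
  unfolding pm_lift_def using assms
  by (intro sum.mono_neutral_left) (auto simp: in_keys_iff)

lemma pm_lift_add: "pm_lift h (x + y) = pm_lift h x + pm_lift h y"
proof -
  let ?A = "Poly_Mapping.keys x \<union> Poly_Mapping.keys y"
  have "Poly_Mapping.keys (x + y) \<subseteq> ?A"
    by (rule Poly_Mapping.keys_add)
  then show ?thesis
    by (simp add: pm_lift_superset[of ?A] lookup_add pm.scale_left_distrib sum.distrib)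
qed

lemma pm_lift_scale: "pm_lift h (pm_scale c x) = pm_scale c (pm_lift h x)"
proof -
  have "Poly_Mapping.keys (pm_scale c x) \<subseteq> Poly_Mapping.keys x"
    by (auto simp: in_keys_iff)
  then show ?thesis
    by (simp add: pm_lift_superset[of "Poly_Mapping.keys x"] pm.scale_sum_right)
qed

lemma pm_lift_single [simp]: "pm_lift h (Poly_Mapping.single a c) = pm_scale c (h a)"
  by (cases "c = 0") (simp_all add: pm_lift_def)

lemma pm_lift_zero [simp]: "pm_lift h 0 = 0"
  by (simp add: pm_lift_def)

lemma pm_lift_diff: "pm_lift h (x - y) = pm_lift h x - pm_lift h y"
  by (metis add_diff_cancel diff_add_cancel pm_lift_add)

lemma pm_lift_sum: "pm_lift h (sum f A) = (\<Sum>a\<in>A. pm_lift h (f a))"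
  by (induction A rule: infinite_finite_induct) (simp_all add: pm_lift_add)

lemma pm_scale_single [simp]: "pm_scale c (Poly_Mapping.single a d) = Poly_Mapping.single a (c * d)"
  by (rule poly_mapping_eqI) (simp add: lookup_single when_def)

lemma contra_act_chev_f: "contra_act (chev_f i) \<phi> x = \<phi> (tensor_incl (chev_e i) * x)"
  and contra_act_chev_e: "contra_act (chev_e i) \<phi> x = \<phi> (tensor_incl (chev_f i) * x)"
  by (simp_all add: contra_act_def affine_anti_def chev_e_def chev_f_def loop_def)

lemma basis_anti_bracket:
  "affine_anti (basis_bracket a b) = basis_bracket (basis_anti b) (basis_anti a)"
proof (cases "a = Central \<or> b = Central")
  case True
  have "basis_bracket x Central = 0" for x
    by (cases x) auto
  with True show ?thesis
    by (auto simp: affine_anti_def)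
next
  case False
  then obtain x i y j where "a = Loop x i" "b = Loop y j"
    by (meson aff_basis.exhaust)
  then show ?thesis
    by (cases x; cases y)
      (auto simp: affine_anti_def pm_lift_add loop_def central_def pm_lift_scale add.commute)
qed

lemma pm_lift_comp: "pm_lift h (pm_lift g x) = pm_lift (\<lambda>a. pm_lift h (g a)) x"
  unfolding pm_lift_def[of g] pm_lift_def[of "\<lambda>a. pm_lift h (g a)"]
  by (simp add: pm_lift_sum pm_lift_scale)

lemma pm_lift_swap:
  "pm_lift (\<lambda>a. pm_lift (\<lambda>b. F a b) y) x = pm_lift (\<lambda>b. pm_lift (\<lambda>a. F a b) x) y"
proof -
  have "pm_lift (\<lambda>a. pm_lift (\<lambda>b. F a b) y) x
      = (\<Sum>a\<in>Poly_Mapping.keys x. \<Sum>b\<in>Poly_Mapping.keys y.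
           pm_scale (Poly_Mapping.lookup x a * Poly_Mapping.lookup y b) (F a b))"
    by (simp add: pm_lift_def pm.scale_sum_right)
  also have "\<dots> = (\<Sum>b\<in>Poly_Mapping.keys y. \<Sum>a\<in>Poly_Mapping.keys x.
           pm_scale (Poly_Mapping.lookup y b * Poly_Mapping.lookup x a) (F a b))"
    by (subst sum.swap) (simp add: mult.commute)
  also have "\<dots> = pm_lift (\<lambda>b. pm_lift (\<lambda>a. F a b) x) y"
    by (simp add: pm_lift_def pm.scale_sum_right)
  finally show ?thesis .
qed

lemma affine_anti_bracket:
  "affine_anti (affine_bracket x y) = affine_bracket (affine_anti y) (affine_anti x)"
proof -
  have "affine_anti (affine_bracket x y)
      = pm_lift (\<lambda>a. pm_lift (\<lambda>b. affine_anti (basis_bracket a b)) y) x"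
    by (simp add: affine_bracket_def affine_anti_def pm_lift_comp)
  also have "\<dots> = pm_lift (\<lambda>b. pm_lift (\<lambda>a. basis_bracket (basis_anti b) (basis_anti a)) x) y"
    by (subst pm_lift_swap) (simp add: basis_anti_bracket)
  also have "\<dots> = affine_bracket (affine_anti y) (affine_anti x)"
    by (simp add: affine_bracket_def affine_anti_def pm_lift_comp)
  finally show ?thesis .
qed

lemma contra_act_bracket:
  assumes "\<phi> \<in> verma_dual k m"
  shows "contra_act (affine_bracket g h) \<phi> x
    = contra_act g (contra_act h \<phi>) x - contra_act h (contra_act g \<phi>) x"
proof -
  interpret \<phi>: Vector_Spaces.linear pm_scale "(*)" \<phi>
    using assms by (simp add: verma_dual_def)
  let ?A = "tensor_incl (affine_anti h)" and ?B = "tensor_incl (affine_anti g)"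
  let ?AB = "tensor_incl (affine_anti (affine_bracket g h))"
  have "1 * (?A * ?B - ?B * ?A - ?AB) * x \<in> verma_rel k m"
    unfolding verma_rel_def affine_anti_bracket by (rule pm.span_base) blast
  then have "\<phi> ((?A * ?B - ?B * ?A - ?AB) * x) = 0"
    using assms by (simp add: verma_dual_def)
  then have "\<phi> (?A * (?B * x)) - \<phi> (?B * (?A * x)) - \<phi> (?AB * x) = 0"
    by (simp add: left_diff_distrib \<phi>.diff mult.assoc)
  then show ?thesis
    by (simp add: contra_act_def)
qed

end

theory Submission
  imports Defs "HOL-Library.Product_Plus"
begin

text \<open>
  Straightening of words (the Poincare--Birkhoff--Witt theorem) makes the coefficient of a PBW basis
  vector a functional on words that kills the relations of the Verma module, and a homogeneous
  functional on the Verma module is determined by its values on a PBW basis.  If the letters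
  \<open>f/T\<^sup>b\<close>, which commute with each other, stand in front, then
  \<open>\<langle>(f/T\<^sup>a v)\<^sup>*, f/T\<^sup>b y\<rangle>\<close> is \<open>\<langle>v\<^sup>*, y\<rangle>\<close> for \<open>a = b\<close> and zero otherwise, and similarly for two letters.
  Every PBW vector of degree \<open>(a + 1, a)\<close> starts with such a letter, so it suffices to move the acting
  element past one letter.  After a shift of the summation index everything cancels except for
  \<open>f/T\<^sup>a v\<^sup>* - \<Sum>\<^sub>l (e/T\<^sup>l 2 \<Sum> (f/T\<^sup>i f/T\<^sup>j v)\<^sup>* + h/T\<^sup>l (f/T\<^bsup>a-l\<^esup> v)\<^sup>*) = (m + a \<kappa>) (f/T\<^sup>a v)\<^sup>*\<close>,
  and the same computation with \<open>e/T\<^sup>b\<close> in place of \<open>f/T\<^sup>b\<close> applies at infinity.  At the other points only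
  nonnegative powers of \<open>T\<close> act on \<open>v\<^sup>*\<close>, which leaves \<open>e v\<^sup>* = 0\<close>, \<open>h v\<^sup>* = m v\<^sup>*\<close> and \<open>f v\<^sup>* = m (f v)\<^sup>*\<close>.
  Hence \<open>d \<eta>\<^sup>0 = \<eta>\<^sup>1 \<partial>\<close> becomes the partial fraction expansion of the products \<open>(t - z\<^sub>j)\<^sup>-\<^sup>1 u\<close> with a basis
  element \<open>u\<close>.  Injectivity follows by pairing with PBW vectors, and for \<open>\<eta>\<^sup>0\<close> already from the
  terms with \<open>f\<close>.
\<close>

subsection \<open>Linear maps on free vector spaces\<close>

text \<open>The dual vectors are given by a definite description, so nothing can be computed with
  them before both halves of the PBW theorem are at hand: independence makes \<open>Phi\<close> a
  functional on the Verma module and gives existence, spanning gives uniqueness. Two orders of the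
  letters are needed because two kinds of PBW bases are fixed; the parameter \<open>s\<close> treats
  both, and with them the finite points and infinity, at once. The 2 in \<kappa> = k + 2 is a count.
  Against a PBW vector starting with \<open>f/T^a\<close>, the central term gives a k,
  \<open>h\<close> gives m, and each of the a summands gives 2 through [h, f] = -2f. At infinity the
  sum is shorter by one and \<open>h\<close> changes sign, so the constant becomes a \<kappa> - (m +
  2) with m = \<open>m (n + 1)\<close>. On the de Rham side every t^a/(t - z_j) contains t^(a-1)
  with coefficient 1, which produces a \<kappa> minus the sum of the m_j. The value prescribed for
  \<open>m (n + 1)\<close> makes these two agree.\<close>

abbreviation pm_linear :: "(('a \<Rightarrow>\<^sub>0 complex) \<Rightarrow> ('b \<Rightarrow>\<^sub>0 complex)) \<Rightarrow> bool" where
  "pm_linear \<equiv> Vector_Spaces.linear pm_scale pm_scale"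

abbreviation unit :: "'a \<Rightarrow> ('a \<Rightarrow>\<^sub>0 complex)" where
  "unit a \<equiv> Poly_Mapping.single a 1"

lemma pm_linear_lift: "pm_linear (pm_lift h)"
  by unfold_locales (simp_all add: pm_lift_add pm_lift_scale)

lemma pm_lift_units [simp]: "pm_lift unit x = x"
proof (rule poly_mapping_eqI)
  fix a
  have "Poly_Mapping.lookup (pm_lift unit x) a
      = (\<Sum>b\<in>Poly_Mapping.keys x. if b = a then Poly_Mapping.lookup x b else 0)"
    unfolding pm_lift_def lookup_sum by (intro sum.cong) (auto simp: lookup_single when_def)
  then show "Poly_Mapping.lookup (pm_lift unit x) a = Poly_Mapping.lookup x a"
    by (simp add: in_keys_iff)
qed

lemma pm_linear_conv_lift:
  assumes "Vector_Spaces.linear pm_scale s f"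
  shows "f x = (\<Sum>a\<in>Poly_Mapping.keys x. s (Poly_Mapping.lookup x a) (f (unit a)))"
proof -
  interpret Vector_Spaces.linear pm_scale s f by fact
  have "f x = f (pm_lift unit x)" by simp
  then show ?thesis
    unfolding pm_lift_def sum scale .
qed

lemma pm_linear_eqI:
  assumes "Vector_Spaces.linear pm_scale s f" "Vector_Spaces.linear pm_scale s g"
    and "\<And>a. a \<in> Poly_Mapping.keys x \<Longrightarrow> f (unit a) = g (unit a)"
  shows "f x = g x"
  unfolding pm_linear_conv_lift[OF assms(1), of x] pm_linear_conv_lift[OF assms(2), of x]
  using assms(3) by (intro sum.cong) auto

lemma pm_lift_cong:
  "(\<And>a. a \<in> Poly_Mapping.keys x \<Longrightarrow> h a = g a) \<Longrightarrow> pm_lift h x = pm_lift g x"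
  unfolding pm_lift_def by (intro sum.cong) auto

lemma pm_lift_plus_fun: "pm_lift (\<lambda>a. h a + g a) x = pm_lift h x + pm_lift g x"
  by (simp add: pm_lift_def pm.scale_right_distrib sum.distrib)

lemma pm_lift_minus_fun: "pm_lift (\<lambda>a. h a - g a) x = pm_lift h x - pm_lift g x"
  by (simp add: pm_lift_def pm.scale_right_diff_distrib sum_subtractf)

lemma pm_lift_uminus: "pm_lift h (- x) = - pm_lift h x"
  using pm_lift_diff[of h 0 x] by simp

lemma keys_pm_lift: "Poly_Mapping.keys (pm_lift h x) \<subseteq> (\<Union>a\<in>Poly_Mapping.keys x. Poly_Mapping.keys (h a))"
proof
  fix b assume "b \<in> Poly_Mapping.keys (pm_lift h x)"
  then have "(\<Sum>a\<in>Poly_Mapping.keys x. Poly_Mapping.lookup x a * Poly_Mapping.lookup (h a) b) \<noteq> 0"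
    by (simp add: in_keys_iff pm_lift_def lookup_sum)
  then obtain a where "a \<in> Poly_Mapping.keys x" "Poly_Mapping.lookup x a * Poly_Mapping.lookup (h a) b \<noteq> 0"
    by (meson sum.not_neutral_contains_not_neutral)
  then show "b \<in> (\<Union>a\<in>Poly_Mapping.keys x. Poly_Mapping.keys (h a))"
    by (auto simp: in_keys_iff)
qed

lemma keys_pm_liftE:
  assumes "b \<in> Poly_Mapping.keys (pm_lift h x)"
  obtains a where "a \<in> Poly_Mapping.keys x" "b \<in> Poly_Mapping.keys (h a)"
  using assms keys_pm_lift by fast

lemma keys_addE:
  fixes x y :: "'a \<Rightarrow>\<^sub>0 complex"
  assumes "b \<in> Poly_Mapping.keys (x + y)"
  obtains "b \<in> Poly_Mapping.keys x" | "b \<in> Poly_Mapping.keys y"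
  using assms by (fastforce simp: in_keys_iff lookup_add)

lemma keys_diffE:
  fixes x y :: "'a \<Rightarrow>\<^sub>0 complex"
  assumes "b \<in> Poly_Mapping.keys (x - y)"
  obtains "b \<in> Poly_Mapping.keys x" | "b \<in> Poly_Mapping.keys y"
  using assms by (fastforce simp: in_keys_iff lookup_minus)

lemma pm_lift_in_subspace:
  assumes "pm.subspace S" "\<And>a. a \<in> Poly_Mapping.keys x \<Longrightarrow> h a \<in> S"
  shows "pm_lift h x \<in> S"
  unfolding pm_lift_def using assms by (intro pm.subspace_sum pm.subspace_scale) auto

subsection \<open>Straightening of words\<close>

text \<open>
  The straightening operators \<open>act x\<close> make the span of the sorted words a module over the Lie
  algebra with structure constants \<open>br\<close>: one has \<open>x \<cdot> (y # w) = y \<cdot> (x \<cdot> w) + [x, y] \<cdot> w\<close> if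
  \<open>x\<close> is not allowed in front of \<open>y\<close>.  The leading term \<open>y # ins x w\<close> is split off to make the
  recursion on the length of the word terminate; \<open>actN\<close> carries a bound for this length.
\<close>

locale lie_basis =
  fixes le :: "'a \<Rightarrow> 'a \<Rightarrow> bool" and br :: "'a \<Rightarrow> 'a \<Rightarrow> ('a \<Rightarrow>\<^sub>0 complex)"
  assumes le_total: "le x y \<or> le y x"
    and le_trans: "le x y \<Longrightarrow> le y z \<Longrightarrow> le x z"
    and le_antisym: "le x y \<Longrightarrow> le y x \<Longrightarrow> x = y"
    and br_anti: "br y x = - br x y"
    and jacobi: "pm_lift (br x) (br y z) + pm_lift (br y) (br z x) + pm_lift (br z) (br x y) = 0"
begin

section \<open>The straightening operators\<close>

fun ins :: "'a \<Rightarrow> 'a list \<Rightarrow> 'a list" where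
  "ins x [] = [x]"
| "ins x (y # w) = (if le x y then x # y # w else y # ins x w)"

abbreviation srt :: "'a list \<Rightarrow> bool" where
  "srt \<equiv> sorted_wrt le"

lemma set_ins [simp]: "set (ins x w) = insert x (set w)"
  by (induction w) auto

lemma length_ins [simp]: "length (ins x w) = Suc (length w)"
  by (induction w) auto

lemma srt_ins: "srt w \<Longrightarrow> srt (ins x w)"
  by (induction w) (use le_total le_trans in auto)

fun actN :: "nat \<Rightarrow> 'a \<Rightarrow> 'a list \<Rightarrow> ('a list \<Rightarrow>\<^sub>0 complex)" where
  "actN n x [] = unit [x]"
| "actN 0 x (y # w) = 0"
| "actN (Suc n) x (y # w) =
     (if le x y then unit (x # y # w)
      else unit (y # ins x w) + pm_lift (actN n y) (actN n x w - unit (ins x w))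
        + pm_lift (\<lambda>z. actN n z w) (br x y))"

text \<open>The word \<open>y # ins x w'\<close> is the leading term. In all other terms
  \<open>y\<close> meets only words no longer than \<open>w'\<close>, by induction, or a bracket has
  shortened the word.\<close>

lemma actN_lower:
  "length w \<le> n \<Longrightarrow> u \<in> Poly_Mapping.keys (actN n x w - unit (ins x w)) \<Longrightarrow> length u \<le> length w"
proof (induction n arbitrary: x w u)
  case (Suc n)
  show ?case
  proof (cases w)
    case (Cons y w')
    show ?thesis
    proof (cases "le x y")
      case False
      have *: "length v \<le> Suc (length w'')" if "v \<in> Poly_Mapping.keys (actN n a w'')" "length w'' \<le> n" for v w'' a
      proof (cases "v = ins a w''")
        case False
        then have "v \<in> Poly_Mapping.keys (actN n a w'' - unit (ins a w''))"
          using that by (simp add: in_keys_iff lookup_minus lookup_single)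
        then show ?thesis using Suc.IH[OF that(2)] by fastforce
      qed simp
      have "u \<in> Poly_Mapping.keys (pm_lift (actN n y) (actN n x w' - unit (ins x w'))
          + pm_lift (\<lambda>z. actN n z w') (br x y))"
        using Suc.prems(2) False Cons by (simp add: algebra_simps)
      then consider v where "v \<in> Poly_Mapping.keys (actN n x w' - unit (ins x w'))"
          "u \<in> Poly_Mapping.keys (actN n y v)"
        | z where "u \<in> Poly_Mapping.keys (actN n z w')"
        by (elim keys_addE keys_pm_liftE) blast+
      then show ?thesis
      proof cases
        case 1
        then have "length v \<le> length w'" using Suc.IH[of w' v x] Suc.prems Cons by simp
        then show ?thesis using *[OF 1(2)] Suc.prems Cons by simp
      next
        case 2
        then show ?thesis using *[OF 2] Suc.prems Cons by simp
      qed
    qed (use Suc Cons in auto)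
  qed (use Suc in auto)
qed auto

text \<open>By \<open>actN_lower\<close> every recursive call is made on a word no longer than the
  remaining bound, so the clause with value 0 is never reached and \<open>act\<close> can do without
  the bound.\<close>

lemma actN_fuel: "length w \<le> n \<Longrightarrow> actN (Suc n) x w = actN n x w"
proof (induction n arbitrary: x w)
  case (Suc n)
  show ?case
  proof (cases w)
    case (Cons y w')
    have l: "length w' \<le> n" using Suc.prems Cons by simp
    have "pm_lift (actN (Suc n) y) (actN (Suc n) x w' - unit (ins x w'))
        = pm_lift (actN n y) (actN n x w' - unit (ins x w'))"
      unfolding Suc.IH[OF l]
    proof (rule pm_lift_cong)
      fix v assume "v \<in> Poly_Mapping.keys (actN n x w' - unit (ins x w'))"
      then have "length v \<le> length w'" using actN_lower[OF l] by blast
      then show "actN (Suc n) y v = actN n y v"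
        using Suc.IH l by simp
    qed
    moreover have "pm_lift (\<lambda>z. actN (Suc n) z w') (br x y) = pm_lift (\<lambda>z. actN n z w') (br x y)"
      using Suc.IH[OF l] by (intro pm_lift_cong) simp
    ultimately show ?thesis
      unfolding Cons actN.simps(3)[of "Suc n"] actN.simps(3)[of n] by simp
  qed simp
qed simp

definition act :: "'a \<Rightarrow> 'a list \<Rightarrow> ('a list \<Rightarrow>\<^sub>0 complex)" where
  "act x w = actN (length w) x w"

lemma actN_eq_act: "length w \<le> n \<Longrightarrow> actN n x w = act x w"
  by (induction n rule: dec_induct) (simp_all add: act_def actN_fuel)

lemma act_Nil [simp]: "act x [] = unit [x]"
  by (simp add: act_def)

lemma act_le [simp]: "le x y \<Longrightarrow> act x (y # w) = unit (x # y # w)"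
  by (simp add: act_def)

lemma act_lower: "u \<in> Poly_Mapping.keys (act x w - unit (ins x w)) \<Longrightarrow> length u \<le> length w"
  unfolding act_def using actN_lower by blast

lemma act_not_le:
  assumes "\<not> le x y"
  shows "act x (y # w) = unit (y # ins x w) + pm_lift (act y) (act x w - unit (ins x w))
     + pm_lift (\<lambda>z. act z w) (br x y)"
proof -
  have "pm_lift (actN (length w) y) (act x w - unit (ins x w)) = pm_lift (act y) (act x w - unit (ins x w))"
    using act_lower by (intro pm_lift_cong actN_eq_act) blast
  then show ?thesis
    using assms by (simp add: act_def)
qed

lemma act_hd: "srt (y # w) \<Longrightarrow> act y w = unit (y # w)"
  by (cases w) auto

abbreviation op :: "'a \<Rightarrow> ('a list \<Rightarrow>\<^sub>0 complex) \<Rightarrow> ('a list \<Rightarrow>\<^sub>0 complex)" where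
  "op x \<equiv> pm_lift (act x)"

abbreviation opl :: "('a \<Rightarrow>\<^sub>0 complex) \<Rightarrow> ('a list \<Rightarrow>\<^sub>0 complex) \<Rightarrow> ('a list \<Rightarrow>\<^sub>0 complex)" where
  "opl p s \<equiv> pm_lift (\<lambda>z. op z s) p"

text \<open>For sorted words the splitting of the leading term can be undone:
  \<open>y # ins x w\<close> is again sorted, hence equal to \<open>y\<close> applied to
  \<open>ins x w\<close>.\<close>

lemma act_srt:
  assumes "\<not> le x y" "srt (y # w)"
  shows "act x (y # w) = op y (act x w) + opl (br x y) (unit w)"
proof -
  have "srt (y # ins x w)"
    using assms le_total srt_ins by auto
  then show ?thesis
    using assms by (simp add: act_not_le pm_lift_diff act_hd)
qed

lemma act_keys_srt: "srt w \<Longrightarrow> u \<in> Poly_Mapping.keys (act x w) \<Longrightarrow> srt u"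
proof (induction "length w" arbitrary: x w u rule: less_induct)
  case less
  show ?case
  proof (cases w)
    case (Cons y w')
    show ?thesis
    proof (cases "le x y")
      case False
      have sw: "srt w'" using less.prems Cons by simp
      have "srt (y # ins x w')"
        using less.prems Cons False le_total srt_ins by auto
      from less.prems(2) consider "u = y # ins x w'"
        | v where "v \<in> Poly_Mapping.keys (act x w' - unit (ins x w'))" "u \<in> Poly_Mapping.keys (act y v)"
        | z where "u \<in> Poly_Mapping.keys (act z w')"
        unfolding Cons act_not_le[OF False] by (elim keys_addE keys_pm_liftE) auto
      then show ?thesis
      proof cases
        case 1 then show ?thesis using \<open>srt (y # ins x w')\<close> by simp
      next
        case 2
        have "v \<in> Poly_Mapping.keys (act x w') \<or> v = ins x w'"
          using 2(1) by (elim keys_diffE) auto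
        then have "srt v" using less.hyps[of w' v x] sw srt_ins Cons by auto
        then show ?thesis using less.hyps[of v u y] act_lower[OF 2(1)] 2(2) Cons by simp
      next
        case 3
        then show ?thesis using less.hyps[of w' u z] sw Cons by simp
      qed
    qed (use less le_trans Cons in auto)
  qed (use less in auto)
qed

section \<open>Properties of words preserved by straightening\<close>

definition stable :: "('a list \<Rightarrow> bool) \<Rightarrow> bool" where
  "stable Q \<longleftrightarrow> (\<forall>u a b v. Q (u @ a # b # v) \<longrightarrow>
     Q (u @ b # a # v) \<and> (\<forall>c\<in>Poly_Mapping.keys (br a b). Q (u @ c # v)))"

lemma stable_Cons: "stable Q \<Longrightarrow> stable (\<lambda>w. Q (x # w))"
  unfolding stable_def by (metis append_Cons)

lemma stable_ins: "stable Q \<Longrightarrow> Q (x # w) \<Longrightarrow> Q (ins x w)"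
proof (induction w arbitrary: Q)
  case (Cons y w)
  have "Q (y # x # w)"
    using Cons.prems unfolding stable_def by (metis append_Nil)
  then show ?case using Cons.IH[OF stable_Cons[OF Cons.prems(1)]] Cons.prems by simp
qed simp

text \<open>The induction varies \<open>Q\<close>: behind a leading letter \<open>y\<close> the
  hypothesis is needed for \<open>\<lambda>w. Q (y # w)\<close>, which is stable again.\<close>

lemma act_keys_stable: "stable Q \<Longrightarrow> Q (x # w) \<Longrightarrow> u \<in> Poly_Mapping.keys (act x w) \<Longrightarrow> Q u"
proof (induction "length w" arbitrary: x w u Q rule: less_induct)
  case less
  show ?case
  proof (cases w)
    case (Cons y w')
    have Q: "Q (y # x # w')" "\<And>c. c \<in> Poly_Mapping.keys (br x y) \<Longrightarrow> Q (c # w')"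
      using less.prems(1,2) unfolding stable_def Cons by (metis append_Nil)+
    show ?thesis
    proof (cases "le x y")
      case False
      from less.prems(3) consider "u = y # ins x w'"
        | v where "v \<in> Poly_Mapping.keys (act x w' - unit (ins x w'))" "u \<in> Poly_Mapping.keys (act y v)"
        | z where "z \<in> Poly_Mapping.keys (br x y)" "u \<in> Poly_Mapping.keys (act z w')"
        unfolding Cons act_not_le[OF False] by (elim keys_addE keys_pm_liftE) auto
      then show ?thesis
      proof cases
        case 1 then show ?thesis
          using stable_ins[OF stable_Cons[OF less.prems(1)]] Q(1) by simp
      next
        case 2
        have "v \<in> Poly_Mapping.keys (act x w') \<or> v = ins x w'"
          using 2(1) by (elim keys_diffE) auto
        then have "Q (y # v)"
          using less.hyps[of w' "\<lambda>w. Q (y # w)" x v] stable_ins[OF stable_Cons[OF less.prems(1)]]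
            stable_Cons[OF less.prems(1)] Q(1) Cons by auto
        then show ?thesis using less.hyps[of v Q y u] act_lower[OF 2(1)] 2(2) Cons less.prems by simp
      next
        case 3
        then show ?thesis using less.hyps[of w' Q z u] Q(2) less.prems(1) Cons by simp
      qed
    qed (use less Cons in auto)
  qed (use less in auto)
qed

section \<open>Commutators of straightening operators\<close>

lemma op_opl: "op x (opl p s) = pm_lift (\<lambda>z. op x (op z s)) p"
  by (simp add: pm_lift_comp)

lemma opl_lift: "opl (pm_lift h p) s = pm_lift (\<lambda>z. opl (h z) s) p"
  by (simp add: pm_lift_comp)

lemma comm_words_imp_comm:
  assumes "\<And>w. w \<in> Poly_Mapping.keys s \<Longrightarrow> op x (act y w) = op y (act x w) + opl (br x y) (unit w)"
  shows "op x (op y s) = op y (op x s) + opl (br x y) s"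
proof -
  have "op x (op y s) = pm_lift (\<lambda>w. op y (act x w) + opl (br x y) (unit w)) s"
    unfolding pm_lift_comp by (rule pm_lift_cong) (rule assms)
  also have "\<dots> = op y (op x s) + pm_lift (\<lambda>w. pm_lift (\<lambda>z. act z w) (br x y)) s"
    by (simp add: pm_lift_plus_fun pm_lift_comp)
  also have "pm_lift (\<lambda>w. pm_lift (\<lambda>z. act z w) (br x y)) s = opl (br x y) s"
    by (rule pm_lift_swap)
  finally show ?thesis .
qed

text \<open>This makes the span of the sorted words a representation, from which independence of the
  PBW monomials follows. By antisymmetry \<open>x\<close> may be taken above \<open>y\<close>. If
  \<open>y\<close> may stand in front of \<open>w\<close>, this is \<open>act_srt\<close>. Otherwise
  \<open>w = z # w'\<close> with \<open>z\<close> below both; writing \<open>w\<close> as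
  \<open>z\<close> applied to \<open>w'\<close> and moving \<open>z\<close> to the front leaves
  double brackets that cancel by the Jacobi identity.\<close>

lemma act_comm:
  "srt w \<Longrightarrow> op x (act y w) = op y (act x w) + opl (br x y) (unit w)"
proof (induction "length w" arbitrary: x y w rule: less_induct)
  case less
  have IH: "op x (op y s) = op y (op x s) + opl (br x y) s"
    if "\<And>u. u \<in> Poly_Mapping.keys s \<Longrightarrow> srt u \<and> length u < length w" for x y s
    using that by (intro comm_words_imp_comm less.hyps) auto
  have IHl: "opl p (op y s) = op y (opl p s) + opl (pm_lift (\<lambda>z. br z y) p) s"
    if "\<And>u. u \<in> Poly_Mapping.keys s \<Longrightarrow> srt u \<and> length u < length w" for p y s
  proof -
    have "opl p (op y s) = pm_lift (\<lambda>z. op y (op z s) + opl (br z y) s) p"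
      by (rule pm_lift_cong) (rule IH[OF that])
    then show ?thesis by (simp only: pm_lift_plus_fun op_opl opl_lift)
  qed
  have easy: "op x (act y w) = op y (act x w) + opl (br x y) (unit w)"
    if "srt (y # w)" "\<not> le x y" for x y w
    using that act_srt[OF that(2,1)] by (simp add: act_hd)
  have main: "op x (act y w) = op y (act x w) + opl (br x y) (unit w)" if xy: "\<not> le x y" for x y
  proof (cases "srt (y # w)")
    case False
    then obtain z w' where w: "w = z # w'" and zy: "\<not> le y z"
      using less.prems le_trans by (cases w) auto
    have zx: "\<not> le x z" and "le z y" using xy zy le_trans le_total by blast+
    have sw: "srt w'" and sz: "srt (z # w')" using less.prems w by auto
    let ?s = "unit w'"
    have s: "srt u \<and> length u < length w" if "u \<in> Poly_Mapping.keys ?s" for u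
      using that sw w by simp
    have IHs: "op a (op b ?s) = op b (op a ?s) + opl (br a b) ?s" for a b
      using IH[of ?s a b] s by blast
    have IHls: "opl p (op a ?s) = op a (opl p ?s) + opl (pm_lift (\<lambda>z. br z a) p) ?s" for a p
      using IHl[of ?s a p] s by blast
    \<comment> \<open>The leading term of \<open>op y\<close> applied to \<open>w'\<close> is as
      long as \<open>w\<close>, so the induction hypothesis does not cover it; but it stays sorted
      with \<open>z\<close> in front, so \<open>easy\<close> applies. The remaining terms are
      shorter than \<open>w\<close>.\<close>
    have xz: "op x (op z (op y ?s)) = op z (op x (op y ?s)) + opl (br x z) (op y ?s)"
     and yz: "op y (op z (op x ?s)) = op z (op y (op x ?s)) + opl (br y z) (op x ?s)"
    proof -
      have "op a (op z (op b ?s)) = op z (op a (op b ?s)) + opl (br a z) (op b ?s)"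
        if b: "\<not> le b z" and a: "\<not> le a z" for a b
      proof -
        let ?r = "act b w' - unit (ins b w')"
        have "srt u \<and> length u < length w" if "u \<in> Poly_Mapping.keys ?r" for u
        proof -
          have "u \<in> Poly_Mapping.keys (act b w') \<or> u = ins b w'"
            using that by (elim keys_diffE) auto
          then show ?thesis using act_keys_srt[OF sw] srt_ins[OF sw] act_lower[OF that] w by auto
        qed
        from IH[OF this] have "op a (op z ?r) = op z (op a ?r) + opl (br a z) ?r" by blast
        moreover have "op a (op z (unit (ins b w'))) = op z (op a (unit (ins b w'))) + opl (br a z) (unit (ins b w'))"
        proof -
          have "srt (z # ins b w')" using sz srt_ins le_total b by auto
          then show ?thesis using easy[OF _ a] by simp
        qed
        moreover have "op b ?s = ?r + unit (ins b w')" by simp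
        ultimately show ?thesis
          by (simp only: pm_lift_add pm_lift_plus_fun) (simp only: add_ac)
      qed
      then show "op x (op z (op y ?s)) = op z (op x (op y ?s)) + opl (br x z) (op y ?s)"
        "op y (op z (op x ?s)) = op z (op y (op x ?s)) + opl (br y z) (op x ?s)"
        using zx zy by blast+
    qed
    have "op x (act y w) = op x (op z (op y ?s)) + op x (opl (br y z) ?s)"
      using act_srt[OF zy sz] w by (simp add: pm_lift_add)
    also have "\<dots> = op z (op x (op y ?s)) + opl (br x z) (op y ?s) + op x (opl (br y z) ?s)"
      using xz by simp
    also have "op x (op y ?s) = op y (op x ?s) + opl (br x y) ?s"
      by (rule IHs)
    finally have 1: "op x (act y w) = op z (op y (op x ?s)) + op z (opl (br x y) ?s)
        + (op y (opl (br x z) ?s) + opl (pm_lift (\<lambda>c. br c y) (br x z)) ?s) + op x (opl (br y z) ?s)"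
      unfolding IHls pm_lift_add .
    have "op y (act x w) = op y (op z (op x ?s)) + op y (opl (br x z) ?s)"
      using act_srt[OF zx sz] w by (simp add: pm_lift_add)
    also have "\<dots> = op z (op y (op x ?s)) + opl (br y z) (op x ?s) + op y (opl (br x z) ?s)"
      using yz by simp
    finally have 2: "op y (act x w) = op z (op y (op x ?s))
        + (op x (opl (br y z) ?s) + opl (pm_lift (\<lambda>c. br c x) (br y z)) ?s) + op y (opl (br x z) ?s)"
      unfolding IHls .
    have 3: "opl (br x y) (unit w) = op z (opl (br x y) ?s) + opl (pm_lift (\<lambda>c. br c z) (br x y)) ?s"
      using IHls[of z "br x y"] act_hd[OF sz] w by simp
    \<comment> \<open>Once the other terms of 1, 2 and 3 are compared, this form of the Jacobi
      identity is all that remains.\<close>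
    have "pm_lift (\<lambda>c. br c y) (br x z) = pm_lift (\<lambda>c. br c x) (br y z) + pm_lift (\<lambda>c. br c z) (br x y)"
    proof -
      have *: "pm_lift (\<lambda>c. br c a) p = - pm_lift (br a) p" for a p
        unfolding br_anti[of _ a] pm_lift_def by (simp add: sum_negf)
      show ?thesis
        using jacobi[of x y z] unfolding * br_anti[of x z] pm_lift_uminus
        by (simp add: algebra_simps eq_neg_iff_add_eq_0)
    qed
    then show ?thesis unfolding 1 2 3 by (simp add: pm_lift_add add_ac)
  qed (use easy xy in blast)
  show ?case
  proof (cases "le x y")
    case True
    show ?thesis
    proof (cases "le y x")
      case False
      show ?thesis using main[OF False] br_anti[of x y] by (simp add: pm_lift_uminus)
    next
      case b: True
      have "br x x = 0"
      proof (rule poly_mapping_eqI)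
        fix c
        have "Poly_Mapping.lookup (br x x) c = Poly_Mapping.lookup (- br x x) c"
          using br_anti[of x x] by (rule arg_cong)
        then show "Poly_Mapping.lookup (br x x) c = Poly_Mapping.lookup 0 c" by simp
      qed
      then show ?thesis using le_antisym[OF True b] by simp
    qed
  qed (rule main)
qed

lemma op_comm:
  assumes "\<And>w. w \<in> Poly_Mapping.keys s \<Longrightarrow> srt w"
  shows "op x (op y s) = op y (op x s) + opl (br x y) s"
  using assms by (intro comm_words_imp_comm act_comm)

section \<open>Normal forms of words\<close>

primrec nf :: "'a list \<Rightarrow> ('a list \<Rightarrow>\<^sub>0 complex)" where
  "nf [] = unit []"
| "nf (x # w) = op x (nf w)"

lemma nf_srt: "u \<in> Poly_Mapping.keys (nf w) \<Longrightarrow> srt u"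
proof (induction w arbitrary: u)
  case (Cons x w)
  then show ?case using keys_pm_lift[of "act x" "nf w"] act_keys_srt by fastforce
qed simp

lemma nf_of_srt: "srt w \<Longrightarrow> nf w = unit w"
  by (induction w) (auto simp: act_hd)

text \<open>Applied to the weight of a word and to the words in nonnegative letters, which span a
  subalgebra.\<close>

lemma nf_stable: "stable Q \<Longrightarrow> Q w \<Longrightarrow> u \<in> Poly_Mapping.keys (nf w) \<Longrightarrow> Q u"
proof (induction w arbitrary: Q u)
  case (Cons x w)
  then obtain v where v: "v \<in> Poly_Mapping.keys (nf w)" "u \<in> Poly_Mapping.keys (act x v)"
    using keys_pm_lift[of "act x" "nf w"] by auto
  then have "Q (x # v)"
    using Cons.IH[OF stable_Cons[OF Cons.prems(1)] Cons.prems(2)] by blast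
  then show ?case using act_keys_stable[OF Cons.prems(1)] v(2) by blast
qed simp

lemma nf_append: "nf (u @ w) = pm_lift (\<lambda>v. nf (u @ v)) (nf w)"
proof (induction u)
  case Nil
  have "pm_lift nf (nf w) = pm_lift unit (nf w)"
    by (intro pm_lift_cong nf_of_srt nf_srt)
  then show ?case by simp
qed (simp add: pm_lift_comp)

text \<open>Hence \<open>nf\<close> factors through the enveloping algebra, and since it fixes
  sorted words, these are independent there. A prefix does no harm because \<open>nf\<close> applies
  its letters as linear operators, and \<open>nf v\<close> consists of sorted words, as
  \<open>op_comm\<close> requires.\<close>

lemma nf_relation:
  "nf (u @ x # y # v) = nf (u @ y # x # v) + pm_lift (\<lambda>c. nf (u @ c # v)) (br x y)"
proof (induction u)
  case Nil
  then show ?case using op_comm[of "nf v" x y] nf_srt by simp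
qed (simp add: pm_lift_add pm_lift_comp)

section \<open>Words modulo the Lie algebra relations\<close>

lemma stable_append: "stable Q \<Longrightarrow> stable (\<lambda>w. Q (u @ w))"
  unfolding stable_def by (metis append_assoc)

text \<open>The relations are demanded only for words with property \<open>Q\<close>, because the
  character of the nonnegative part kills them only between letters of that part.\<close>

definition rel_space :: "('a list \<Rightarrow> bool) \<Rightarrow> ('a list \<Rightarrow>\<^sub>0 complex) set \<Rightarrow> bool" where
  "rel_space Q J \<longleftrightarrow> pm.subspace J \<and> stable Q \<and>
     (\<forall>u a b v. Q (u @ a # b # v) \<longrightarrow>
        unit (u @ a # b # v) - unit (u @ b # a # v) - pm_lift (\<lambda>c. unit (u @ c # v)) (br a b) \<in> J)"

text \<open>The spanning half of PBW. The prefix \<open>u\<close> is arbitrary because the recursion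
  straightens behind the additional letter \<open>y\<close>; the four memberships below follow
  \<open>act_not_le\<close> term by term.\<close>

lemma act_mod:
  assumes J: "rel_space Q J" and "Q (u @ x # w)"
  shows "unit (u @ x # w) - pm_lift (\<lambda>v. unit (u @ v)) (act x w) \<in> J"
  using assms(2)
proof (induction "length w" arbitrary: u x w rule: less_induct)
  case less
  have sub: "pm.subspace J" and Q: "stable Q" using J by (simp_all add: rel_space_def)
  show ?case
  proof (cases w)
    case (Cons y w')
    have Qs: "Q (u @ y # x # w')" "\<And>c. c \<in> Poly_Mapping.keys (br x y) \<Longrightarrow> Q (u @ c # w')"
      using less.prems Q unfolding stable_def Cons by blast+
    show ?thesis
    proof (cases "le x y")
      case False
      let ?U = "\<lambda>v. unit (u @ v)"
      let ?r = "act x w' - unit (ins x w')"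
      have Qr: "Q (u @ y # v)" if "v \<in> Poly_Mapping.keys ?r" for v
      proof -
        have *: "stable (\<lambda>w. Q (u @ y # w))"
          using stable_Cons[OF stable_append[OF Q]] .
        show ?thesis using that
          by (elim keys_diffE) (use act_keys_stable[OF * Qs(1)] stable_ins[OF * Qs(1)] in auto)
      qed
      have 1: "unit (u @ x # w) - unit (u @ y # x # w') - pm_lift (\<lambda>c. ?U (c # w')) (br x y) \<in> J"
        using J Cons less.prems by (simp add: rel_space_def)
      have 2: "unit (u @ y # x # w') - pm_lift (\<lambda>v. ?U (y # v)) (act x w') \<in> J"
        using less.hyps[of w' "u @ [y]" x] Cons Qs by simp
      have 3: "pm_lift (\<lambda>v. ?U (y # v) - pm_lift ?U (act y v)) ?r \<in> J"
        using less.hyps act_lower Cons Qr by (intro pm_lift_in_subspace[OF sub]) fastforce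
      have 4: "pm_lift (\<lambda>c. ?U (c # w') - pm_lift ?U (act c w')) (br x y) \<in> J"
        using less.hyps Cons Qs by (intro pm_lift_in_subspace[OF sub]) simp
      have "unit (u @ x # w) - pm_lift ?U (act x w) =
        (unit (u @ x # w) - unit (u @ y # x # w') - pm_lift (\<lambda>c. ?U (c # w')) (br x y))
        + (unit (u @ y # x # w') - pm_lift (\<lambda>v. ?U (y # v)) (act x w'))
        + pm_lift (\<lambda>v. ?U (y # v) - pm_lift ?U (act y v)) ?r
        + pm_lift (\<lambda>c. ?U (c # w') - pm_lift ?U (act c w')) (br x y)"
        unfolding Cons act_not_le[OF False]
        by (simp add: pm_lift_add pm_lift_diff pm_lift_minus_fun pm_lift_comp)
      then show ?thesis using 1 2 3 4 by (simp only: pm.subspace_add[OF sub])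
    qed (use Cons sub in \<open>simp add: pm.subspace_0\<close>)
  qed (use sub in \<open>simp add: pm.subspace_0\<close>)
qed

lemma nf_mod:
  assumes J: "rel_space Q J" and "Q (u @ w)"
  shows "unit (u @ w) - pm_lift (\<lambda>v. unit (u @ v)) (nf w) \<in> J"
  using assms(2)
proof (induction w arbitrary: u)
  case Nil
  then show ?case using J by (simp add: pm.subspace_0 rel_space_def)
next
  case (Cons x w)
  have sub: "pm.subspace J" and Q: "stable Q" using J by (simp_all add: rel_space_def)
  have 1: "unit (u @ x # w) - pm_lift (\<lambda>v. unit (u @ x # v)) (nf w) \<in> J"
    using Cons.IH[of "u @ [x]"] Cons.prems by simp
  have 2: "pm_lift (\<lambda>w. unit (u @ x # w) - pm_lift (\<lambda>v. unit (u @ v)) (act x w)) (nf w) \<in> J"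
    using nf_stable[OF stable_Cons[OF stable_append[OF Q]] Cons.prems]
    by (intro pm_lift_in_subspace[OF sub] act_mod[OF J])
  have "unit (u @ x # w) - pm_lift (\<lambda>v. unit (u @ v)) (nf (x # w)) =
      (unit (u @ x # w) - pm_lift (\<lambda>v. unit (u @ x # v)) (nf w))
    + pm_lift (\<lambda>w. unit (u @ x # w) - pm_lift (\<lambda>v. unit (u @ v)) (act x w)) (nf w)"
    by (simp add: pm_lift_comp pm_lift_minus_fun)
  then show ?case using pm.subspace_add[OF sub 1 2] by (simp only:)
qed

lemma stable_True: "stable (\<lambda>_. True)"
  by (simp add: stable_def)

text \<open>Since \<open>nf\<close> works from the right end of a word, the left factor needs
  another argument than \<open>nf_append\<close>: the kernel of the right-hand side, as a map of the
  left factor, contains all relations, so \<open>nf_mod\<close> applies.\<close>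

lemma nf_append_left: "nf (w @ u) = pm_lift (\<lambda>v. nf (v @ u)) (nf w)"
proof -
  let ?J = "{t. pm_lift (\<lambda>v. nf (v @ u)) t = 0}"
  have rel: "pm_lift (\<lambda>v. nf (v @ u)) (unit (u' @ a # b # v) - unit (u' @ b # a # v)
      - pm_lift (\<lambda>c. unit (u' @ c # v)) (br a b)) = 0" for u' a b v
    using nf_relation[of u' a b "v @ u"] by (simp add: pm_lift_diff pm_lift_comp del: nf.simps)
  have "rel_space (\<lambda>_. True) ?J"
    unfolding rel_space_def pm.subspace_def using rel
    by (auto simp: stable_True pm_lift_add pm_lift_scale)
  from nf_mod[OF this, of "[]" w] show ?thesis
    by (simp add: pm_lift_diff)
qed

end

section \<open>Functionals on free vector spaces\<close>

definition pm_eval :: "('a \<Rightarrow> complex) \<Rightarrow> ('a \<Rightarrow>\<^sub>0 complex) \<Rightarrow> complex" where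
  "pm_eval h x = (\<Sum>a\<in>Poly_Mapping.keys x. Poly_Mapping.lookup x a * h a)"

lemma pm_eval_superset:
  assumes "finite A" "Poly_Mapping.keys x \<subseteq> A"
  shows "pm_eval h x = (\<Sum>a\<in>A. Poly_Mapping.lookup x a * h a)"
  unfolding pm_eval_def using assms
  by (intro sum.mono_neutral_left) (auto simp: in_keys_iff)

abbreviation functional_linear :: "(('a \<Rightarrow>\<^sub>0 complex) \<Rightarrow> complex) \<Rightarrow> bool" where
  "functional_linear \<equiv> Vector_Spaces.linear pm_scale (*)"

lemma vector_space_complex: "vector_space ((*) :: complex \<Rightarrow> complex \<Rightarrow> complex)"
  by standard (simp_all add: algebra_simps)

lemma functional_linearI:
  assumes "\<And>x y. f (x + y) = f x + f y" "\<And>c x. f (pm_scale c x) = c * f x"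
  shows "functional_linear f"
  unfolding Vector_Spaces.linear_def module_hom_def module_hom_axioms_def
  using assms vector_space_complex pm.vector_space_axioms
  by (auto simp: vector_space_def module_def)

lemma pm_eval_add: "pm_eval h (x + y) = pm_eval h x + pm_eval h y"
proof -
  let ?A = "Poly_Mapping.keys x \<union> Poly_Mapping.keys y"
  have "Poly_Mapping.keys (x + y) \<subseteq> ?A"
    by (rule Poly_Mapping.keys_add)
  then show ?thesis
    by (simp add: pm_eval_superset[of ?A] lookup_add algebra_simps sum.distrib)
qed

lemma pm_eval_scale: "pm_eval h (pm_scale c x) = c * pm_eval h x"
proof -
  have "Poly_Mapping.keys (pm_scale c x) \<subseteq> Poly_Mapping.keys x"
    by (auto simp: in_keys_iff)
  then show ?thesis
    by (simp add: pm_eval_superset[of "Poly_Mapping.keys x"] sum_distrib_left mult.assoc)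
qed

lemma linear_pm_eval: "functional_linear (pm_eval h)"
  by (intro functional_linearI pm_eval_add pm_eval_scale)

lemma pm_eval_single [simp]: "pm_eval h (Poly_Mapping.single a c) = c * h a"
  by (cases "c = 0") (simp_all add: pm_eval_def)

lemma pm_eval_zero [simp]: "pm_eval h 0 = 0"
  by (simp add: pm_eval_def)

lemma pm_eval_mult_fun: "pm_eval (\<lambda>a. c * h a) x = c * pm_eval h x"
  by (simp add: pm_eval_def sum_distrib_left mult.left_commute)

lemma pm_eval_diff: "pm_eval h (x - y) = pm_eval h x - pm_eval h y"
  by (metis add_diff_cancel diff_add_cancel pm_eval_add)

lemma pm_eval_sum: "pm_eval h (sum f A) = (\<Sum>a\<in>A. pm_eval h (f a))"
  by (induction A rule: infinite_finite_induct) (simp_all add: pm_eval_add)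

lemma pm_eval_lift: "pm_eval h (pm_lift g x) = pm_eval (\<lambda>a. pm_eval h (g a)) x"
  unfolding pm_lift_def pm_eval_def[of "\<lambda>a. pm_eval h (g a)"]
  by (simp add: pm_eval_sum pm_eval_scale)

lemma pm_eval_cong:
  "(\<And>a. a \<in> Poly_Mapping.keys x \<Longrightarrow> h a = g a) \<Longrightarrow> pm_eval h x = pm_eval g x"
  unfolding pm_eval_def by (intro sum.cong) auto

lemma functional_conv_eval: "functional_linear f \<Longrightarrow> f x = pm_eval (\<lambda>a. f (unit a)) x"
  unfolding pm_eval_def by (rule pm_linear_conv_lift)

subsection \<open>Ordered bases of the affine Lie algebra\<close>

lemma basis_bracket_Central [simp]: "basis_bracket x Central = 0"
  by (cases x) auto

lemma basis_bracket_anti: "basis_bracket y x = - basis_bracket x y"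
proof (cases "x = Central \<or> y = Central")
  case False
  then obtain a i b j where *: "x = Loop a i" "y = Loop b j"
    by (meson aff_basis.exhaust)
  have "of_int j = (- of_int i :: complex)" if "i + j = 0"
  proof -
    have "j = - i" using that by simp
    then show ?thesis by simp
  qed
  then show ?thesis unfolding *
    by (intro poly_mapping_eqI; cases a; cases b)
      (auto simp: loop_def central_def add.commute lookup_add lookup_single lookup_minus when_def)
qed auto

text \<open>The central term of the inner bracket is killed by the outer one.\<close>

lemma bracket_basis_bracket:
  "pm_lift (basis_bracket x) (basis_bracket (Loop b j) (Loop c l))
    = pm_lift (\<lambda>t. basis_bracket x (Loop t (j + l))) (sl2_bracket b c)"
  by (simp add: pm_lift_add pm_lift_comp loop_def central_def)

lemma basis_bracket_jacobi:
  "pm_lift (basis_bracket x) (basis_bracket y z) + pm_lift (basis_bracket y) (basis_bracket z x)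
     + pm_lift (basis_bracket z) (basis_bracket x y) = 0"
proof (cases "x = Central \<or> y = Central \<or> z = Central")
  case True
  have *: "pm_lift (basis_bracket Central) p = 0" for p
    by (simp add: pm_lift_def)
  with True show ?thesis
    by (auto simp: *)
next
  case False
  then obtain a i b j c l where *: "x = Loop a i" "y = Loop b j" "z = Loop c l"
    by (meson aff_basis.exhaust)
  show ?thesis
  \<comment> \<open>Central terms occur only if the three modes add up to zero, and then they
    cancel. Otherwise only the Jacobi identity of \<open>sl2\<close> is left.\<close>
  proof (cases "l = - i - j")
    case True
    show ?thesis
      unfolding * bracket_basis_bracket True
      by (intro poly_mapping_eqI; cases a; cases b; cases c)
        (simp_all add: loop_def central_def lookup_add lookup_single when_def algebra_simps)
  next
    case False
    then have ne: "i + (j + l) \<noteq> 0" "j + (l + i) \<noteq> 0" "l + (i + j) \<noteq> 0" by auto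
    have eq: "j + (l + i) = i + (j + l)" "l + (i + j) = i + (j + l)" by auto
    show ?thesis
      unfolding * bracket_basis_bracket
      by (intro poly_mapping_eqI; cases a; cases b; cases c)
        (simp_all add: loop_def central_def lookup_add lookup_single when_def ne eq)
  qed
qed

text \<open>The letters of the subalgebra generated by \<open>f_1 = f\<close> and
  \<open>f_2 = e/T\<close>: all negative modes, and \<open>f\<close> itself. The other letters act
  on the generating vector by a character.\<close>

fun negL :: "aff_basis \<Rightarrow> bool" where
  "negL (Loop a i) \<longleftrightarrow> i < 0 \<or> a = sl_f \<and> i = 0"
| "negL Central \<longleftrightarrow> False"

text \<open>
  The letters of the negative part precede the others.  Among them, \<open>f\<close> comes first and \<open>e\<close> last
  if \<open>s\<close> holds, which gives the PBW bases in the degrees \<open>(p\<^sub>1, p\<^sub>2)\<close> with \<open>p\<^sub>1 > p\<^sub>2\<close>, and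
  vice versa otherwise.
\<close>

fun grp :: "bool \<Rightarrow> aff_basis \<Rightarrow> nat" where
  "grp s (Loop a i) = (if negL (Loop a i)
     then (case a of sl_h \<Rightarrow> 1 | sl_f \<Rightarrow> if s then 0 else 2 | sl_e \<Rightarrow> if s then 2 else 0)
     else (case a of sl_f \<Rightarrow> 3 | sl_h \<Rightarrow> 4 | sl_e \<Rightarrow> 5))"
| "grp s Central = 6"

fun idx :: "aff_basis \<Rightarrow> int" where
  "idx (Loop a i) = i"
| "idx Central = 0"

text \<open>Within a group the modes increase, so the exponents i of 1/T^i decrease weakly along a
  sorted word, as the PBW bases require.\<close>

definition ale :: "bool \<Rightarrow> aff_basis \<Rightarrow> aff_basis \<Rightarrow> bool" where
  "ale s x y \<longleftrightarrow> grp s x < grp s y \<or> grp s x = grp s y \<and> idx x \<le> idx y"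

lemma grp_negL: "grp s x \<le> 2 \<longleftrightarrow> negL x"
  by (cases x) (auto split: sl2.splits)

lemma grp_idx_inj: "grp s x = grp s y \<Longrightarrow> idx x = idx y \<Longrightarrow> x = y"
  by (cases x; cases y) (auto split: sl2.splits if_splits)

global_interpretation aff: lie_basis "ale s" basis_bracket for s
proof
  fix x y z
  show "ale s x y \<or> ale s y x" by (auto simp: ale_def)
  show "ale s x y \<Longrightarrow> ale s y z \<Longrightarrow> ale s x z" by (auto simp: ale_def)
  show "ale s x y \<Longrightarrow> ale s y x \<Longrightarrow> x = y" by (rule grp_idx_inj[of s]) (auto simp: ale_def)
  show "basis_bracket y x = - basis_bracket x y" by (rule basis_bracket_anti)
  show "pm_lift (basis_bracket x) (basis_bracket y z) + pm_lift (basis_bracket y) (basis_bracket z x)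
     + pm_lift (basis_bracket z) (basis_bracket x y) = 0" by (rule basis_bracket_jacobi)
qed

lemma ale_negL: "ale s x y \<Longrightarrow> negL y \<Longrightarrow> negL x"
  unfolding ale_def grp_negL[of s, symmetric] by auto

lemma negL_ale: "negL x \<Longrightarrow> \<not> negL y \<Longrightarrow> ale s x y"
  unfolding ale_def grp_negL[of s, symmetric] by auto

lemma basis_bracket_keys_nonneg:
  "c \<in> Poly_Mapping.keys (basis_bracket a b) \<Longrightarrow> \<not> negL a \<Longrightarrow> \<not> negL b \<Longrightarrow> \<not> negL c"
proof (cases "a = Central \<or> b = Central")
  case False
  then obtain x i y j where "a = Loop x i" "b = Loop y j"
    by (meson aff_basis.exhaust)
  then show "c \<in> Poly_Mapping.keys (basis_bracket a b) \<Longrightarrow> \<not> negL a \<Longrightarrow> \<not> negL b \<Longrightarrow> \<not> negL c"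
    by (cases x; cases y) (auto simp: loop_def central_def elim!: keys_addE split: if_splits)
qed auto

subsection \<open>PBW coefficients as functionals on words\<close>

text \<open>The degree, extended to all letters so that it is additive under brackets: (1,0) for
  \<open>f_1 = f\<close> and (0,1) for \<open>f_2 = e/T\<close>.\<close>

fun d1 :: "aff_basis \<Rightarrow> int" where
  "d1 (Loop a i) = - i + (case a of sl_f \<Rightarrow> 1 | sl_h \<Rightarrow> 0 | sl_e \<Rightarrow> -1)"
| "d1 Central = 0"

fun d2 :: "aff_basis \<Rightarrow> int" where
  "d2 (Loop a i) = - i"
| "d2 Central = 0"

definition wt :: "aff_basis list \<Rightarrow> int \<times> int" where
  "wt w = (sum_list (map d1 w), sum_list (map d2 w))"

lemma wt_simps [simp]:
  "wt [] = 0" "wt (x # w) = (d1 x, d2 x) + wt w" "wt (u @ w) = wt u + wt w"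
  by (simp_all add: wt_def zero_prod_def)

lemma basis_bracket_keys_wt:
  assumes "c \<in> Poly_Mapping.keys (basis_bracket a b)"
  shows "d1 c = d1 a + d1 b \<and> d2 c = d2 a + d2 b"
proof (cases "a = Central \<or> b = Central")
  case False
  then obtain x i y j where "a = Loop x i" "b = Loop y j"
    by (meson aff_basis.exhaust)
  then show ?thesis using assms
    by (cases x; cases y) (auto simp: loop_def central_def elim!: keys_addE split: if_splits)
qed (use assms in auto)

lemma stable_wt: "aff.stable (\<lambda>w. wt w = \<gamma>)"
  unfolding lie_basis.stable_def[OF aff.lie_basis_axioms]
  using basis_bracket_keys_wt by (auto simp: add_ac)

lemma stable_nonneg: "aff.stable (\<lambda>w. \<forall>x\<in>set w. \<not> negL x)"
  unfolding lie_basis.stable_def[OF aff.lie_basis_axioms]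
  using basis_bracket_keys_nonneg by auto

text \<open>The character of the nonnegative part through which it acts on the generating vector.\<close>

fun chi :: "complex \<Rightarrow> complex \<Rightarrow> aff_basis \<Rightarrow> complex" where
  "chi k m (Loop a i) = (if a = sl_h \<and> i = 0 then m else 0)"
| "chi k m Central = k"

abbreviation chiw :: "complex \<Rightarrow> complex \<Rightarrow> aff_basis list \<Rightarrow> complex" where
  "chiw k m w \<equiv> prod_list (map (chi k m) w)"

text \<open>Two nonnegative letters whose modes add up to zero both have mode zero, so the cocycle
  vanishes on them; and \<open>h\<close> in mode zero is not a bracket of nonnegative
  letters.\<close>

lemma chi_bracket:
  assumes "\<not> negL a" "\<not> negL b"
  shows "pm_eval (chi k m) (basis_bracket a b) = 0"
proof (cases "a = Central \<or> b = Central")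
  case False
  then obtain x i y j where "a = Loop x i" "b = Loop y j"
    by (meson aff_basis.exhaust)
  then show ?thesis using assms
    by (cases x; cases y) (auto simp: loop_def central_def pm_eval_add)
qed (use assms in auto)

lemma chiw_nf:
  assumes "\<forall>x\<in>set w. \<not> negL x"
  shows "pm_eval (chiw k m) (aff.nf s w) = chiw k m w"
proof -
  let ?J = "{t. pm_eval (chiw k m) t = 0}"
  have rel: "pm_eval (chiw k m) (unit (u @ a # b # v) - unit (u @ b # a # v)
      - pm_lift (\<lambda>c. unit (u @ c # v)) (basis_bracket a b)) = 0" if "\<not> negL a" "\<not> negL b" for u a b v
  proof -
    have "pm_eval (chiw k m) (pm_lift (\<lambda>c. unit (u @ c # v)) (basis_bracket a b))
        = pm_eval (\<lambda>c. chiw k m (u @ v) * chi k m c) (basis_bracket a b)"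
      by (simp add: pm_eval_lift mult_ac)
    also have "\<dots> = 0"
      using chi_bracket[OF that, of k m] by (simp add: pm_eval_mult_fun)
    finally show ?thesis by (simp add: pm_eval_diff mult_ac)
  qed
  have "lie_basis.rel_space basis_bracket (\<lambda>w. \<forall>x\<in>set w. \<not> negL x) ?J"
    unfolding lie_basis.rel_space_def[OF aff.lie_basis_axioms] pm.subspace_def using rel
    by (auto simp: stable_nonneg pm_eval_add pm_eval_scale)
  from aff.nf_mod[OF this, of "[]" w s] assms show ?thesis
    by (simp add: pm_eval_diff)
qed

text \<open>In a sorted word \<open>takeWhile\<close> collects all negative letters, and the rest
  acts on the generating vector by a scalar.\<close>

definition pbw_coeff :: "complex \<Rightarrow> complex \<Rightarrow> aff_basis list \<Rightarrow> aff_basis list \<Rightarrow> complex" where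
  "pbw_coeff k m F w = (if takeWhile negL w = F then chiw k m (dropWhile negL w) else 0)"

text \<open>The coefficient of the word \<open>F\<close> in the PBW basis given by the ordering \<open>s\<close>.\<close>

definition Phi :: "bool \<Rightarrow> complex \<Rightarrow> complex \<Rightarrow> aff_basis list \<Rightarrow> functional" where
  "Phi s k m F = pm_eval (\<lambda>w. pm_eval (pbw_coeff k m F) (aff.nf s w))"

lemma linear_Phi: "functional_linear (Phi s k m F)"
  unfolding Phi_def by (rule linear_pm_eval)

lemma srt_dropWhile_nonneg:
  assumes "aff.srt s w"
  shows "\<forall>x\<in>set (dropWhile negL w). \<not> negL x"
  using assms by (induction w) (auto dest: ale_negL)

text \<open>After \<open>w\<close> is straightened, only its nonnegative tail meets
  \<open>u\<close>. Straightening the two together stays nonnegative, so the word remains sorted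
  with the same negative part, and \<open>chiw\<close> is unchanged by straightening. This handles
  the defining relations of the generating vector.\<close>

lemma Phi_nonneg:
  assumes u: "\<forall>x\<in>set u. \<not> negL x"
  shows "Phi s k m F (unit (w @ u)) = chiw k m u * Phi s k m F (unit w)"
proof -
  have *: "pm_eval (pbw_coeff k m F) (aff.nf s (v @ u)) = chiw k m u * pbw_coeff k m F v"
    if v: "v \<in> Poly_Mapping.keys (aff.nf s w)" for v
  proof -
    let ?n = "takeWhile negL v" and ?b = "dropWhile negL v"
    have sv: "aff.srt s v" using aff.nf_srt[OF v] .
    have nn: "\<forall>x\<in>set (?b @ u). \<not> negL x"
      using u srt_dropWhile_nonneg[OF sv] by auto
    have sn: "aff.srt s ?n"
      using sv sorted_wrt_append[of "ale s" ?n ?b] by simp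
    have neg: "\<forall>x\<in>set ?n. negL x" by (auto dest: set_takeWhileD)
    have "pm_eval (pbw_coeff k m F) (aff.nf s (v @ u))
        = pm_eval (pbw_coeff k m F) (aff.nf s (?n @ (?b @ u)))"
      unfolding append_assoc[symmetric] takeWhile_dropWhile_id ..
    also have "\<dots> = pm_eval (\<lambda>t. pm_eval (pbw_coeff k m F) (aff.nf s (?n @ t))) (aff.nf s (?b @ u))"
      by (subst aff.nf_append) (rule pm_eval_lift)
    also have "\<dots> = pm_eval (\<lambda>t. of_bool (?n = F) * chiw k m t) (aff.nf s (?b @ u))"
    proof (rule pm_eval_cong)
      fix t assume t: "t \<in> Poly_Mapping.keys (aff.nf s (?b @ u))"
      have "aff.srt s t" using aff.nf_srt[OF t] .
      moreover have tn: "\<forall>x\<in>set t. \<not> negL x"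
        using aff.nf_stable[OF stable_nonneg nn t] .
      ultimately have "aff.srt s (?n @ t)"
        using sn neg by (auto simp: sorted_wrt_append intro: negL_ale)
      then have "aff.nf s (?n @ t) = unit (?n @ t)" by (rule aff.nf_of_srt)
      moreover have "takeWhile negL (?n @ t) = ?n" "dropWhile negL (?n @ t) = t"
        using neg tn by (auto simp: takeWhile_append takeWhile_eq_Nil_iff dropWhile_append hd_in_set)
      ultimately show "pm_eval (pbw_coeff k m F) (aff.nf s (?n @ t)) = of_bool (?n = F) * chiw k m t"
        by (simp only: pm_eval_single pbw_coeff_def) simp
    qed
    also have "\<dots> = of_bool (?n = F) * pm_eval (chiw k m) (aff.nf s (?b @ u))"
      by (rule pm_eval_mult_fun)
    also have "\<dots> = of_bool (?n = F) * chiw k m (?b @ u)"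
      by (simp only: chiw_nf[OF nn])
    finally show ?thesis by (simp add: pbw_coeff_def)
  qed
  have "Phi s k m F (unit (w @ u)) = pm_eval (\<lambda>v. pm_eval (pbw_coeff k m F) (aff.nf s (v @ u))) (aff.nf s w)"
    unfolding Phi_def pm_eval_single mult_1 by (subst aff.nf_append_left) (rule pm_eval_lift)
  also have "\<dots> = pm_eval (\<lambda>v. chiw k m u * pbw_coeff k m F v) (aff.nf s w)"
    by (rule pm_eval_cong) (rule *)
  finally show ?thesis
    by (simp add: Phi_def pm_eval_mult_fun)
qed

lemma Phi_srt:
  assumes "aff.srt s w" "\<forall>x\<in>set w. negL x"
  shows "Phi s k m F (unit w) = of_bool (w = F)"
proof -
  have "takeWhile negL w = w" "dropWhile negL w = []"
    using assms(2) by simp_all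
  then have "pbw_coeff k m F w = of_bool (w = F)"
    by (simp only: pbw_coeff_def) simp
  then show ?thesis
    by (simp add: Phi_def aff.nf_of_srt[OF assms(1)])
qed

lemma chiw_wt: "chiw k m w \<noteq> 0 \<Longrightarrow> wt w = 0"
proof (induction w)
  case (Cons x w)
  then show ?case by (cases x) (auto simp: zero_prod_def split: if_splits)
qed simp

lemma Phi_wt:
  assumes "wt w \<noteq> wt F"
  shows "Phi s k m F (unit w) = 0"
proof -
  have "pbw_coeff k m F v = 0" if "v \<in> Poly_Mapping.keys (aff.nf s w)" for v
  proof (rule ccontr)
    assume nz: "pbw_coeff k m F v \<noteq> 0"
    have "wt v = wt w" using aff.nf_stable[OF stable_wt refl that] .
    moreover have "wt v = wt (takeWhile negL v) + wt (dropWhile negL v)"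
      by (metis takeWhile_dropWhile_id wt_simps(3))
    ultimately show False using nz assms chiw_wt
      by (auto simp: pbw_coeff_def split: if_splits)
  qed
  then show ?thesis by (simp add: Phi_def pm_eval_def)
qed

subsection \<open>The relations of the Verma module\<close>

lemma unit_mult [simp]: "unit u * unit w = unit (u @ w)"
  by (simp add: mult_single plus_list_def)

lemma pm_scale_conv_mult: "pm_scale c x = Poly_Mapping.single [] c * (x :: 'a list \<Rightarrow>\<^sub>0 complex)"
  unfolding pm_scale_def mult_map_scale_conv_mult zero_list_def ..

lemma single_Nil_commute: "Poly_Mapping.single [] c * x = x * Poly_Mapping.single [] (c :: complex)"
proof -
  interpret a: Vector_Spaces.linear pm_scale pm_scale "\<lambda>x. x * Poly_Mapping.single ([] :: 'a list) c"
    by unfold_locales (simp_all add: algebra_simps pm_scale_conv_mult)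
  have "pm_scale c x = x * Poly_Mapping.single [] c"
    by (rule pm_linear_eqI[OF _ a.linear_axioms])
       (unfold_locales, simp_all add: pm.scale_right_distrib mult.commute mult_single plus_list_def)
  then show ?thesis by (simp add: pm_scale_conv_mult)
qed

lemma pm_scale_mult_left: "pm_scale c x * y = pm_scale c (x * (y :: 'a list \<Rightarrow>\<^sub>0 complex))"
  by (simp add: pm_scale_conv_mult mult.assoc)

lemma pm_scale_mult_right: "x * pm_scale c y = pm_scale c (x * (y :: 'a list \<Rightarrow>\<^sub>0 complex))"
  by (metis pm_scale_conv_mult mult.assoc single_Nil_commute)

lemma mult_tensor_incl_mult: "unit u * tensor_incl p * unit v = pm_lift (\<lambda>c. unit (u @ c # v)) p"
proof (rule pm_linear_eqI[OF _ pm_linear_lift])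
  show "pm_linear (\<lambda>p. unit u * tensor_incl p * unit v)"
    by unfold_locales
      (simp_all add: tensor_incl_def pm_lift_add pm_lift_scale pm_scale_mult_left pm_scale_mult_right algebra_simps)
qed (simp add: tensor_incl_def)

lemma tensor_incl_unit [simp]: "tensor_incl (unit a) = unit [a]"
  by (simp add: tensor_incl_def)

lemma tensor_incl_loop [simp]: "tensor_incl (loop a i) = unit [Loop a i]"
  by (simp add: loop_def)

lemma affine_bracket_unit [simp]: "affine_bracket (unit a) (unit b) = basis_bracket a b"
  by (simp add: affine_bracket_def)

lemma subspace_verma_rel: "pm.subspace (verma_rel k m)"
  unfolding verma_rel_def by (rule pm.subspace_span)

lemma verma_rel_bracket:
  "unit (u @ a # b # v) - unit (u @ b # a # v) - pm_lift (\<lambda>c. unit (u @ c # v)) (basis_bracket a b)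
    \<in> verma_rel k m"
proof -
  have "unit u * (tensor_incl (unit a) * tensor_incl (unit b) - tensor_incl (unit b) * tensor_incl (unit a)
      - tensor_incl (affine_bracket (unit a) (unit b))) * unit v \<in> verma_rel k m"
    unfolding verma_rel_def by (rule pm.span_base) blast
  then show ?thesis
    by (simp add: right_diff_distrib left_diff_distrib mult_tensor_incl_mult)
qed

lemma rel_space_verma_rel: "lie_basis.rel_space basis_bracket (\<lambda>_. True) (verma_rel k m)"
  unfolding lie_basis.rel_space_def[OF aff.lie_basis_axioms]
  by (simp add: aff.stable_True subspace_verma_rel verma_rel_bracket)

text \<open>The contragradient action composes a functional with a left multiplication; this keeps
  the result a functional on the Verma module.\<close>

lemma verma_rel_left_ideal: "x \<in> verma_rel k m \<Longrightarrow> t * x \<in> verma_rel k m"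
proof -
  assume "x \<in> verma_rel k m"
  then show ?thesis
    unfolding verma_rel_def
  proof (induction rule: pm.span_induct)
    case base
    show ?case
      by (auto simp: pm.subspace_def distrib_left pm_scale_mult_right
        intro: pm.span_zero pm.span_add pm.span_scale)
  next
    case (step x)
    then consider
        a b x' y where "x = a * (tensor_incl x' * tensor_incl y - tensor_incl y * tensor_incl x'
            - tensor_incl (affine_bracket x' y)) * b"
      | a i where "x = a * tensor_incl (chev_e i)" "i \<in> {1, 2}"
      | a where "x = a * tensor_incl (chev_h 1) - pm_scale m a"
      | a where "x = a * tensor_incl (chev_h 2) - pm_scale (k - m) a"
      by blast
    then show ?case
    proof cases
      case 1
      have "t * x = (t * a) * (tensor_incl x' * tensor_incl y - tensor_incl y * tensor_incl x'
            - tensor_incl (affine_bracket x' y)) * b"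
        unfolding 1 by (simp only: mult.assoc)
      then show ?thesis by (intro pm.span_base) blast
    next
      case 2
      have "t * x = (t * a) * tensor_incl (chev_e i)"
        unfolding 2 by (simp only: mult.assoc)
      then show ?thesis using 2(2) by (intro pm.span_base) blast
    next
      case 3
      have "t * x = (t * a) * tensor_incl (chev_h 1) - pm_scale m (t * a)"
        unfolding 3 by (simp only: mult.assoc right_diff_distrib pm_scale_mult_right)
      then show ?thesis by (intro pm.span_base) blast
    next
      case 4
      have "t * x = (t * a) * tensor_incl (chev_h 2) - pm_scale (k - m) (t * a)"
        unfolding 4 by (simp only: mult.assoc right_diff_distrib pm_scale_mult_right)
      then show ?thesis by (intro pm.span_base) blast
    qed
  qed
qed

lemma pm_lift_scale_fun: "pm_lift (\<lambda>a. pm_scale c (h a)) x = pm_scale c (pm_lift h x)"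
  by (simp add: pm_lift_def pm.scale_sum_right mult.commute)

lemma functional_zeroI:
  assumes "\<And>w. f (unit w) = 0" "\<And>x y. f (x + y) = f x + f y" "\<And>c x. f (pm_scale c x) = c * f x"
  shows "f x = 0"
  using functional_conv_eval[OF functional_linearI[of f], of x] assms by (simp add: pm_eval_def)

lemma tensor_incl_linear [simp]:
  "tensor_incl (x + y) = tensor_incl x + tensor_incl y"
  "tensor_incl (x - y) = tensor_incl x - tensor_incl y"
  "tensor_incl (pm_scale c x) = pm_scale c (tensor_incl x)"
  by (simp_all add: tensor_incl_def pm_lift_add pm_lift_diff pm_lift_scale)

lemma affine_bracket_linear:
  "affine_bracket (x + x') y = affine_bracket x y + affine_bracket x' y"
  "affine_bracket (pm_scale c x) y = pm_scale c (affine_bracket x y)"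
  "affine_bracket x (y + y') = affine_bracket x y + affine_bracket x y'"
  "affine_bracket x (pm_scale c y) = pm_scale c (affine_bracket x y)"
  by (simp_all add: affine_bracket_def pm_lift_add pm_lift_scale pm_lift_plus_fun pm_lift_scale_fun)

locale linear_functional =
  fixes \<phi> :: "('a \<Rightarrow>\<^sub>0 complex) \<Rightarrow> complex"
  assumes linear: "functional_linear \<phi>"
begin

sublocale Vector_Spaces.linear pm_scale "(*)" \<phi>
  by (rule linear)

end

text \<open>Together with \<open>Phi_srt\<close> this gives independence of the PBW vectors in the
  Verma module. Brackets are handled by \<open>nf_relation\<close>, the left ideal by
  \<open>Phi_nonneg\<close>.\<close>

lemma Phi_verma_rel:
  assumes "x \<in> verma_rel k m"
  shows "Phi s k m F x = 0"
proof -
  interpret P: linear_functional "Phi s k m F"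
    by (rule linear_functional.intro) (rule linear_Phi)
  let ?G = "\<lambda>a b x y. Phi s k m F (a * (tensor_incl x * tensor_incl y - tensor_incl y * tensor_incl x
      - tensor_incl (affine_bracket x y)) * b)"
  note simps = affine_bracket_linear tensor_incl_linear mult.assoc distrib_left distrib_right left_diff_distrib right_diff_distrib
    P.add P.diff P.scale pm_scale_mult_left pm_scale_mult_right
  have "?G (unit u) (unit v) (unit a) (unit b) = 0" for u v a b
    using aff.nf_relation[of s u a b v]
    by (simp add: left_diff_distrib right_diff_distrib mult_tensor_incl_mult P.diff)
      (simp add: Phi_def pm_eval_lift pm_eval_add)
  \<comment> \<open>The relation is linear in each of its four arguments, so letters and words are
    replaced by arbitrary elements one argument at a time.\<close>
  then have "?G (unit u) (unit v) (unit a) y = 0" for u v a y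
    by (rule functional_zeroI[of "\<lambda>y. ?G (unit u) (unit v) (unit a) y"])
      (simp_all only: simps, (simp_all add: algebra_simps)?)
  then have "?G (unit u) (unit v) x y = 0" for u v x y
    by (rule functional_zeroI[of "\<lambda>x. ?G (unit u) (unit v) x y"])
      (simp_all only: simps, (simp_all add: algebra_simps)?)
  then have "?G (unit u) b x y = 0" for u b x y
    by (rule functional_zeroI[of "\<lambda>b. ?G (unit u) b x y"])
      (simp_all only: simps, (simp_all add: algebra_simps)?)
  then have G: "?G a b x y = 0" for a b x y
    by (rule functional_zeroI[of "\<lambda>a. ?G a b x y"])
      (simp_all only: simps, (simp_all add: algebra_simps)?)
  have nonneg: "Phi s k m F (a * unit [y]) = chi k m y * Phi s k m F a" if "\<not> negL y" for a y
  proof -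
    have "Phi s k m F (unit u * unit [y]) - chi k m y * Phi s k m F (unit u) = 0" for u
      using Phi_nonneg[of "[y]" s k m F] that by simp
    moreover have "Phi s k m F ((x + x') * unit [y]) - chi k m y * Phi s k m F (x + x')
        = (Phi s k m F (x * unit [y]) - chi k m y * Phi s k m F x)
          + (Phi s k m F (x' * unit [y]) - chi k m y * Phi s k m F x')" for x x'
      by (simp add: distrib_right P.add distrib_left)
    moreover have "Phi s k m F (pm_scale c x * unit [y]) - chi k m y * Phi s k m F (pm_scale c x)
        = c * (Phi s k m F (x * unit [y]) - chi k m y * Phi s k m F x)" for c x
      by (simp add: pm_scale_mult_left P.scale right_diff_distrib)
    ultimately have "Phi s k m F (a * unit [y]) - chi k m y * Phi s k m F a = 0"
      by (rule functional_zeroI[of "\<lambda>a. Phi s k m F (a * unit [y]) - chi k m y * Phi s k m F a" a])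
    then show ?thesis by simp
  qed
  show ?thesis using assms unfolding verma_rel_def
  proof (induction rule: pm.span_induct)
    case base
    show ?case by (auto simp: pm.subspace_def P.add P.scale)
  next
    case (step x)
    then consider
        a b x' y where "x = a * (tensor_incl x' * tensor_incl y - tensor_incl y * tensor_incl x'
            - tensor_incl (affine_bracket x' y)) * b"
      | a i where "x = a * tensor_incl (chev_e i)" "i \<in> {1, 2}"
      | a where "x = a * tensor_incl (chev_h 1) - pm_scale m a"
      | a where "x = a * tensor_incl (chev_h 2) - pm_scale (k - m) a"
      by blast
    then show ?case
    proof cases
      case 1
      then show ?thesis using G by simp
    next
      case 2
      then show ?thesis by (auto simp: chev_e_def nonneg)
    next
      case 3
      then show ?thesis by (simp add: chev_h_def nonneg P.diff P.scale)
    next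
      case 4
      show ?thesis unfolding 4
        by (simp add: chev_h_def central_def nonneg right_diff_distrib left_diff_distrib P.diff P.scale)
    qed
  qed
qed

text \<open>The full dual. Finiteness of the support is kept apart, as homogeneous functionals have
  it automatically.\<close>

definition verma_fun :: "complex \<Rightarrow> complex \<Rightarrow> functional set" where
  "verma_fun k m = {\<phi>. functional_linear \<phi> \<and> (\<forall>x\<in>verma_rel k m. \<phi> x = 0)}"

text \<open>Tested on all words, whereas \<open>verma_piece\<close> uses only words in
  \<open>f_1\<close> and \<open>f_2\<close>; \<open>verma_fun_piece\<close> connects the
  two.\<close>

definition homog :: "int \<times> int \<Rightarrow> functional \<Rightarrow> bool" where
  "homog \<gamma> \<phi> \<longleftrightarrow> (\<forall>w. wt w \<noteq> \<gamma> \<longrightarrow> \<phi> (unit w) = 0)"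

lemma Phi_verma_fun: "Phi s k m F \<in> verma_fun k m"
  by (simp add: verma_fun_def linear_Phi Phi_verma_rel)

lemma Phi_homog: "homog (wt F) (Phi s k m F)"
  by (simp add: homog_def Phi_wt)

definition chev_letter :: "nat \<Rightarrow> aff_basis" where
  "chev_letter i = (if i = 1 then Loop sl_f 0 else Loop sl_e (-1))"

lemma chev_f_prod: "prod_list (map (\<lambda>i. tensor_incl (chev_f i)) is) = unit (map chev_letter is)"
proof (induction "is")
  case Nil
  show ?case unfolding list.map prod_list.Nil single_one[symmetric] zero_list_def ..
qed (simp add: chev_letter_def chev_f_def)

lemma wt_chev: "set is \<subseteq> {1, 2} \<Longrightarrow> wt (map chev_letter is) = (int (count_list is 1), int (count_list is 2))"
  by (induction "is") (auto simp: chev_letter_def zero_prod_def)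

lemma verma_piece_eq:
  "verma_piece \<gamma> = pm.span {unit c | c. set c \<subseteq> {Loop sl_f 0, Loop sl_e (-1)} \<and> wt c = (int (fst \<gamma>), int (snd \<gamma>))}"
proof -
  have "{prod_list (map (\<lambda>i. tensor_incl (chev_f i)) is) | is.
     set is \<subseteq> {1, 2} \<and> count_list is 1 = fst \<gamma> \<and> count_list is 2 = snd \<gamma>}
    = {unit c | c. set c \<subseteq> {Loop sl_f 0, Loop sl_e (-1)} \<and> wt c = (int (fst \<gamma>), int (snd \<gamma>))}" (is "?A = ?B")
  proof (intro equalityI subsetI)
    fix x assume "x \<in> ?A"
    then obtain "is" where "x = unit (map chev_letter is)" "set is \<subseteq> {1, 2}"
      "count_list is 1 = fst \<gamma>" "count_list is 2 = snd \<gamma>"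
      unfolding chev_f_prod by blast
    then show "x \<in> ?B"
      using wt_chev[of "is"] by (auto intro!: exI[of _ "map chev_letter is"] simp: chev_letter_def)
  next
    fix x assume "x \<in> ?B"
    then obtain c where c: "x = unit c" "set c \<subseteq> {Loop sl_f 0, Loop sl_e (-1)}" "wt c = (int (fst \<gamma>), int (snd \<gamma>))"
      by blast
    define "is" where "is = map (\<lambda>l. if l = Loop sl_f 0 then 1 else 2 :: nat) c"
    have "map chev_letter is = c" "set is \<subseteq> {1, 2}"
      using c(2) by (auto simp: is_def chev_letter_def intro!: map_idI)
    then show "x \<in> ?A"
      using wt_chev[of "is"] c unfolding chev_f_prod by (auto intro!: exI[of _ "is"])
  qed
  then show ?thesis unfolding verma_piece_def by simp
qed

lemma homog_verma_piece:
  assumes "functional_linear \<phi>" "homog \<gamma> \<phi>" "x \<in> verma_piece \<gamma>'" "\<gamma> \<noteq> (int (fst \<gamma>'), int (snd \<gamma>'))"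
  shows "\<phi> x = 0"
proof -
  interpret linear_functional \<phi>
    by (rule linear_functional.intro) (rule assms)
  show ?thesis using assms(3) unfolding verma_piece_eq
  proof (induction rule: pm.span_induct)
    case base
    show ?case by (auto simp: pm.subspace_def add scale)
  qed (use assms(2,4) in \<open>auto simp: homog_def\<close>)
qed

lemma verma_dual_homogI:
  assumes "\<phi> \<in> verma_fun k m" "homog \<gamma> \<phi>"
  shows "\<phi> \<in> verma_dual k m"
proof -
  have "{\<gamma>'. \<exists>x\<in>verma_piece \<gamma>'. \<phi> x \<noteq> 0} \<subseteq> {(nat (fst \<gamma>), nat (snd \<gamma>))}"
    using homog_verma_piece[of \<phi> \<gamma>] assms by (force simp: verma_fun_def)
  then show ?thesis
    using assms(1) finite_subset by (fastforce simp: verma_dual_def verma_fun_def)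
qed

lemma verma_dual_verma_fun: "\<phi> \<in> verma_dual k m \<Longrightarrow> \<phi> \<in> verma_fun k m"
  by (simp add: verma_dual_def verma_fun_def)

subsection \<open>Functionals are determined by their values on a PBW basis\<close>

text \<open>The positive part is generated by the Chevalley generators \<open>e\<^sub>1\<close> and \<open>e\<^sub>2\<close>.\<close>

lemma verma_rel_nonneg:
  assumes "\<not> negL x"
  shows "unit (w @ [x]) - pm_scale (chi k m x) (unit w) \<in> verma_rel k m"
proof -
  let ?P = "\<lambda>x. \<forall>w. unit (w @ [x]) - pm_scale (chi k m x) (unit w) \<in> verma_rel k m"
  note sub = subspace_verma_rel[of k m]
  \<comment> \<open>Two letters that act by scalars commute there, so their bracket acts by
    zero.\<close>
  have bracket: "?P z" if "?P x" "?P y" "basis_bracket x y = Poly_Mapping.single z c" "c \<noteq> 0" "chi k m z = 0" for x y z c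
  proof
    fix w
    let ?X = "chi k m x" and ?Y = "chi k m y"
    have 1: "unit (w @ [x] @ [y]) - pm_scale ?Y (unit (w @ [x])) \<in> verma_rel k m"
      and 2: "unit (w @ [y] @ [x]) - pm_scale ?X (unit (w @ [y])) \<in> verma_rel k m"
      and 3: "pm_scale ?Y (unit (w @ [x]) - pm_scale ?X (unit w)) \<in> verma_rel k m"
      and 4: "pm_scale ?X (unit (w @ [y]) - pm_scale ?Y (unit w)) \<in> verma_rel k m"
      using that(2)[rule_format, of "w @ [x]"] that(1)[rule_format, of "w @ [y]"]
        that(1,2)[rule_format, of w] pm.subspace_scale[OF sub] by (simp_all only: append_assoc)
    have 5: "unit (w @ x # y # []) - unit (w @ y # x # [])
        - pm_lift (\<lambda>c. unit (w @ c # [])) (basis_bracket x y) \<in> verma_rel k m"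
      by (rule verma_rel_bracket)
    have "pm_scale (1 / c) ((unit (w @ [x] @ [y]) - pm_scale ?Y (unit (w @ [x])))
        + pm_scale ?Y (unit (w @ [x]) - pm_scale ?X (unit w))
        - (unit (w @ [y] @ [x]) - pm_scale ?X (unit (w @ [y])))
        - pm_scale ?X (unit (w @ [y]) - pm_scale ?Y (unit w))
        - (unit (w @ x # y # []) - unit (w @ y # x # [])
        - pm_lift (\<lambda>c. unit (w @ c # [])) (basis_bracket x y))) \<in> verma_rel k m"
      by (intro pm.subspace_scale[OF sub] pm.subspace_diff[OF sub] pm.subspace_add[OF sub] 1 2 3 4 5)
    also have "pm_scale (1 / c) ((unit (w @ [x] @ [y]) - pm_scale ?Y (unit (w @ [x])))
        + pm_scale ?Y (unit (w @ [x]) - pm_scale ?X (unit w))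
        - (unit (w @ [y] @ [x]) - pm_scale ?X (unit (w @ [y])))
        - pm_scale ?X (unit (w @ [y]) - pm_scale ?Y (unit w))
        - (unit (w @ x # y # []) - unit (w @ y # x # [])
        - pm_lift (\<lambda>c. unit (w @ c # [])) (basis_bracket x y))) = unit (w @ [z])"
      using that(4) unfolding that(3)
      by (intro poly_mapping_eqI) (simp add: lookup_add lookup_minus algebra_simps lookup_single)
    finally show "unit (w @ [z]) - pm_scale (chi k m z) (unit w) \<in> verma_rel k m"
      using that(5) by simp
  qed
  have e0: "?P (Loop sl_e 0)" and f1: "?P (Loop sl_f 1)"
  proof -
    have "a * tensor_incl (chev_e 1) \<in> verma_rel k m" "a * tensor_incl (chev_e 2) \<in> verma_rel k m" for a
      unfolding verma_rel_def by (intro pm.span_base; blast)+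
    from this[of "unit _"] show "?P (Loop sl_e 0)" "?P (Loop sl_f 1)"
      by (simp_all add: chev_e_def)
  qed
  have h0: "?P (Loop sl_h 0)"
  proof
    fix w
    have "unit w * tensor_incl (chev_h 1) - pm_scale m (unit w) \<in> verma_rel k m"
      unfolding verma_rel_def by (intro pm.span_base) blast
    then show "unit (w @ [Loop sl_h 0]) - pm_scale (chi k m (Loop sl_h 0)) (unit w) \<in> verma_rel k m"
      by (simp add: chev_h_def)
  qed
  \<comment> \<open>\<open>c\<close> is the sum of \<open>h_1\<close> and \<open>h_2\<close>, which
    act by m and k - m.\<close>
  have c: "?P Central"
  proof
    fix w
    have "unit w * tensor_incl (chev_h 2) - pm_scale (k - m) (unit w) \<in> verma_rel k m"
      unfolding verma_rel_def by (intro pm.span_base) blast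
    from pm.subspace_add[OF sub this h0[rule_format, of w]]
    show "unit (w @ [Central]) - pm_scale (chi k m Central) (unit w) \<in> verma_rel k m"
      by (simp add: chev_h_def central_def algebra_simps single_diff)
  qed
  \<comment> \<open>The element h T is [e, f T], and brackets with it raise the modes of
    \<open>e\<close> and \<open>f\<close> by one.\<close>
  have pos: "?P (Loop sl_e (int i)) \<and> ?P (Loop sl_f (int i + 1)) \<and> ?P (Loop sl_h (int i + 1))" for i
  proof (induction i)
    case 0
    then show ?case using bracket[OF e0 f1, of "Loop sl_h 1" 1] e0 f1 by (simp add: loop_def)
  next
    case (Suc i)
    have h1: "?P (Loop sl_h 1)"
      using bracket[OF e0 f1, of "Loop sl_h 1" 1] by (simp add: loop_def)
    have e: "?P (Loop sl_e (int (Suc i)))"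
      by (rule bracket[OF h1 Suc[THEN conjunct1], of _ 2]) (simp_all add: loop_def)
    have f: "?P (Loop sl_f (int (Suc i) + 1))"
      by (rule bracket[OF h1 Suc[THEN conjunct2, THEN conjunct1], of _ "-2"]) (simp_all add: loop_def)
    have "?P (Loop sl_h (int (Suc i) + 1))"
      by (rule bracket[OF e f1, of _ 1]) (simp_all add: loop_def)
    with e f show ?case by blast
  qed
  have "?P x"
  proof (cases x)
    case (Loop a i)
    show ?thesis
    proof (cases "i = 0")
      case True
      then show ?thesis using assms Loop e0 h0 by (cases a) auto
    next
      case False
      then have "i > 0" using assms Loop by auto
      then show ?thesis
        using pos[of "nat i"] pos[of "nat (i - 1)"] Loop by (cases a) auto
    qed
  qed (use c in simp)
  then show ?thesis by blast
qed

text \<open>The negative part is generated by the Chevalley generators \<open>f\<^sub>1\<close> and \<open>f\<^sub>2\<close>.\<close>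

lemma neg_word_generated:
  assumes J: "lie_basis.rel_space basis_bracket (\<lambda>_. True) J"
    and "\<forall>x\<in>set w. negL x"
    and "\<And>c. set c \<subseteq> {Loop sl_f 0, Loop sl_e (-1)} \<Longrightarrow> wt c = wt w \<Longrightarrow> unit (u @ c) \<in> J"
  shows "unit (u @ w) \<in> J"
proof -
  have sub: "pm.subspace J"
    using J by (simp add: lie_basis.rel_space_def[OF aff.lie_basis_axioms])
  let ?C = "\<lambda>c. set c \<subseteq> {Loop sl_f 0, Loop sl_e (-1)}"
  let ?P = "\<lambda>x. \<forall>u v. (\<forall>c. ?C c \<longrightarrow> wt c = wt [x] \<longrightarrow> unit (u @ c @ v) \<in> J) \<longrightarrow> unit (u @ x # v) \<in> J"
  \<comment> \<open>If \<open>x\<close> and \<open>y\<close> can be replaced by words in the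
    generators, so can both products in x y - y x, which is a multiple of \<open>z\<close> modulo
    \<open>J\<close>.\<close>
  have bracket: "?P z" if x: "?P x" and y: "?P y" and xy: "basis_bracket x y = Poly_Mapping.single z a" "a \<noteq> 0" for x y z a
  proof (intro allI impI)
    fix u v assume *: "\<forall>c. ?C c \<longrightarrow> wt c = wt [z] \<longrightarrow> unit (u @ c @ v) \<in> J"
    have z: "wt [z] = wt [x] + wt [y]"
      using basis_bracket_keys_wt[of z x y] xy by simp
    have 1: "unit (u @ x # (y # v)) \<in> J"
    proof (rule x[rule_format])
      fix c assume c: "?C c" "wt c = wt [x]"
      have "unit ((u @ c) @ y # v) \<in> J"
      proof (rule y[rule_format])
        fix c' assume "?C c'" "wt c' = wt [y]"
        then show "unit ((u @ c) @ c' @ v) \<in> J"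
          using *[rule_format, of "c @ c'"] c z by simp
      qed
      then show "unit (u @ c @ y # v) \<in> J" by simp
    qed
    have 2: "unit (u @ y # (x # v)) \<in> J"
    proof (rule y[rule_format])
      fix c assume c: "?C c" "wt c = wt [y]"
      have "unit ((u @ c) @ x # v) \<in> J"
      proof (rule x[rule_format])
        fix c' assume "?C c'" "wt c' = wt [x]"
        then show "unit ((u @ c) @ c' @ v) \<in> J"
          using *[rule_format, of "c @ c'"] c z by (simp add: add_ac)
      qed
      then show "unit (u @ c @ x # v) \<in> J" by simp
    qed
    have 3: "unit (u @ x # y # v) - unit (u @ y # x # v) - pm_lift (\<lambda>c. unit (u @ c # v)) (basis_bracket x y) \<in> J"
      using J by (simp add: lie_basis.rel_space_def[OF aff.lie_basis_axioms])
    have "pm_scale (1 / a) (unit (u @ x # y # v) - unit (u @ y # x # v)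
      - (unit (u @ x # y # v) - unit (u @ y # x # v) - pm_lift (\<lambda>c. unit (u @ c # v)) (basis_bracket x y))) \<in> J"
      by (intro pm.subspace_scale[OF sub] pm.subspace_diff[OF sub _ 3] pm.subspace_diff[OF sub 1 2])
    then show "unit (u @ z # v) \<in> J" using xy by simp
  qed
  have f0: "?P (Loop sl_f 0)"
  proof (intro allI impI)
    fix u v assume "\<forall>c. ?C c \<longrightarrow> wt c = wt [Loop sl_f 0] \<longrightarrow> unit (u @ c @ v) \<in> J"
    from this[rule_format, of "[Loop sl_f 0]"] show "unit (u @ Loop sl_f 0 # v) \<in> J" by simp
  qed
  have e1: "?P (Loop sl_e (-1))"
  proof (intro allI impI)
    fix u v assume "\<forall>c. ?C c \<longrightarrow> wt c = wt [Loop sl_e (-1)] \<longrightarrow> unit (u @ c @ v) \<in> J"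
    from this[rule_format, of "[Loop sl_e (-1)]"] show "unit (u @ Loop sl_e (-1) # v) \<in> J" by simp
  qed
  have h1: "?P (Loop sl_h (-1))"
    by (rule bracket[OF e1 f0, of _ 1]) (simp_all add: loop_def)
  \<comment> \<open>Brackets with h/T lower the modes of \<open>f\<close> and \<open>e\<close>, and
    h/T^i is the bracket of e/T^i and \<open>f\<close>.\<close>
  have neg: "?P (Loop sl_f (- int i)) \<and> ?P (Loop sl_e (- int i - 1)) \<and> ?P (Loop sl_h (- int i - 1))" for i
  proof (induction i)
    case 0
    then show ?case using e1 f0 h1 by simp
  next
    case (Suc i)
    have f: "?P (Loop sl_f (- int (Suc i)))"
      by (rule bracket[OF h1 Suc[THEN conjunct1], of _ "-2"]) (simp_all add: loop_def)
    have e: "?P (Loop sl_e (- int (Suc i) - 1))"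
      by (rule bracket[OF h1 Suc[THEN conjunct2, THEN conjunct1], of _ 2]) (simp_all add: loop_def)
    have "?P (Loop sl_h (- int (Suc i) - 1))"
      by (rule bracket[OF e f0, of _ 1]) (simp_all add: loop_def)
    with e f show ?case by blast
  qed
  have neg_letter: "?P x" if x: "negL x" for x
  proof (cases x)
    case (Loop a i)
    then have i: "i \<le> 0" "a = sl_f \<or> i < 0" using x by auto
    show ?thesis
    proof (cases a)
      case sl_f
      then show ?thesis using neg[of "nat (- i)"] Loop i by simp
    next
      case sl_e
      then have "int (nat (- i - 1)) = - i - 1" using i by auto
      then show ?thesis using neg[of "nat (- i - 1)"] Loop sl_e by simp
    next
      case sl_h
      then have "int (nat (- i - 1)) = - i - 1" using i by auto
      then show ?thesis using neg[of "nat (- i - 1)"] Loop sl_h by simp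
    qed
  qed (use x in simp)
  show ?thesis using assms(2,3)
  proof (induction w arbitrary: u)
    case Nil
    from Nil.prems(2)[of "[]"] show ?case by simp
  next
    case (Cons x w)
    have P: "?P x" using neg_letter Cons.prems(1) by simp
    show ?case
    proof (rule P[rule_format])
      fix c assume c: "?C c" "wt c = wt [x]"
      have "unit ((u @ c) @ w) \<in> J"
      proof (rule Cons.IH)
        fix c' assume "?C c'" "wt c' = wt w"
        then show "unit ((u @ c) @ c') \<in> J"
          using Cons.prems(2)[of "c @ c'"] c by simp
      qed (use Cons.prems in auto)
      then show "unit (u @ c @ w) \<in> J" by simp
    qed
  qed
qed

lemma verma_fun_linear: "\<phi> \<in> verma_fun k m \<Longrightarrow> functional_linear \<phi>"
  by (simp add: verma_fun_def)

lemma functional_linear_iff: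
  "functional_linear f \<longleftrightarrow> (\<forall>x y. f (x + y) = f x + f y) \<and> (\<forall>c x. f (pm_scale c x) = c * f x)"
proof
  assume "functional_linear f"
  then interpret linear_functional f by (rule linear_functional.intro)
  show "(\<forall>x y. f (x + y) = f x + f y) \<and> (\<forall>c x. f (pm_scale c x) = c * f x)"
    by (simp add: add scale)
qed (auto intro: functional_linearI)

lemma verma_fun_add: "\<phi> \<in> verma_fun k m \<Longrightarrow> \<psi> \<in> verma_fun k m \<Longrightarrow> (\<lambda>x. \<phi> x + \<psi> x) \<in> verma_fun k m"
  and verma_fun_diff: "\<phi> \<in> verma_fun k m \<Longrightarrow> \<psi> \<in> verma_fun k m \<Longrightarrow> (\<lambda>x. \<phi> x - \<psi> x) \<in> verma_fun k m"
  and verma_fun_scale: "\<phi> \<in> verma_fun k m \<Longrightarrow> (\<lambda>x. c * \<phi> x) \<in> verma_fun k m"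
  and verma_fun_zero: "(\<lambda>x. 0) \<in> verma_fun k m"
  by (auto simp: verma_fun_def functional_linear_iff algebra_simps)

lemma verma_fun_sum: "(\<And>i. i \<in> I \<Longrightarrow> f i \<in> verma_fun k m) \<Longrightarrow> (\<lambda>x. \<Sum>i\<in>I. f i x) \<in> verma_fun k m"
  by (induction I rule: infinite_finite_induct) (auto simp: verma_fun_zero verma_fun_add)

lemma homog_diff: "homog \<gamma> \<phi> \<Longrightarrow> homog \<gamma> \<psi> \<Longrightarrow> homog \<gamma> (\<lambda>x. \<phi> x - \<psi> x)"
  and homog_add: "homog \<gamma> \<phi> \<Longrightarrow> homog \<gamma> \<psi> \<Longrightarrow> homog \<gamma> (\<lambda>x. \<phi> x + \<psi> x)"
  and homog_scale: "homog \<gamma> \<phi> \<Longrightarrow> homog \<gamma> (\<lambda>x. c * \<phi> x)"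
  by (auto simp: homog_def)

lemma homog_sum: "(\<And>i. i \<in> I \<Longrightarrow> homog \<gamma> (f i)) \<Longrightarrow> homog \<gamma> (\<lambda>x. \<Sum>i\<in>I. f i x)"
  by (auto simp: homog_def intro!: sum.neutral)

lemma verma_fun_bracket:
  assumes "\<phi> \<in> verma_fun k m"
  shows "\<phi> (unit (u @ a # b # w)) = \<phi> (unit (u @ b # a # w)) + pm_eval (\<lambda>c. \<phi> (unit (u @ c # w))) (basis_bracket a b)"
proof -
  interpret linear_functional \<phi>
    using assms by (intro linear_functional.intro verma_fun_linear)
  have "\<phi> (unit (u @ a # b # w) - unit (u @ b # a # w) - pm_lift (\<lambda>c. unit (u @ c # w)) (basis_bracket a b)) = 0"
    using assms verma_rel_bracket unfolding verma_fun_def by blast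
  moreover have "\<phi> (pm_lift (\<lambda>c. unit (u @ c # w)) (basis_bracket a b))
      = pm_eval (\<lambda>c. \<phi> (unit (u @ c # w))) (basis_bracket a b)"
    by (simp add: pm_lift_def pm_eval_def sum scale del: pm_scale_single)
  ultimately show ?thesis by (simp add: diff diff_eq_eq add.commute)
qed

lemma verma_fun_nonneg:
  assumes "\<phi> \<in> verma_fun k m" "\<forall>x\<in>set u. \<not> negL x"
  shows "\<phi> (unit (w @ u)) = chiw k m u * \<phi> (unit w)"
  using assms(2)
proof (induction u rule: rev_induct)
  case (snoc x u)
  interpret linear_functional \<phi>
    using assms by (intro linear_functional.intro verma_fun_linear)
  have "\<phi> (unit ((w @ u) @ [x]) - pm_scale (chi k m x) (unit (w @ u))) = 0"
    using assms(1) snoc.prems verma_rel_nonneg[of x "w @ u" k m] unfolding verma_fun_def by simp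
  then show ?case using snoc by (simp add: diff scale del: pm_scale_single)
qed simp

text \<open>The PBW vectors span: straighten \<open>w\<close> modulo the relations and drop the
  nonnegative tail, which has weight zero whenever it acts by a nonzero scalar.\<close>

lemma verma_fun_nf:
  assumes "\<phi> \<in> verma_fun k m"
    and "\<And>v. aff.srt s v \<Longrightarrow> \<forall>x\<in>set v. negL x \<Longrightarrow> wt v = wt w \<Longrightarrow> \<phi> (unit v) = 0"
  shows "\<phi> (unit w) = 0"
proof -
  interpret linear_functional \<phi>
    using assms by (intro linear_functional.intro verma_fun_linear)
  have "\<phi> (unit v) = 0" if v: "v \<in> Poly_Mapping.keys (aff.nf s w)" for v
  proof -
    let ?n = "takeWhile negL v" and ?b = "dropWhile negL v"
    have sv: "aff.srt s v" using aff.nf_srt[OF v] .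
    have "\<phi> (unit (?n @ ?b)) = chiw k m ?b * \<phi> (unit ?n)"
      by (rule verma_fun_nonneg[OF assms(1) srt_dropWhile_nonneg[OF sv]])
    moreover have "\<phi> (unit ?n) = 0" if "chiw k m ?b \<noteq> 0"
    proof (rule assms(2))
      show "aff.srt s ?n" using sv sorted_wrt_append[of "ale s" ?n ?b] by simp
      show "\<forall>x\<in>set ?n. negL x" by (auto dest: set_takeWhileD)
      have "wt (?n @ ?b) = wt w" using aff.nf_stable[OF stable_wt refl v] by simp
      then show "wt ?n = wt w" using chiw_wt[OF that] by (simp only: wt_simps) simp
    qed
    ultimately show ?thesis by fastforce
  qed
  moreover have "\<phi> (unit w) = \<phi> (aff.nf s w)"
  proof -
    have "unit ([] @ w) - pm_lift (\<lambda>v. unit ([] @ v)) (aff.nf s w) \<in> verma_rel k m"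
      by (rule aff.nf_mod[OF rel_space_verma_rel]) simp
    then have "\<phi> (unit w - aff.nf s w) = 0"
      using assms(1) unfolding verma_fun_def by simp
    then show ?thesis by (simp add: diff)
  qed
  ultimately show ?thesis
    using functional_conv_eval[OF linear, of "aff.nf s w"] by (simp add: pm_eval_def)
qed

lemma verma_fun_eq_zero:
  assumes "\<phi> \<in> verma_fun k m" "homog \<gamma> \<phi>"
    and "\<And>w. aff.srt s w \<Longrightarrow> \<forall>x\<in>set w. negL x \<Longrightarrow> wt w = \<gamma> \<Longrightarrow> \<phi> (unit w) = 0"
  shows "\<phi> x = 0"
proof -
  interpret linear_functional \<phi>
    using assms by (intro linear_functional.intro verma_fun_linear)
  have "\<phi> (unit w) = 0" for w
    using assms(2) verma_fun_nf[OF assms(1), of s w] assms(3) unfolding homog_def by metis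
  then show ?thesis by (rule functional_zeroI) (simp_all add: add scale)
qed

lemma chev_word_wt:
  "set c \<subseteq> {Loop sl_f 0, Loop sl_e (-1)} \<Longrightarrow> \<exists>p1 p2. wt c = (int p1, int p2)"
proof (induction c)
  case (Cons x c)
  then obtain p1 p2 where "wt c = (int p1, int p2)" by auto
  moreover have "(d1 x, d2 x) = (1, 0) \<or> (d1 x, d2 x) = (0, 1)"
    using Cons.prems by auto
  ultimately have "wt (x # c) = (int (Suc p1), int p2) \<or> wt (x # c) = (int p1, int (Suc p2))"
    by auto
  then show ?case by blast
qed (auto simp: zero_prod_def intro: exI[of _ 0])

text \<open>\<open>verma_dual\<close> and \<open>dual_vec\<close> refer to degrees through
  \<open>verma_piece\<close>. A functional vanishing on the piece in the degree of \<open>w\<close>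
  vanishes on the negative words of that degree, as these come from words in \<open>f_1\<close> and
  \<open>f_2\<close>, and hence on \<open>w\<close> itself.\<close>

lemma verma_fun_piece:
  assumes "\<phi> \<in> verma_fun k m" "\<phi> (unit w) \<noteq> 0"
  obtains \<gamma> x where "x \<in> verma_piece \<gamma>" "\<phi> x \<noteq> 0" "wt w = (int (fst \<gamma>), int (snd \<gamma>))"
proof (rule ccontr)
  assume "\<not> thesis"
  note get = that
  have *: "\<phi> x = 0" if "x \<in> verma_piece \<gamma>" "wt w = (int (fst \<gamma>), int (snd \<gamma>))" for \<gamma> x
    using that get \<open>\<not> thesis\<close> by blast
  interpret linear_functional \<phi>
    using assms by (intro linear_functional.intro verma_fun_linear)
  let ?J = "{t. \<phi> t = 0}"
  have J: "lie_basis.rel_space basis_bracket (\<lambda>_. True) ?J"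
    using assms(1) verma_rel_bracket unfolding lie_basis.rel_space_def[OF aff.lie_basis_axioms] verma_fun_def
    by (auto simp: aff.stable_True pm.subspace_def add scale)
  have "\<phi> (unit w) = 0"
  proof (rule verma_fun_nf[OF assms(1), of True])
    fix v assume v: "\<forall>x\<in>set v. negL x" "wt v = wt w"
    have "unit ([] @ v) \<in> ?J"
    proof (rule neg_word_generated[OF J v(1)])
      fix c assume c: "set c \<subseteq> {Loop sl_f 0, Loop sl_e (-1)}" "wt c = wt v"
      obtain p1 p2 where p: "wt c = (int p1, int p2)" using chev_word_wt[OF c(1)] by blast
      then have "unit c \<in> verma_piece (p1, p2)"
        unfolding verma_piece_eq using c(1) by (intro pm.span_base) auto
      then show "unit ([] @ c) \<in> ?J" using *[of "unit c" "(p1, p2)"] p c(2) v(2) by simp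
    qed
    then show "\<phi> (unit v) = 0" by simp
  qed
  then show False using assms(2) by simp
qed

subsection \<open>The dual basis vectors\<close>

lemma srt_split:
  assumes "aff.srt s w" "\<forall>x\<in>set w. negL x"
  shows "w = filter (\<lambda>x. grp s x = 0) w @ filter (\<lambda>x. grp s x = 1) w @ filter (\<lambda>x. grp s x = 2) w"
  using assms
proof (induction w)
  case (Cons x w)
  have le: "grp s x \<le> grp s y" if "y \<in> set w" for y
    using Cons.prems(1) that by (auto simp: ale_def)
  have "grp s x \<le> 2" using Cons.prems(2) grp_negL by simp
  then consider "grp s x = 0" | "grp s x = 1" | "grp s x = 2" by linarith
  then show ?case
  proof cases
    case 1
    then show ?thesis using Cons by simp
  next
    case 2
    then have "filter (\<lambda>x. grp s x = 0) w = []" using le by (fastforce simp: filter_empty_conv)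
    then show ?thesis using Cons 2 by simp
  next
    case 3
    then have "filter (\<lambda>x. grp s x = 0) w = []" "filter (\<lambda>x. grp s x = 1) w = []"
      using le by (fastforce simp: filter_empty_conv)+
    then show ?thesis using Cons 3 by simp
  qed
qed simp

lemma negL_downE:
  assumes "negL x"
  obtains a i where "x = down a i"
proof (cases x)
  case (Loop a i)
  then have "x = down a (nat (- i))" using assms by (auto simp: down_def)
  then show ?thesis by (rule that)
qed (use assms in simp)

definition lead :: "bool \<Rightarrow> sl2" where "lead s = (if s then sl_f else sl_e)"
definition opp :: "bool \<Rightarrow> sl2" where "opp s = (if s then sl_e else sl_f)"

lemma grp_eqD:
  assumes "negL x"
  shows "grp s x = 0 \<Longrightarrow> \<exists>i. x = down (lead s) i"
    "grp s x = 1 \<Longrightarrow> \<exists>i. x = down sl_h i" "grp s x = 2 \<Longrightarrow> \<exists>i. x = down (opp s) i"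
proof -
  obtain a i where x: "x = down a i" using negL_downE[OF assms] .
  show "grp s x = 0 \<Longrightarrow> \<exists>i. x = down (lead s) i"
    "grp s x = 1 \<Longrightarrow> \<exists>i. x = down sl_h i" "grp s x = 2 \<Longrightarrow> \<exists>i. x = down (opp s) i"
    using assms unfolding x by (cases a; auto simp: down_def lead_def opp_def split: if_splits)+
qed

lemma srt_group:
  assumes "aff.srt s w" "\<forall>x\<in>set w. negL x"
    and g: "\<And>x. negL x \<Longrightarrow> grp s x = g \<Longrightarrow> \<exists>i. x = down a i"
  defines "is \<equiv> map (\<lambda>x. nat (- idx x)) (filter (\<lambda>x. grp s x = g) w)"
  shows "filter (\<lambda>x. grp s x = g) w = map (down a) is \<and> sorted_wrt (\<ge>) is"
proof
  let ?f = "filter (\<lambda>x. grp s x = g) w"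
  show "?f = map (down a) is"
    unfolding is_def map_map
  proof (rule map_idI[symmetric])
    fix x assume "x \<in> set ?f"
    then obtain i where "x = down a i" using g assms(2) by auto
    then show "(down a \<circ> (\<lambda>x. nat (- idx x))) x = x" by (simp add: down_def)
  qed
  have "aff.srt s ?f" using assms(1) by (rule sorted_wrt_filter)
  then show "sorted_wrt (\<ge>) is"
    unfolding is_def sorted_wrt_map
    by (rule sorted_wrt_mono_rel[rotated]) (auto simp: ale_def)
qed

lemma wt_map_down:
  "wt (map (down sl_f) is) = (int (sum_list is + length is), int (sum_list is))"
  "wt (map (down sl_h) is) = (int (sum_list is), int (sum_list is))"
  "wt (map (down sl_e) is) = (int (sum_list is) - int (length is), int (sum_list is))"
  by (induction "is") (auto simp: down_def zero_prod_def)

lemma grp_down: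
  "grp True (down sl_f i) = 0" "1 \<le> i \<Longrightarrow> grp s (down sl_h i) = 1" "1 \<le> i \<Longrightarrow> grp True (down sl_e i) = 2"
  "grp False (down sl_f i) = 2" "1 \<le> i \<Longrightarrow> grp False (down sl_e i) = 0"
  by (auto simp: down_def)

lemma negL_down: "negL (down sl_f i)" "1 \<le> i \<Longrightarrow> negL (down a i)"
  by (auto simp: down_def)

lemma idx_down [simp]: "idx (down a i) = - int i"
  by (simp add: down_def)

lemma pbw_indicesI:
  assumes "wt (map (down sl_f) is) + wt (map (down sl_h) js) + wt (map (down sl_e) ls) = (int p1, int p2)"
    and "sorted_wrt (\<ge>) is" "sorted_wrt (\<ge>) js" "sorted_wrt (\<ge>) ls"
    and "\<forall>j\<in>set js. negL (down sl_h j)" "\<forall>l\<in>set ls. negL (down sl_e l)"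
  shows "pbw_indices p1 p2 is js ls"
proof -
  have "int (sum_list is + length is) + int (sum_list js) + (int (sum_list ls) - int (length ls)) = int p1"
    "int (sum_list is) + int (sum_list js) + int (sum_list ls) = int p2"
    using assms(1) by (simp_all add: wt_map_down)
  moreover have "\<forall>j\<in>set js. 1 \<le> j" "\<forall>l\<in>set ls. 1 \<le> l"
    using assms(5,6) by (auto simp: down_def)
  ultimately show ?thesis using assms(2-4) unfolding pbw_indices_def by auto
qed

text \<open>In \<open>pbw_indices\<close> the list for \<open>f\<close> comes first. Without
  \<open>s\<close> the letters \<open>e\<close> lead the word, so the outer two lists change
  places.\<close>

lemma srt_words_eq:
  "{w. aff.srt s w \<and> (\<forall>x\<in>set w. negL x) \<and> wt w = (int p1, int p2)}
    = {map (down (lead s)) is @ map (down sl_h) js @ map (down (opp s)) ls | is js ls.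
        if s then pbw_indices p1 p2 is js ls else pbw_indices p1 p2 ls js is}" (is "?W = ?P")
proof (intro equalityI subsetI)
  fix w assume "w \<in> ?P"
  then obtain "is" js ls where w: "w = map (down (lead s)) is @ map (down sl_h) js @ map (down (opp s)) ls"
    and i: "if s then pbw_indices p1 p2 is js ls else pbw_indices p1 p2 ls js is"
    by blast
  have "aff.srt s w" "\<forall>x\<in>set w. negL x" "wt w = (int p1, int p2)"
    using i unfolding w
    by (cases s; auto simp: sorted_wrt_append sorted_wrt_map pbw_indices_def ale_def grp_down negL_down wt_map_down
        lead_def opp_def elim!: sorted_wrt_mono_rel[rotated])+
  then show "w \<in> ?W" by simp
next
  fix w assume "w \<in> ?W"
  then have w: "aff.srt s w" "\<forall>x\<in>set w. negL x" "wt w = (int p1, int p2)" by auto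
  define I where "I g = map (\<lambda>x. nat (- idx x)) (filter (\<lambda>x. grp s x = g) w)" for g
  have g: "filter (\<lambda>x. grp s x = 0) w = map (down (lead s)) (I 0) \<and> sorted_wrt (\<ge>) (I 0)"
    "filter (\<lambda>x. grp s x = 1) w = map (down sl_h) (I 1) \<and> sorted_wrt (\<ge>) (I 1)"
    "filter (\<lambda>x. grp s x = 2) w = map (down (opp s)) (I 2) \<and> sorted_wrt (\<ge>) (I 2)"
    unfolding I_def by (rule srt_group[OF w(1,2)], erule (1) grp_eqD)+
  have eq: "w = map (down (lead s)) (I 0) @ map (down sl_h) (I 1) @ map (down (opp s)) (I 2)"
    using srt_split[OF w(1,2)] g by simp
  have neg: "\<forall>l\<in>set (I 0). negL (down (lead s) l)" "\<forall>j\<in>set (I 1). negL (down sl_h j)"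
    "\<forall>l\<in>set (I 2). negL (down (opp s) l)"
    using w(2) by (subst (asm) eq, simp)+
  have wt: "wt (map (down (lead s)) (I 0)) + wt (map (down sl_h) (I 1)) + wt (map (down (opp s)) (I 2)) = (int p1, int p2)"
    using w(3) arg_cong[OF eq, of wt] by (simp only: wt_simps add_ac)
  have "if s then pbw_indices p1 p2 (I 0) (I 1) (I 2) else pbw_indices p1 p2 (I 2) (I 1) (I 0)"
  proof (cases s)
    case True
    then have "pbw_indices p1 p2 (I 0) (I 1) (I 2)"
      using g neg wt by (intro pbw_indicesI) (simp_all only: lead_def opp_def if_True)
    then show ?thesis using True by simp
  next
    case False
    then have "pbw_indices p1 p2 (I 2) (I 1) (I 0)"
      using g neg wt by (intro pbw_indicesI) (simp_all only: lead_def opp_def if_False add_ac)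
    then show ?thesis using False by simp
  qed
  then show "w \<in> ?P" using eq by blast
qed

lemma pbw_eq:
  assumes "p1 \<noteq> p2"
  shows "pbw (p1, p2) = {w. aff.srt (p2 < p1) w \<and> (\<forall>x\<in>set w. negL x) \<and> wt w = (int p1, int p2)}"
  unfolding srt_words_eq using assms by (auto simp: pbw_def lead_def opp_def)

lemma pbw_diag: "pbw (p, p) = (if p = 0 then {[]} else {})"
  by (simp add: pbw_def)

lemma pbw_wt: "w \<in> pbw \<gamma> \<Longrightarrow> wt w = (int (fst \<gamma>), int (snd \<gamma>))"
  by (cases \<gamma>; cases "fst \<gamma> = snd \<gamma>") (auto simp: pbw_eq pbw_diag zero_prod_def split: if_splits)

lemma neg_wt_pos: "negL x \<Longrightarrow> d1 x \<ge> 0 \<and> d2 x \<ge> 0 \<and> d1 x + d2 x > 0"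
  by (cases x) (auto split: sl2.splits)

lemma neg_wt_nonneg: "\<forall>x\<in>set w. negL x \<Longrightarrow> fst (wt w) \<ge> 0 \<and> snd (wt w) \<ge> 0"
  by (induction w) (use neg_wt_pos in \<open>fastforce+\<close>)

lemma neg_wt_zero: "\<forall>x\<in>set w. negL x \<Longrightarrow> wt w = 0 \<Longrightarrow> w = []"
proof (cases w)
  case (Cons x v)
  assume *: "\<forall>x\<in>set w. negL x" "wt w = 0"
  then have "d1 x + d2 x > 0" "fst (wt v) \<ge> 0" "snd (wt v) \<ge> 0"
    using neg_wt_pos[of x] neg_wt_nonneg[of v] Cons by auto
  then show ?thesis using *(2) Cons by (cases "wt v") (auto simp: zero_prod_def)
qed simp

text \<open>\<open>Phi\<close> satisfies the description by independence; any other candidate agrees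
  with it on the sorted negative words of the degree and is therefore equal. In degree (0,0) the
  basis is {v} in either order, so both values of \<open>s\<close> serve for the empty word.\<close>

lemma dual_vec_eq:
  assumes F: "aff.srt s F" "\<forall>x\<in>set F. negL x" "wt F = (int p1, int p2)"
    and s: "p1 \<noteq> p2 \<and> s = (p2 < p1) \<or> F = []"
  shows "dual_vec k m F = Phi s k m F"
proof -
  have pbw: "F \<in> pbw (p1, p2) \<and> (\<forall>w\<in>pbw (p1, p2). aff.srt s w \<and> (\<forall>x\<in>set w. negL x))"
  proof (cases "F = []")
    case True
    then have "p1 = 0" "p2 = 0" using F(3) by (simp_all add: zero_prod_def)
    then show ?thesis using True by (simp add: pbw_diag)
  next
    case False
    then show ?thesis using s F pbw_eq[of p1 p2] by auto
  qed
  have pbw': "w \<in> pbw (p1, p2)" if "aff.srt s w" "\<forall>x\<in>set w. negL x" "wt w = (int p1, int p2)" for w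
  proof (cases "F = []")
    case True
    then have "p1 = 0" "p2 = 0" using F(3) by (simp_all add: zero_prod_def)
    then show ?thesis using neg_wt_zero[of w] that by (simp add: pbw_diag zero_prod_def)
  next
    case False
    then show ?thesis using s that pbw_eq[of p1 p2] by auto
  qed
  show ?thesis unfolding dual_vec_def
  proof (rule the_equality)
    have "\<forall>w\<in>pbw (p1, p2). Phi s k m F (unit w) = (if w = F then 1 else 0)"
      using pbw Phi_srt[of s _ k m F] by simp
    moreover have "\<forall>\<gamma>'. \<gamma>' \<noteq> (p1, p2) \<longrightarrow> (\<forall>x\<in>verma_piece \<gamma>'. Phi s k m F x = 0)"
      using F(3)
      by (intro allI impI ballI homog_verma_piece[OF linear_Phi Phi_homog[of F s k m]]) (auto simp: prod_eq_iff)
    ultimately show "Phi s k m F \<in> verma_dual k m \<and> (\<exists>\<gamma>. F \<in> pbw \<gamma> \<and>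
     (\<forall>w'\<in>pbw \<gamma>. Phi s k m F (unit w') = (if w' = F then 1 else 0)) \<and>
     (\<forall>\<gamma>'. \<gamma>' \<noteq> \<gamma> \<longrightarrow> (\<forall>x\<in>verma_piece \<gamma>'. Phi s k m F x = 0)))"
      using pbw verma_dual_homogI[OF Phi_verma_fun Phi_homog[of F s k m]] by blast
  next
    fix \<phi> assume "\<phi> \<in> verma_dual k m \<and> (\<exists>\<gamma>. F \<in> pbw \<gamma> \<and>
     (\<forall>w'\<in>pbw \<gamma>. \<phi> (unit w') = (if w' = F then 1 else 0)) \<and>
     (\<forall>\<gamma>'. \<gamma>' \<noteq> \<gamma> \<longrightarrow> (\<forall>x\<in>verma_piece \<gamma>'. \<phi> x = 0)))"
    then obtain \<gamma> where \<phi>: "\<phi> \<in> verma_dual k m" and \<gamma>: "F \<in> pbw \<gamma>"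
      "\<forall>w'\<in>pbw \<gamma>. \<phi> (unit w') = (if w' = F then 1 else 0)"
      "\<forall>\<gamma>'. \<gamma>' \<noteq> \<gamma> \<longrightarrow> (\<forall>x\<in>verma_piece \<gamma>'. \<phi> x = 0)" by blast
    have g: "\<gamma> = (p1, p2)" using pbw_wt[OF \<gamma>(1)] F(3) by (simp add: prod_eq_iff)
    have vf: "\<phi> \<in> verma_fun k m" by (rule verma_dual_verma_fun[OF \<phi>])
    \<comment> \<open>Vanishing on the other pieces is upgraded to vanishing on all words of other
      weights.\<close>
    have "homog (wt F) \<phi>"
      unfolding homog_def
    proof (intro allI impI, rule ccontr)
      fix w assume "wt w \<noteq> wt F" "\<phi> (unit w) \<noteq> 0"
      from verma_fun_piece[OF vf this(2)] obtain \<gamma>' x where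
        "x \<in> verma_piece \<gamma>'" "\<phi> x \<noteq> 0" "wt w = (int (fst \<gamma>'), int (snd \<gamma>'))" .
      then show False using \<gamma>(3) g F(3) \<open>wt w \<noteq> wt F\<close> by (metis fst_conv snd_conv)
    qed
    then have h: "homog (wt F) (\<lambda>x. \<phi> x - Phi s k m F x)"
      by (rule homog_diff) (rule Phi_homog)
    have "\<phi> x - Phi s k m F x = 0" for x
    proof (rule verma_fun_eq_zero[OF verma_fun_diff[OF vf Phi_verma_fun] h, of s])
      fix w assume w: "aff.srt s w" "\<forall>x\<in>set w. negL x" "wt w = wt F"
      then have "w \<in> pbw (p1, p2)" using pbw' F(3) by simp
      then show "\<phi> (unit w) - Phi s k m F (unit w) = 0"
        using \<gamma>(2) g Phi_srt[OF w(1,2), of k m F] by simp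
    qed
    then show "\<phi> = Phi s k m F" by auto
  qed
qed

subsection \<open>Dual vectors of words in commuting letters\<close>

text \<open>The letters of the first group are \<open>lead s\<close> in the modes \<open>- b\<close> with \<open>b \<ge> low s\<close>.  Those with \<open>s\<close>
  serve the points \<open>z\<^sub>p\<close>, the others the point at infinity, where \<open>\<pi>\<close> exchanges \<open>e\<close> and \<open>f\<close>.\<close>

definition low :: "bool \<Rightarrow> nat" where "low s = (if s then 0 else 1)"
text \<open>The sign in [opp s, lead s] = sg s h, and also the sign of \<open>h\<close> in the local
  action: \<pi> reverses it at infinity.\<close>

definition sg :: "bool \<Rightarrow> complex" where "sg s = (if s then 1 else - 1)"

lemma lead_down [simp]:
  assumes "low s \<le> b"
  shows "grp s (down (lead s) b) = 0" "negL (down (lead s) b)"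
  using assms by (auto simp: lead_def low_def down_def)

lemma basis_bracket_grp0: "grp s x = 0 \<Longrightarrow> grp s y = 0 \<Longrightarrow> basis_bracket x y = 0"
  by (cases x; cases y) (auto split: sl2.splits if_splits)

text \<open>Letters of the first group commute with each other and precede all others, so moving
  \<open>x\<close> into place creates no bracket terms.\<close>

lemma act_first:
  assumes "grp s x = 0" "aff.srt s v"
  shows "aff.act s x v = unit (aff.ins s x v)"
  using assms(2)
proof (induction v)
  case (Cons y v)
  show ?case
  proof (cases "ale s x y")
    case False
    then have "grp s y = 0" using assms(1) by (auto simp: ale_def)
    then have "basis_bracket x y = 0" using assms(1) basis_bracket_grp0 by blast
    moreover have "aff.srt s (y # aff.ins s x v)"
      using Cons.prems False aff.le_total aff.srt_ins by auto
    ultimately show ?thesis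
      using False Cons aff.act_srt[OF False Cons.prems] by (simp add: aff.act_hd)
  qed simp
qed simp

lemma takeWhile_ins:
  assumes "grp s x = 0"
  shows "takeWhile negL (aff.ins s x v) = aff.ins s x (takeWhile negL v) \<and>
    dropWhile negL (aff.ins s x v) = dropWhile negL v"
proof -
  have "negL x" using assms grp_negL[of s x] by simp
  moreover have "negL y" if "\<not> ale s x y" for y
  proof -
    have "grp s y = 0" using that assms by (auto simp: ale_def)
    then show ?thesis using grp_negL[of s y] by simp
  qed
  ultimately show ?thesis by (induction v) auto
qed

text \<open>So pairing with \<open>x # w\<close> amounts to taking one letter \<open>x\<close> off
  \<open>F\<close>.\<close>

lemma Phi_first:
  assumes "grp s x = 0"
  shows "Phi s k m F (unit (x # w))
    = pm_eval (\<lambda>v. if aff.ins s x (takeWhile negL v) = F then chiw k m (dropWhile negL v) else 0) (aff.nf s w)"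
proof -
  have "Phi s k m F (unit (x # w)) = pm_eval (\<lambda>v. pm_eval (pbw_coeff k m F) (aff.act s x v)) (aff.nf s w)"
    by (simp add: Phi_def pm_eval_lift)
  also have "\<dots> = pm_eval (\<lambda>v. pbw_coeff k m F (aff.ins s x v)) (aff.nf s w)"
    by (rule pm_eval_cong) (simp add: act_first[OF assms] aff.nf_srt)
  finally show ?thesis by (simp add: pbw_coeff_def takeWhile_ins[OF assms] cong: if_cong)
qed

lemma Phi_eq_eval: "Phi s k m F (unit w) = pm_eval (\<lambda>v. if takeWhile negL v = F then chiw k m (dropWhile negL v) else 0) (aff.nf s w)"
  by (simp add: Phi_def pbw_coeff_def[abs_def])

lemma ins_Nil_neq: "aff.ins s x v \<noteq> []"
  by (cases v) auto

lemma ins_eq_one: "aff.ins s x v = [y] \<longleftrightarrow> x = y \<and> v = []"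
  by (cases v) (auto simp: ins_Nil_neq)

lemma ins_eq_two:
  assumes "ale s p q"
  shows "aff.ins s x v = [p, q] \<longleftrightarrow> (if x = p then v = [q] else x = q \<and> v = [p])"
proof (cases v)
  case (Cons y v')
  have "aff.ins s x v' = [q] \<longleftrightarrow> x = q \<and> v' = []" by (rule ins_eq_one)
  then show ?thesis using Cons assms aff.le_antisym[of s p q] aff.le_total[of s x y] by auto
qed auto

lemma Phi_first_Nil: "grp s x = 0 \<Longrightarrow> Phi s k m [] (unit (x # w)) = 0"
  by (simp add: Phi_first ins_Nil_neq pm_eval_def)

lemma Phi_first_one: "grp s x = 0 \<Longrightarrow> Phi s k m [y] (unit (x # w)) = (if x = y then Phi s k m [] (unit w) else 0)"
  by (simp only: Phi_first Phi_eq_eval[of s k m "[]" w] ins_eq_one) (auto simp: pm_eval_def)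

lemma Phi_first_two:
  assumes "grp s x = 0" "ale s p q"
  shows "Phi s k m [p, q] (unit (x # w))
    = (if x = p then Phi s k m [q] (unit w) else if x = q then Phi s k m [p] (unit w) else 0)"
proof -
  consider "x = p" | "x \<noteq> p" "x = q" | "x \<noteq> p" "x \<noteq> q" by blast
  then show ?thesis
    unfolding Phi_first[OF assms(1)] unfolding Phi_eq_eval ins_eq_two[OF assms(2)]
    by cases (simp_all add: pm_eval_def)
qed

section \<open>The functionals occurring in \<open>eta0\<close> and \<open>eta1\<close>\<close>

abbreviation vac :: "bool \<Rightarrow> complex \<Rightarrow> complex \<Rightarrow> functional" where
  "vac s k m \<equiv> Phi s k m []"
abbreviation D1 :: "bool \<Rightarrow> complex \<Rightarrow> complex \<Rightarrow> nat \<Rightarrow> functional" where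
  "D1 s k m a \<equiv> Phi s k m [down (lead s) a]"
abbreviation D2 :: "bool \<Rightarrow> complex \<Rightarrow> complex \<Rightarrow> nat \<Rightarrow> nat \<Rightarrow> functional" where
  "D2 s k m i j \<equiv> Phi s k m [down (lead s) i, down (lead s) j]"

lemma down_inject [simp]: "down a i = down a j \<longleftrightarrow> i = j"
  by (simp add: down_def)

lemma D1_first: "low s \<le> b \<Longrightarrow> D1 s k m a (unit (down (lead s) b # w)) = (if a = b then vac s k m (unit w) else 0)"
  by (simp add: Phi_first_one)

lemma ale_down: "low s \<le> j \<Longrightarrow> j \<le> i \<Longrightarrow> ale s (down (lead s) i) (down (lead s) j)"
  by (simp add: ale_def)

lemma D2_first:
  "low s \<le> b \<Longrightarrow> low s \<le> j \<Longrightarrow> j \<le> i \<Longrightarrow> D2 s k m i j (unit (down (lead s) b # w))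
    = (if b = i then D1 s k m j (unit w) else if b = j then D1 s k m i (unit w) else 0)"
  by (simp add: Phi_first_two ale_down)

definition pair_set :: "bool \<Rightarrow> nat \<Rightarrow> (nat \<times> nat) set" where
  "pair_set s N = {(i, j). i + j = N \<and> j \<le> i \<and> low s \<le> j}"

definition Dsum :: "bool \<Rightarrow> complex \<Rightarrow> complex \<Rightarrow> nat \<Rightarrow> functional" where
  "Dsum s k m N = (\<lambda>x. 2 * (\<Sum>(i, j)\<in>pair_set s N. D2 s k m i j x))"

lemma finite_pair_set [simp]: "finite (pair_set s N)"
  by (rule finite_subset[of _ "{..N} \<times> {..N}"]) (auto simp: pair_set_def)

text \<open>At most one pair contains \<open>b\<close>, the one with entries \<open>b\<close> and
  \<open>N - b\<close>. Its value is the same whether or not the entries coincide: the dual of a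
  square gives up one letter with coefficient 1, not 2. Hence the uniform factor 2.\<close>

lemma Dsum_first:
  assumes b: "low s \<le> b"
  shows "Dsum s k m N (unit (down (lead s) b # w))
    = (if b + low s \<le> N then 2 * D1 s k m (N - b) (unit w) else 0)"
proof -
  let ?p = "(max b (N - b), min b (N - b))"
  have "(\<Sum>(i, j)\<in>pair_set s N. D2 s k m i j (unit (down (lead s) b # w)))
      = (\<Sum>p\<in>pair_set s N. if p = ?p \<and> b + low s \<le> N then D1 s k m (N - b) (unit w) else 0)"
    by (intro sum.cong) (auto simp: pair_set_def D2_first b split: prod.splits)
  also have "\<dots> = (if b + low s \<le> N then D1 s k m (N - b) (unit w) else 0)"
  proof (cases "b + low s \<le> N")
    case True
    then have "?p \<in> pair_set s N" using b by (auto simp: pair_set_def)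
    then show ?thesis using True by (simp add: sum.delta)
  qed simp
  finally show ?thesis by (simp add: Dsum_def)
qed

subsection \<open>The contragradient action of loops\<close>

lemma contra_act_loop: "contra_act (loop a i) \<phi> = (\<lambda>x. \<phi> (unit [basis_anti (Loop a i)] * x))"
  by (simp add: contra_act_def affine_anti_def loop_def)

lemma verma_fun_shift: "\<phi> \<in> verma_fun k m \<Longrightarrow> (\<lambda>y. \<phi> (unit [x] * y)) \<in> verma_fun k m"
  by (simp add: verma_fun_def functional_linear_iff distrib_left pm_scale_mult_right verma_rel_left_ideal)

lemma homog_shift:
  assumes "homog \<gamma> \<phi>" "\<gamma> = \<gamma>' + (d1 x, d2 x)"
  shows "homog \<gamma>' (\<lambda>y. \<phi> (unit [x] * y))"
  using assms by (auto simp: homog_def add_ac)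

lemma verma_fun_contra: "\<phi> \<in> verma_fun k m \<Longrightarrow> contra_act (loop a i) \<phi> \<in> verma_fun k m"
  unfolding contra_act_loop by (rule verma_fun_shift)

lemma verma_fun_neg_degree:
  assumes "\<phi> \<in> verma_fun k m" "homog \<gamma> \<phi>" "fst \<gamma> < 0 \<or> snd \<gamma> < 0"
  shows "\<phi> x = 0"
  by (rule verma_fun_eq_zero[OF assms(1,2), of True]) (use neg_wt_nonneg assms(3) in fastforce)

lemma vac_homog: "homog 0 (vac s k m)"
  using Phi_homog[of "[]" s k m] by simp

lemma vac_Nil [simp]: "vac s k m (unit []) = 1"
  using Phi_srt[of s "[]" k m "[]"] by simp

lemma verma_fun_deg0:
  assumes "\<phi> \<in> verma_fun k m" "homog 0 \<phi>"
  shows "\<phi> x = \<phi> (unit []) * vac s k m x"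
proof -
  have "\<phi> x - \<phi> (unit []) * vac s k m x = 0"
    by (rule verma_fun_eq_zero[OF verma_fun_diff[OF assms(1) verma_fun_scale[OF Phi_verma_fun]]
          homog_diff[OF assms(2) homog_scale[OF vac_homog]], of s])
      (auto dest: neg_wt_zero)
  then show ?thesis by simp
qed

text \<open>Degrees replace straightening: composing with \<open>h\<close> or \<open>c\<close> keeps
  the degree (0,0), where every functional is a multiple of \<open>vac\<close>, and composing with
  h/T^j leads to a negative degree, where only zero is left.\<close>

lemma vac_h:
  "vac s k m (unit (Loop sl_h 0 # w)) = m * vac s k m (unit w)"
  "j > 0 \<Longrightarrow> vac s k m (unit (Loop sl_h (- j) # w)) = 0"
  "vac s k m (unit (Central # w)) = k * vac s k m (unit w)"
proof -
  let ?f = "\<lambda>x y. vac s k m (unit [x] * y)"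
  have vf: "?f x \<in> verma_fun k m" for x by (rule verma_fun_shift[OF Phi_verma_fun])
  have x: "vac s k m (unit [x]) = chi k m x" if "\<not> negL x" for x
    using Phi_nonneg[of "[x]" s k m "[]" "[]"] that by simp
  have "homog 0 (?f (Loop sl_h 0))" "homog 0 (?f Central)"
    by (rule homog_shift[OF vac_homog]; simp add: zero_prod_def)+
  from this[THEN verma_fun_deg0[OF vf], of "unit w" s]
  show "vac s k m (unit (Loop sl_h 0 # w)) = m * vac s k m (unit w)"
    "vac s k m (unit (Central # w)) = k * vac s k m (unit w)"
    by (simp_all add: x)
  assume "j > 0"
  have "homog (- j, - j) (?f (Loop sl_h (- j)))"
    by (rule homog_shift[OF vac_homog]) (simp add: zero_prod_def)
  from verma_fun_neg_degree[OF vf this, of "unit w"] \<open>j > 0\<close>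
  show "vac s k m (unit (Loop sl_h (- j) # w)) = 0" by simp
qed

lemma Phi_bracket: "Phi s k m F (unit (a # b # w)) = Phi s k m F (unit (b # a # w))
   + pm_eval (\<lambda>c. Phi s k m F (unit (c # w))) (basis_bracket a b)"
  using verma_fun_bracket[OF Phi_verma_fun, of s k m F "[]" a b w] by simp

text \<open>Only the commutator counts, as \<open>vac\<close> vanishes once a letter of the first
  group stands in front. Its central term is the origin of a k in the final constant.\<close>

lemma vac_opp_first:
  assumes "low s \<le> b"
  shows "vac s k m (unit (Loop (opp s) (int a) # down (lead s) b # w))
    = sg s * vac s k m (unit (Loop sl_h (int a - int b) # w)) + (if a = b then of_nat a * k * vac s k m (unit w) else 0)"
proof -
  have "pm_eval (\<lambda>c. vac s k m (unit (c # w))) (basis_bracket (Loop (opp s) (int a)) (down (lead s) b))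
    = sg s * vac s k m (unit (Loop sl_h (int a - int b) # w)) + (if a = b then of_nat a * k * vac s k m (unit w) else 0)"
    by (cases s) (auto simp: down_def opp_def lead_def sg_def loop_def central_def pm_eval_add vac_h)
  then show ?thesis
    using assms by (subst Phi_bracket) (simp add: Phi_first_Nil)
qed

lemma D1_h_first:
  assumes "low s \<le> b"
  shows "D1 s k m c (unit (Loop sl_h (int l) # down (lead s) b # w))
    = (if c = b then vac s k m (unit (Loop sl_h (int l) # w)) else 0)
      - 2 * sg s * D1 s k m c (unit (Loop (lead s) (int l - int b) # w))"
proof -
  have "pm_eval (\<lambda>x. D1 s k m c (unit (x # w))) (basis_bracket (Loop sl_h (int l)) (down (lead s) b))
    = - 2 * sg s * D1 s k m c (unit (Loop (lead s) (int l - int b) # w))"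
    by (cases s) (auto simp: down_def lead_def sg_def loop_def central_def pm_eval_add)
  then show ?thesis
    using assms by (subst Phi_bracket) (simp add: D1_first)
qed

lemma Dsum_lead_first:
  assumes "low s \<le> b"
  shows "Dsum s k m N (unit (Loop (lead s) p # down (lead s) b # w))
    = (if b + low s \<le> N then 2 * D1 s k m (N - b) (unit (Loop (lead s) p # w)) else 0)"
proof -
  have "basis_bracket (Loop (lead s) p) (down (lead s) b) = 0"
    by (cases s) (auto simp: lead_def down_def)
  then have "Dsum s k m N (unit (Loop (lead s) p # down (lead s) b # w))
      = Dsum s k m N (unit (down (lead s) b # Loop (lead s) p # w))"
    unfolding Dsum_def by (subst Phi_bracket) simp
  then show ?thesis by (simp add: Dsum_first[OF assms])
qed

text \<open>The terms with \<open>D1\<close> and positive modes cancel after a shift of the summation index, and the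
  term with \<open>h\<close> is cancelled by the only nonzero contribution of \<open>h\<close> inside the sum.\<close>

lemma key_identity_first:
  fixes w :: "aff_basis list"
  assumes a: "low s \<le> a" and b: "low s \<le> b"
  shows "vac s k m (unit (Loop (opp s) (int a) # down (lead s) b # w))
    - (\<Sum>l=1..a - low s.
        Dsum s k m (a - l + low s) (unit (Loop (lead s) (int l - int (low s)) # down (lead s) b # w))
        + sg s * D1 s k m (a - l) (unit (Loop sl_h (int l) # down (lead s) b # w)))
    = (if a = b then (sg s * m + of_nat a * k + 2 * of_nat (a - low s)) * vac s k m (unit w) else 0)"
proof -
  define d where "d = low s"
  let ?V = "\<lambda>w. vac s k m (unit w)"
  \<comment> \<open>\<open>A\<close> comes from the terms with \<open>Dsum\<close>, \<open>B\<close>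
    and \<open>C\<close> from those with \<open>h\<close>: in \<open>B\<close> the functional
    absorbs the letter in mode -b, and \<open>C\<close> is the commutator of \<open>h\<close> with
    that letter.\<close>
  define A where "A l = (if b \<le> a - l then 2 * D1 s k m (a - l + d - b) (unit (Loop (lead s) (int l - int d) # w)) else 0)" for l
  define B where "B l = (if b = a - l then sg s * ?V (Loop sl_h (int l) # w) else 0)" for l
  define C where "C l = 2 * D1 s k m (a - l) (unit (Loop (lead s) (int l - int b) # w))" for l
  have ss: "sg s * sg s = 1" by (simp add: sg_def)
  have term_eq: "Dsum s k m (a - l + low s) (unit (Loop (lead s) (int l - int (low s)) # down (lead s) b # w))
        + sg s * D1 s k m (a - l) (unit (Loop sl_h (int l) # down (lead s) b # w)) = A l + B l - C l" for l
  proof -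
    have "sg s * (2 * sg s * x) = 2 * x" for x using ss by (simp add: algebra_simps)
    then show ?thesis
      using b by (simp add: Dsum_lead_first D1_h_first A_def B_def C_def d_def right_diff_distrib)
  qed
  \<comment> \<open>For these \<open>l\<close> the letter still belongs to the first group, so
    \<open>D1\<close> absorbs it, which requires a - l = b - l.\<close>
  have low_C: "C l = (if a = b then 2 * ?V w else 0)" if "l + d \<le> b" "l \<le> a" for l
  proof -
    have "Loop (lead s) (int l - int b) = down (lead s) (b - l)"
      using that by (simp add: down_def of_nat_diff)
    then show ?thesis using that by (auto simp: C_def D1_first d_def)
  qed
  \<comment> \<open>If b < a, then \<open>A l = C (l + (b - d))\<close> for l up to a - b, and all
    other terms vanish. If b \<ge> a, every \<open>A l\<close> is zero, and for a = b each of the a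
    - d values of \<open>C\<close> contributes 2: this is the 2 in k + 2.\<close>
  have ABC: "(\<Sum>l=1..a-d. A l) - (\<Sum>l=1..a-d. C l) = (if a = b then - 2 * of_nat (a - d) * ?V w else 0)"
  proof (cases "b < a")
    case False
    then have "(\<Sum>l=1..a-d. A l) = 0" by (intro sum.neutral) (auto simp: A_def)
    moreover have "(\<Sum>l=1..a-d. C l) = (\<Sum>l=1..a-d. if a = b then 2 * ?V w else 0)"
      using False a[folded d_def] b[folded d_def] by (intro sum.cong refl low_C) auto
    ultimately show ?thesis by simp
  next
    case True
    have "(\<Sum>l=1..a-d. A l) = (\<Sum>l=1..a-b. A l)"
      using b d_def by (intro sum.mono_neutral_right) (auto simp: A_def)
    also have "\<dots> = (\<Sum>l=1..a-b. C (l + (b - d)))"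
      using b d_def by (intro sum.cong) (auto simp: A_def C_def of_nat_diff intro!: arg_cong2[of _ _ _ _ "\<lambda>x y. D1 s k m x (unit (Loop (lead s) y # w))"])
    also have "\<dots> = (\<Sum>l=1+(b-d)..(a-b)+(b-d). C l)"
      by (rule sum.shift_bounds_cl_nat_ivl[symmetric])
    also have "\<dots> = (\<Sum>l=1..a-d. C l)"
      using b d_def True by (intro sum.mono_neutral_left) (auto simp: low_C)
    finally show ?thesis using True by simp
  qed
  have "(\<Sum>l=1..a-d. B l) = (\<Sum>l=1..a-d. if l = a - b then (if b < a then sg s * ?V (Loop sl_h (int a - int b) # w) else 0) else 0)"
    by (intro sum.cong) (auto simp: B_def of_nat_diff)
  also have "\<dots> = (if b < a then sg s * ?V (Loop sl_h (int a - int b) # w) else 0)"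
    using b d_def by (simp add: sum.delta) auto
  finally have B: "(\<Sum>l=1..a-d. B l) = (if b < a then sg s * ?V (Loop sl_h (int a - int b) # w) else 0)" .
  have "(\<Sum>l=1..a - d. A l + B l - C l) = (if b < a then sg s * ?V (Loop sl_h (int a - int b) # w) else 0)
      + (if a = b then - 2 * of_nat (a - d) * ?V w else 0)"
    using ABC B by (simp add: sum.distrib sum_subtractf algebra_simps)
  \<comment> \<open>For b < a the term with \<open>h\<close> from \<open>vac_opp_first\<close>
    cancels against \<open>B\<close>. Otherwise its mode is not positive, and only a = b leaves a
    multiple of m.\<close>
  moreover have "?V (Loop sl_h (int a - int b) # w) = (if a = b then m * ?V w else 0)" if "\<not> b < a"
    using vac_h(1)[of s k m w] vac_h(2)[of "int b - int a" s k m w] that by auto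
  ultimately show ?thesis
    using vac_opp_first[OF b, of k m a w] unfolding term_eq unfolding d_def[symmetric]
    by (auto simp: algebra_simps)
qed

lemma grp_zero_lead:
  assumes "grp s x = 0"
  obtains b where "low s \<le> b" "x = down (lead s) b"
proof -
  have "negL x" using assms grp_negL[of s x] by simp
  then have "\<exists>i. x = down (lead s) i"
    using grp_eqD(1) assms by blast
  then obtain i where i: "x = down (lead s) i" ..
  moreover have "low s \<le> i" using \<open>negL x\<close> unfolding i by (auto simp: down_def lead_def low_def)
  ultimately show ?thesis using that by blast
qed

text \<open>The difference of the two degree entries counts letters \<open>f\<close> minus letters
  \<open>e\<close>. Up to the sign \<sigma> it equals 1 here, and letters outside the first group
  contribute at most 0, so a letter of the first group occurs; sorting puts it in front.\<close>

lemma first_letter: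
  assumes "aff.srt s w" "\<forall>x\<in>set w. negL x" "wt w = wt [down (lead s) a]"
  obtains b v where "low s \<le> b" "w = down (lead s) b # v"
proof -
  define \<sigma> :: int where "\<sigma> = (if s then 1 else -1)"
  have charge: "\<sigma> * (fst (wt v) - snd (wt v)) \<le> 0" if "\<forall>x\<in>set v. negL x \<and> grp s x \<noteq> 0" for v
    using that
  proof (induction v)
    case (Cons x v)
    have "\<sigma> * (d1 x - d2 x) \<le> 0"
      using Cons.prems by (cases x) (auto simp: \<sigma>_def split: sl2.splits if_splits)
    then show ?case using Cons by (simp add: algebra_simps)
  qed (simp add: zero_prod_def)
  have "\<sigma> * (fst (wt w) - snd (wt w)) = 1"
    unfolding assms(3) by (auto simp: \<sigma>_def down_def lead_def)
  then obtain y where "y \<in> set w" "grp s y = 0"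
    using charge[of w] assms(2) by fastforce
  then obtain x v where w: "w = x # v" and "grp s x = 0"
    using assms(1) by (cases w) (auto simp: ale_def)
  then show ?thesis using that grp_zero_lead by metis
qed

lemma D1_homog: "homog (wt [down (lead s) a]) (D1 s k m a)"
  by (rule Phi_homog)

lemma Dsum_verma_fun: "Dsum s k m N \<in> verma_fun k m"
  unfolding Dsum_def by (intro verma_fun_scale, unfold case_prod_unfold, intro verma_fun_sum Phi_verma_fun)

text \<open>The letter in mode 0 only serves to write down the degree, which depends on i + j
  alone.\<close>

lemma Dsum_homog: "homog (wt [down (lead s) 0, down (lead s) N]) (Dsum s k m N)"
  unfolding Dsum_def case_prod_unfold
proof (intro homog_scale homog_sum)
  fix p assume "p \<in> pair_set s N"
  then have "wt [down (lead s) 0, down (lead s) N] = wt [down (lead s) (fst p), down (lead s) (snd p)]"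
    by (auto simp: pair_set_def down_def)
  then show "homog (wt [down (lead s) 0, down (lead s) N]) (D2 s k m (fst p) (snd p))"
    using Phi_homog by metis
qed

text \<open>All functionals involved have the degree of \<open>D1 s k m a\<close>, in which every PBW basis vector
  starts with a letter of the first group.\<close>

lemma key_identity:
  assumes a: "low s \<le> a"
  shows "contra_act (loop (lead s) (- int a)) (vac s k m) x
    - (\<Sum>l=1..a - low s. contra_act (loop (opp s) (int (low s) - int l)) (Dsum s k m (a - l + low s)) x
        + sg s * contra_act (loop sl_h (- int l)) (D1 s k m (a - l)) x)
    = (sg s * m + of_nat a * k + 2 * of_nat (a - low s)) * D1 s k m a x"
proof -
  let ?\<gamma> = "wt [down (lead s) a]"
  let ?c = "sg s * m + of_nat a * k + 2 * of_nat (a - low s)"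
  let ?F = "\<lambda>x. vac s k m (unit [Loop (opp s) (int a)] * x)
    - (\<Sum>l=1..a - low s. Dsum s k m (a - l + low s) (unit [Loop (lead s) (int l - int (low s))] * x)
        + sg s * D1 s k m (a - l) (unit [Loop sl_h (int l)] * x))"
  let ?G = "\<lambda>x. ?F x - ?c * D1 s k m a x"
  have anti: "basis_anti (Loop (lead s) i) = Loop (opp s) (- i)" "basis_anti (Loop (opp s) i) = Loop (lead s) (- i)" for i
    by (auto simp: lead_def opp_def)
  have vf: "?G \<in> verma_fun k m"
    by (intro verma_fun_diff verma_fun_sum verma_fun_add verma_fun_scale verma_fun_shift Phi_verma_fun Dsum_verma_fun)
  have hg: "homog ?\<gamma> ?G"
  proof (intro homog_diff homog_sum homog_add homog_scale)
    show "homog ?\<gamma> (\<lambda>x. vac s k m (unit [Loop (opp s) (int a)] * x))"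
      by (rule homog_shift[OF vac_homog]) (auto simp: lead_def opp_def down_def zero_prod_def)
    fix l assume l: "l \<in> {1..a - low s}"
    show "homog ?\<gamma> (\<lambda>x. Dsum s k m (a - l + low s) (unit [Loop (lead s) (int l - int (low s))] * x))"
      by (rule homog_shift[OF Dsum_homog]) (use l a in \<open>auto simp: lead_def opp_def down_def zero_prod_def of_nat_diff low_def\<close>)
    show "homog ?\<gamma> (\<lambda>x. D1 s k m (a - l) (unit [Loop sl_h (int l)] * x))"
      by (rule homog_shift[OF D1_homog]) (use l a in \<open>auto simp: lead_def opp_def down_def zero_prod_def of_nat_diff\<close>)
  qed (rule D1_homog)
  have "?G x = 0"
  proof (rule verma_fun_eq_zero[OF vf hg, of s])
    fix w assume "aff.srt s w" "\<forall>x\<in>set w. negL x" "wt w = ?\<gamma>"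
    then obtain b v where b: "low s \<le> b" and w: "w = down (lead s) b # v"
      using first_letter by blast
    show "?G (unit w) = 0"
      unfolding w unit_mult append_Cons append_Nil
      unfolding key_identity_first[OF a b] D1_first[OF b] by simp
  qed
  then show ?thesis by (simp add: contra_act_loop anti)
qed

lemma vac_eq: "dual_vec k m [] = vac s k m"
  by (rule dual_vec_eq[of s "[]" 0 0]) (simp_all add: zero_prod_def)

text \<open>Both orders give the basis {v} in degree (0,0), so \<open>vac\<close> may be read in
  whichever order makes a given letter lead.\<close>

lemma vac_indep: "vac s k m = vac True k m"
  using vac_eq[of k m s] vac_eq[of k m True] by simp

lemma dual_vec_one:
  assumes "low s \<le> a"
  shows "dual_vec k m [down (lead s) a] = D1 s k m a"
  by (rule dual_vec_eq[of s _ "if s then a + 1 else a - 1" a])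
    (use assms in \<open>auto simp: lead_down down_def lead_def low_def of_nat_diff\<close>)

lemma dual_vec_two:
  assumes "low s \<le> j" "j \<le> i"
  shows "dual_vec k m [down (lead s) i, down (lead s) j] = D2 s k m i j"
  by (rule dual_vec_eq[of s _ "if s then i + j + 2 else i + j - 2" "i + j"])
    (use assms ale_down[of s j i] in \<open>auto simp: lead_down down_def lead_def low_def of_nat_diff\<close>)

lemma verma_fun_zeroI:
  assumes "\<phi> \<in> verma_fun k m" "\<And>w. \<phi> (unit w) = 0"
  shows "\<phi> x = 0"
proof -
  interpret linear_functional \<phi>
    using assms by (intro linear_functional.intro verma_fun_linear)
  show ?thesis by (rule functional_zeroI) (simp_all add: assms(2) add scale)
qed

text \<open>\<open>e T^i\<close> with i \<ge> 0 and \<open>f T^i\<close> with i > 0 act by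
  composition with a letter that leads in one of the two orders, and \<open>vac\<close> vanishes
  behind such a letter.\<close>

lemma contra_vac:
  "0 \<le> i \<Longrightarrow> contra_act (loop sl_e i) (vac s k m) x = 0"
  "0 \<le> i \<Longrightarrow> contra_act (loop sl_f i) (vac s k m) x = (if i = 0 then m * D1 True k m 0 x else 0)"
  "0 \<le> i \<Longrightarrow> contra_act (loop sl_h i) (vac s k m) x = (if i = 0 then m * vac s k m x else 0)"
proof -
  have zero: "vac s k m (unit [y] * x) = 0" if "\<And>w. vac s k m (unit (y # w)) = 0" for y
    by (rule verma_fun_zeroI[OF verma_fun_shift[OF Phi_verma_fun]]) (simp add: that)
  show "contra_act (loop sl_e i) (vac s k m) x = 0" if "0 \<le> i"
    using zero[of "Loop sl_f (- i)"] Phi_first_Nil[of True "Loop sl_f (- i)" k m] that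
    unfolding contra_act_loop vac_indep[of s] by simp
  show "contra_act (loop sl_f i) (vac s k m) x = (if i = 0 then m * D1 True k m 0 x else 0)" if "0 \<le> i"
  proof (cases "i = 0")
    case True
    \<comment> \<open>For a = 0 the sum in \<open>key_identity\<close> is empty, and what is left is
      this case.\<close>
    then show ?thesis using key_identity[of True 0 k m x] vac_indep[of s]
      by (simp add: lead_def low_def sg_def)
  next
    case False
    then show ?thesis
      using zero[of "Loop sl_e (- i)"] Phi_first_Nil[of False "Loop sl_e (- i)" k m] that
      unfolding contra_act_loop vac_indep[of s] vac_indep[of False] by simp
  qed
  show "contra_act (loop sl_h i) (vac s k m) x = (if i = 0 then m * vac s k m x else 0)" if "0 \<le> i"
  proof (cases "i = 0")
    case True
    have "vac s k m (unit [Loop sl_h 0] * x) - m * vac s k m x = 0"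
      by (rule verma_fun_zeroI[OF verma_fun_diff[OF verma_fun_shift[OF Phi_verma_fun]
            verma_fun_scale[OF Phi_verma_fun]]]) (simp add: vac_h)
    then show ?thesis using True by (simp add: contra_act_loop)
  next
    case False
    then show ?thesis using zero[of "Loop sl_h (- i)"] vac_h(2)[of i s k m] that
      by (simp add: contra_act_loop)
  qed
qed

subsection \<open>The action of Laurent series\<close>

definition supp :: "functional \<Rightarrow> (int \<times> int) set" where
  "supp \<phi> = {wt w | w. \<phi> (unit w) \<noteq> 0}"

text \<open>With weights of words in place of pieces, supports can be followed through sums,
  multiples and the action, which only shifts them.\<close>

lemma verma_dual_iff: "\<phi> \<in> verma_dual k m \<longleftrightarrow> \<phi> \<in> verma_fun k m \<and> finite (supp \<phi>)"
proof -
  let ?i = "\<lambda>\<gamma>. (int (fst \<gamma>), int (snd \<gamma>))"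
  let ?S = "{\<gamma>. \<exists>x\<in>verma_piece \<gamma>. \<phi> x \<noteq> 0}"
  have "supp \<phi> = ?i ` ?S" if vf: "\<phi> \<in> verma_fun k m"
  proof (intro equalityI subsetI)
    fix \<delta> assume "\<delta> \<in> supp \<phi>"
    then obtain w where w: "\<delta> = wt w" "\<phi> (unit w) \<noteq> 0" by (auto simp: supp_def)
    from verma_fun_piece[OF vf w(2)] obtain \<gamma> x where "x \<in> verma_piece \<gamma>" "\<phi> x \<noteq> 0" "wt w = ?i \<gamma>" .
    then show "\<delta> \<in> ?i ` ?S" using w(1) by blast
  next
    fix \<delta> assume "\<delta> \<in> ?i ` ?S"
    then obtain \<gamma> x where x: "\<delta> = ?i \<gamma>" "x \<in> verma_piece \<gamma>" "\<phi> x \<noteq> 0" by blast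
    interpret linear_functional \<phi>
      using vf by (intro linear_functional.intro verma_fun_linear)
    show "\<delta> \<in> supp \<phi>"
    proof (rule ccontr)
      assume "\<delta> \<notin> supp \<phi>"
      then have *: "\<phi> (unit c) = 0" if "wt c = ?i \<gamma>" for c
        using x(1) that by (auto simp: supp_def)
      have "\<phi> x = 0"
        using x(2) unfolding verma_piece_eq
      proof (induction rule: pm.span_induct)
        case base
        show ?case by (auto simp: pm.subspace_def add scale)
      qed (use * in auto)
      then show False using x(3) by simp
    qed
  qed
  moreover have "inj_on ?i A" for A by (auto simp: inj_on_def prod_eq_iff)
  ultimately show ?thesis
    by (auto simp: verma_dual_def verma_fun_def finite_image_iff)
qed

lemma verma_dual_add: "\<phi> \<in> verma_dual k m \<Longrightarrow> \<psi> \<in> verma_dual k m \<Longrightarrow> (\<lambda>x. \<phi> x + \<psi> x) \<in> verma_dual k m"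
proof -
  have "supp (\<lambda>x. \<phi> x + \<psi> x) \<subseteq> supp \<phi> \<union> supp \<psi>"
  proof
    fix \<delta> assume "\<delta> \<in> supp (\<lambda>x. \<phi> x + \<psi> x)"
    then obtain w where "\<delta> = wt w" "\<phi> (unit w) + \<psi> (unit w) \<noteq> 0" by (auto simp: supp_def)
    then have "\<phi> (unit w) \<noteq> 0 \<or> \<psi> (unit w) \<noteq> 0" by auto
    then show "\<delta> \<in> supp \<phi> \<union> supp \<psi>" using \<open>\<delta> = wt w\<close> by (auto simp: supp_def)
  qed
  then show "\<phi> \<in> verma_dual k m \<Longrightarrow> \<psi> \<in> verma_dual k m \<Longrightarrow> ?thesis"
    by (auto simp: verma_dual_iff verma_fun_add intro: finite_subset)
qed

lemma verma_dual_scale: "\<phi> \<in> verma_dual k m \<Longrightarrow> (\<lambda>x. c * \<phi> x) \<in> verma_dual k m"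
proof -
  have "supp (\<lambda>x. c * \<phi> x) \<subseteq> supp \<phi>" by (auto simp: supp_def)
  then show "\<phi> \<in> verma_dual k m \<Longrightarrow> ?thesis"
    by (auto simp: verma_dual_iff verma_fun_scale intro: finite_subset)
qed

lemma verma_dual_zero: "(\<lambda>x. 0) \<in> verma_dual k m"
  by (simp add: verma_dual_iff verma_fun_zero supp_def)

lemma verma_dual_sum: "(\<And>i. i \<in> I \<Longrightarrow> f i \<in> verma_dual k m) \<Longrightarrow> (\<lambda>x. \<Sum>i\<in>I. f i x) \<in> verma_dual k m"
  by (induction I rule: infinite_finite_induct) (auto simp: verma_dual_zero verma_dual_add)

lemma verma_dual_contra:
  assumes "\<phi> \<in> verma_dual k m"
  shows "contra_act (loop a i) \<phi> \<in> verma_dual k m"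
proof -
  let ?x = "basis_anti (Loop a i)"
  have "supp (contra_act (loop a i) \<phi>) \<subseteq> (\<lambda>\<delta>. \<delta> - (d1 ?x, d2 ?x)) ` supp \<phi>"
  proof
    fix \<delta> assume "\<delta> \<in> supp (contra_act (loop a i) \<phi>)"
    then obtain w where "\<delta> = wt w" "\<phi> (unit (?x # w)) \<noteq> 0"
      by (auto simp: supp_def contra_act_loop)
    then have "\<delta> = wt (?x # w) - (d1 ?x, d2 ?x)" "wt (?x # w) \<in> supp \<phi>"
      by (auto simp: supp_def simp del: wt_simps(2)) simp
    then show "\<delta> \<in> (\<lambda>\<delta>. \<delta> - (d1 ?x, d2 ?x)) ` supp \<phi>" by blast
  qed
  then show ?thesis
    using assms verma_fun_contra finite_subset by (fastforce simp: verma_dual_iff)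
qed

text \<open>The letter through which \<open>a T^i\<close> acts raises the second degree entry by i,
  and a nonzero functional is detected in nonnegative degrees. Beyond the largest second entry in
  the support nothing is left.\<close>

lemma contra_act_large:
  assumes "\<phi> \<in> verma_dual k m"
  obtains N where "\<And>a i x. N < i \<Longrightarrow> contra_act (loop a i) \<phi> x = 0"
proof -
  have fin: "finite (snd ` supp \<phi>)" using assms by (simp add: verma_dual_iff)
  define N where "N = Max (insert 0 (snd ` supp \<phi>))"
  have "contra_act (loop a i) \<phi> x = 0" if "N < i" for a i x
  proof (rule ccontr)
    have vf: "contra_act (loop a i) \<phi> \<in> verma_fun k m"
      using verma_dual_contra[OF assms] verma_dual_verma_fun by blast
    interpret linear_functional "contra_act (loop a i) \<phi>"
      using vf by (intro linear_functional.intro verma_fun_linear)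
    assume "contra_act (loop a i) \<phi> x \<noteq> 0"
    then obtain w where w: "contra_act (loop a i) \<phi> (unit w) \<noteq> 0"
      using functional_zeroI[of "contra_act (loop a i) \<phi>"] add scale by blast
    from verma_fun_piece[OF vf w] obtain \<gamma> where \<gamma>: "wt w = (int (fst \<gamma>), int (snd \<gamma>))" by blast
    let ?y = "basis_anti (Loop a i)"
    have "wt (?y # w) \<in> supp \<phi>"
      using w by (auto simp: supp_def contra_act_loop simp del: wt_simps(2))
    then have "snd (wt (?y # w)) \<in> snd ` supp \<phi>" by (rule imageI)
    then have "snd (wt (?y # w)) \<le> N" unfolding N_def using fin by (intro Max_ge) (simp, blast)
    moreover have "snd (wt (?y # w)) = i + int (snd \<gamma>)"
      using \<gamma> by (cases a) auto
    ultimately show False using that by simp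
  qed
  then show ?thesis using that by blast
qed

definition series_part :: "sl2 \<Rightarrow> complex fls \<Rightarrow> functional \<Rightarrow> functional" where
  "series_part a L \<phi> = (\<lambda>x. Sum_any (\<lambda>i. fls_nth L i * contra_act (loop a i) \<phi> x))"

lemma series_act_parts:
  "series_act A \<phi> = (\<lambda>x. series_part sl_e (A sl_e) \<phi> x + series_part sl_f (A sl_f) \<phi> x + series_part sl_h (A sl_h) \<phi> x)"
  by (simp add: series_act_def series_part_def add_ac)

text \<open>The upper end \<open>N\<close> depends on the functional alone, and the lower end is any
  bound for the order of the series, so several series can be summed over one common finite
  range.\<close>

lemma series_part_window:
  assumes "\<phi> \<in> verma_dual k m"
  obtains N where "\<And>a L M x. M \<le> fls_subdegree L \<Longrightarrow>
     series_part a L \<phi> x = (\<Sum>i\<in>{M..N}. fls_nth L i * contra_act (loop a i) \<phi> x)"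
proof -
  from contra_act_large[OF assms] obtain N where N: "\<And>a i x. N < i \<Longrightarrow> contra_act (loop a i) \<phi> x = 0"
    by blast
  have "series_part a L \<phi> x = (\<Sum>i\<in>{M..N}. fls_nth L i * contra_act (loop a i) \<phi> x)"
    if "M \<le> fls_subdegree L" for a L M x
    unfolding series_part_def
  proof (rule Sum_any.expand_superset)
    show "{i. fls_nth L i * contra_act (loop a i) \<phi> x \<noteq> 0} \<subseteq> {M..N}"
      using N that by (auto simp: not_less[symmetric])
  qed simp
  then show ?thesis using that by blast
qed

lemma series_part_verma_dual:
  assumes "\<phi> \<in> verma_dual k m"
  shows "series_part a L \<phi> \<in> verma_dual k m"
proof -
  from series_part_window[OF assms] obtain N where
    "series_part a L \<phi> x = (\<Sum>i\<in>{fls_subdegree L..N}. fls_nth L i * contra_act (loop a i) \<phi> x)" for x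
    by (metis order_refl)
  then have "series_part a L \<phi> = (\<lambda>x. \<Sum>i\<in>{fls_subdegree L..N}. fls_nth L i * contra_act (loop a i) \<phi> x)"
    by blast
  then show ?thesis
    by (simp add: verma_dual_sum verma_dual_scale verma_dual_contra assms)
qed

lemma series_act_verma_dual: "\<phi> \<in> verma_dual k m \<Longrightarrow> series_act A \<phi> \<in> verma_dual k m"
  unfolding series_act_parts by (intro verma_dual_add series_part_verma_dual)

lemma series_part_add:
  assumes "\<phi> \<in> verma_dual k m"
  shows "series_part a (L + L') \<phi> x = series_part a L \<phi> x + series_part a L' \<phi> x"
proof -
  define M where "M = min (fls_subdegree (L + L')) (min (fls_subdegree L) (fls_subdegree L'))"
  have "M \<le> fls_subdegree (L + L')" "M \<le> fls_subdegree L" "M \<le> fls_subdegree L'" by (auto simp: M_def)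
  moreover from series_part_window[OF assms] obtain N where "\<And>a L M x. M \<le> fls_subdegree L \<Longrightarrow>
     series_part a L \<phi> x = (\<Sum>i\<in>{M..N}. fls_nth L i * contra_act (loop a i) \<phi> x)" by blast
  ultimately show ?thesis
    by (simp add: distrib_right sum.distrib)
qed

lemma series_part_scale:
  assumes "\<phi> \<in> verma_dual k m"
  shows "series_part a (fls_const c * L) \<phi> x = c * series_part a L \<phi> x"
proof -
  have "series_part a (fls_const c * L) \<phi> x = Sum_any (\<lambda>i. c * (fls_nth L i * contra_act (loop a i) \<phi> x))"
    by (simp add: series_part_def mult.assoc)
  also have "\<dots> = c * series_part a L \<phi> x"
    unfolding series_part_def
    by (cases "c = 0") (auto simp: Sum_any.expand_set sum_distrib_left)
  finally show ?thesis .
qed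

lemma contra_act_add: "contra_act g (\<lambda>x. \<phi> x + \<psi> x) x = contra_act g \<phi> x + contra_act g \<psi> x"
  and contra_act_scale: "contra_act g (\<lambda>x. c * \<phi> x) x = c * contra_act g \<phi> x"
  by (simp_all add: contra_act_def)

lemma series_part_add_right:
  assumes "\<phi> \<in> verma_dual k m" "\<psi> \<in> verma_dual k m"
  shows "series_part a L (\<lambda>x. \<phi> x + \<psi> x) x = series_part a L \<phi> x + series_part a L \<psi> x"
proof -
  from contra_act_large[OF assms(1)] obtain N1 where N1: "\<And>a i x. N1 < i \<Longrightarrow> contra_act (loop a i) \<phi> x = 0" by blast
  from contra_act_large[OF assms(2)] obtain N2 where N2: "\<And>a i x. N2 < i \<Longrightarrow> contra_act (loop a i) \<psi> x = 0" by blast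
  let ?I = "{fls_subdegree L..max N1 N2}"
  have *: "series_part a L \<chi> x = (\<Sum>i\<in>?I. fls_nth L i * contra_act (loop a i) \<chi> x)"
    if "\<And>i. max N1 N2 < i \<Longrightarrow> contra_act (loop a i) \<chi> x = 0" for \<chi>
    unfolding series_part_def
  proof (rule Sum_any.expand_superset)
    show "{i. fls_nth L i * contra_act (loop a i) \<chi> x \<noteq> 0} \<subseteq> ?I"
      using that by (auto simp: not_less[symmetric] simp del: max_less_iff_conj)
  qed simp
  show ?thesis
    by (subst (1 2 3) *) (simp_all add: N1 N2 contra_act_add distrib_left sum.distrib)
qed

lemma series_part_scale_right: "series_part a L (\<lambda>x. c * \<phi> x) x = c * series_part a L \<phi> x"
  unfolding series_part_def contra_act_scale
  by (cases "c = 0") (auto simp: Sum_any.expand_set sum_distrib_left mult.left_commute)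

lemma series_part_zero [simp]: "series_part a 0 \<phi> x = 0"
  by (simp add: series_part_def)

lemma series_part_monomial:
  "(\<And>i. fls_nth L i = (if i = j then c else 0)) \<Longrightarrow> series_part a L \<phi> x = c * contra_act (loop a j) \<phi> x"
proof -
  assume *: "\<And>i. fls_nth L i = (if i = j then c else 0)"
  have "series_part a L \<phi> x = (\<Sum>i\<in>{j}. fls_nth L i * contra_act (loop a i) \<phi> x)"
    unfolding series_part_def by (rule Sum_any.expand_superset) (auto simp: *)
  then show ?thesis by (simp add: *)
qed

lemma series_part_const:
  assumes "\<And>i. i < 0 \<Longrightarrow> fls_nth L i = 0" "\<And>i. i > 0 \<Longrightarrow> contra_act (loop a i) \<phi> x = 0"
  shows "series_part a L \<phi> x = fls_nth L 0 * contra_act (loop a 0) \<phi> x"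
proof -
  have "series_part a L \<phi> x = (\<Sum>i\<in>{0}. fls_nth L i * contra_act (loop a i) \<phi> x)"
    unfolding series_part_def
  proof (rule Sum_any.expand_superset)
    show "{i. fls_nth L i * contra_act (loop a i) \<phi> x \<noteq> 0} \<subseteq> {0}"
      using assms by (auto, metis linorder_neqE)
  qed simp
  then show ?thesis by simp
qed

lemma series_part_vac:
  assumes "\<And>i. i < 0 \<Longrightarrow> fls_nth L i = 0"
  shows "series_part sl_e L (vac s k m) x = 0"
    "series_part sl_f L (vac s k m) x = fls_nth L 0 * (m * D1 True k m 0 x)"
    "series_part sl_h L (vac s k m) x = fls_nth L 0 * (m * vac s k m x)"
  using assms by (simp_all add: series_part_const contra_vac)

subsection \<open>Laurent expansions\<close>

definition poly_at :: "complex fls \<Rightarrow> complex poly \<Rightarrow> complex fls" where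
  "poly_at \<tau> p = poly (map_poly fls_const p) \<tau>"

lemma poly_at_0 [simp]: "poly_at \<tau> 0 = 0"
  by (simp add: poly_at_def)

lemma poly_at_pCons [simp]: "poly_at \<tau> (pCons a p) = fls_const a + \<tau> * poly_at \<tau> p"
  by (simp add: poly_at_def map_poly_pCons)

lemma poly_at_add [simp]: "poly_at \<tau> (p + q) = poly_at \<tau> p + poly_at \<tau> q"
  by (induction p q rule: poly_induct2) (simp_all add: algebra_simps flip: fls_plus_const)

lemma poly_at_smult [simp]: "poly_at \<tau> (smult c p) = fls_const c * poly_at \<tau> p"
  by (induction p) (simp_all add: algebra_simps)

lemma poly_at_mult [simp]: "poly_at \<tau> (p * q) = poly_at \<tau> p * poly_at \<tau> q"
  by (induction p) (simp_all add: algebra_simps)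

lemma poly_at_1 [simp]: "poly_at \<tau> 1 = 1"
  by (simp add: one_pCons)

lemma poly_at_power [simp]: "poly_at \<tau> (p ^ a) = poly_at \<tau> p ^ a"
  by (induction a) simp_all

lemma no_roots_const:
  assumes "\<And>r. poly p r \<noteq> (0 :: complex)"
  obtains c where "p = [:c:]" "c \<noteq> 0"
  using fundamental_theorem_of_algebra_alt[of p] assms that by metis

text \<open>Complex polynomials split into linear factors, so for \<tau> not constant no nonzero
  polynomial vanishes at \<tau>, and substitution does not depend on the representing
  fraction.\<close>

locale transcendental =
  fixes \<tau> :: "complex fls"
  assumes not_const: "\<tau> \<noteq> fls_const r"
begin

lemma poly_at_nonzero: "p \<noteq> 0 \<Longrightarrow> poly_at \<tau> p \<noteq> 0"
proof (induction p rule: poly_root_induct[where P = "\<lambda>_. True"])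
  case (no_roots p)
  then show ?case using no_roots_const[of p] by fastforce
next
  case (root a p)
  have "fls_const a - \<tau> \<noteq> 0" using not_const[of a] by auto
  moreover have "poly_at \<tau> [:a, -1:] = fls_const a - \<tau>"
    by (simp add: fls_const_uminus)
  moreover have "p \<noteq> 0" using root.prems by auto
  ultimately show ?case unfolding poly_at_mult using root.IH by simp
qed simp

lemma laurent_subst_Fract:
  assumes "q \<noteq> 0"
  shows "laurent_subst \<tau> (Fract p q) = poly_at \<tau> p / poly_at \<tau> q"
proof -
  obtain p' q' where pq: "quot_of_fract (Fract p q) = (p', q')" by fastforce
  then have q': "q' \<noteq> 0" using snd_quot_of_fract_nonzero[of "Fract p q"] by simp
  have "Fract p' q' = Fract p q" using Fract_quot_of_fract[of "Fract p q"] pq by simp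
  then have "p' * q = p * q'" using assms q' by (simp add: eq_fract)
  then have "poly_at \<tau> p' * poly_at \<tau> q = poly_at \<tau> p * poly_at \<tau> q'" by (metis poly_at_mult)
  then show ?thesis
    using poly_at_nonzero[OF assms] poly_at_nonzero[OF q'] pq
    by (simp add: laurent_subst_def poly_at_def[symmetric] field_simps)
qed

lemma laurent_subst_add: "laurent_subst \<tau> (u + v) = laurent_subst \<tau> u + laurent_subst \<tau> v"
proof -
  obtain p q p' q' where "u = Fract p q" "q \<noteq> 0" "v = Fract p' q'" "q' \<noteq> 0"
    by (metis Fract_cases)
  then show ?thesis
    by (simp add: laurent_subst_Fract poly_at_nonzero field_simps)
qed

lemma laurent_subst_mult: "laurent_subst \<tau> (u * v) = laurent_subst \<tau> u * laurent_subst \<tau> v"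
proof -
  obtain p q p' q' where "u = Fract p q" "q \<noteq> 0" "v = Fract p' q'" "q' \<noteq> 0"
    by (metis Fract_cases)
  then show ?thesis
    by (simp add: laurent_subst_Fract poly_at_nonzero)
qed

lemma laurent_subst_to_fract: "laurent_subst \<tau> (to_fract p) = poly_at \<tau> p"
  by (simp add: to_fract_def laurent_subst_Fract)

lemma laurent_subst_scale: "laurent_subst \<tau> (rat_scale c u) = fls_const c * laurent_subst \<tau> u"
  by (simp add: rat_scale_def laurent_subst_mult laurent_subst_to_fract)

lemma laurent_subst_0: "laurent_subst \<tau> 0 = 0"
  using laurent_subst_to_fract[of 0] by simp

lemma laurent_subst_pole: "laurent_subst \<tau> (pole c a) = inverse (\<tau> - fls_const c) ^ a"
proof -
  have *: "poly_at \<tau> [:- c, 1:] = \<tau> - fls_const c"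
    by (simp add: fls_const_uminus)
  show ?thesis
    unfolding pole_def by (subst laurent_subst_Fract) (simp_all add: * power_inverse divide_inverse del: poly_at_pCons)
qed

lemma laurent_subst_mono_t: "laurent_subst \<tau> (mono_t a) = \<tau> ^ a"
  by (induction a) (simp_all add: mono_t_def laurent_subst_to_fract monom_0 monom_Suc)

end

interpretation at_point: transcendental "fls_const c + fls_X" for c
proof
  fix r show "fls_const c + fls_X \<noteq> fls_const r"
  proof
    assume "fls_const c + fls_X = fls_const r"
    then have "fls_nth (fls_const c + fls_X) 1 = fls_nth (fls_const r) 1" by simp
    then show False by simp
  qed
qed

interpretation at_inf: transcendental "fls_X_inv"
proof
  fix r :: complex show "fls_X_inv \<noteq> fls_const r"
  proof
    assume "fls_X_inv = fls_const r"
    then have "fls_nth fls_X_inv (-1) = fls_nth (fls_const r) (-1)" by simp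
    then show False by simp
  qed
qed

lemmas expand_at_add = at_point.laurent_subst_add[folded expand_at_def]
lemmas expand_at_scale = at_point.laurent_subst_scale[folded expand_at_def]
lemmas expand_at_0 [simp] = at_point.laurent_subst_0[folded expand_at_def]
lemmas expand_infinity_add = at_inf.laurent_subst_add[folded expand_infinity_def]
lemmas expand_infinity_scale = at_inf.laurent_subst_scale[folded expand_infinity_def]
lemmas expand_infinity_0 [simp] = at_inf.laurent_subst_0[folded expand_infinity_def]

lemma expand_at_pole_self: "fls_nth (expand_at c (pole c a)) i = (if i = - int a then 1 else 0)"
  by (simp add: expand_at_def at_point.laurent_subst_pole fls_inverse_X)

lemma expand_at_pole_other:
  assumes "c \<noteq> d"
  shows "i < 0 \<Longrightarrow> fls_nth (expand_at c (pole d a)) i = 0"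
    "fls_nth (expand_at c (pole d a)) 0 = 1 / (c - d) ^ a"
proof -
  let ?f = "fps_const (c - d) + fps_X"
  have *: "fls_const c + fls_X - fls_const d = fps_to_fls ?f"
    by (simp add: fls_minus_const[symmetric] algebra_simps)
  have "inverse (fps_to_fls ?f) = fps_to_fls (inverse ?f)"
    using assms by (subst fls_inverse_fps_to_fls) (auto simp: subdegree_eq_0)
  then have eq: "expand_at c (pole d a) = fps_to_fls (inverse ?f ^ a)"
    by (simp only: expand_at_def at_point.laurent_subst_pole * fps_to_fls_power)
  show "i < 0 \<Longrightarrow> fls_nth (expand_at c (pole d a)) i = 0"
    unfolding eq by simp
  show "fls_nth (expand_at c (pole d a)) 0 = 1 / (c - d) ^ a"
    unfolding eq by (simp add: fps_nth_power_0 field_simps)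
qed

lemma expand_at_mono:
  "i < 0 \<Longrightarrow> fls_nth (expand_at c (mono_t a)) i = 0"
  "fls_nth (expand_at c (mono_t a)) 0 = c ^ a"
proof -
  have eq: "expand_at c (mono_t a) = fps_to_fls ((fps_const c + fps_X) ^ a)"
    by (simp add: expand_at_def at_point.laurent_subst_mono_t fps_to_fls_power)
  show "i < 0 \<Longrightarrow> fls_nth (expand_at c (mono_t a)) i = 0"
    unfolding eq by simp
  show "fls_nth (expand_at c (mono_t a)) 0 = c ^ a"
    unfolding eq by (simp add: fps_nth_power_0)
qed

lemma expand_infinity_mono: "fls_nth (expand_infinity (mono_t a)) i = (if i = - int a then 1 else 0)"
  by (simp add: expand_infinity_def at_inf.laurent_subst_mono_t)

lemma expand_infinity_pole:
  assumes "0 < a" "i \<le> 0"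
  shows "fls_nth (expand_infinity (pole d a)) i = 0"
proof -
  let ?f = "1 - fps_const d * fps_X"
  have inv: "inverse (fps_to_fls ?f) = fps_to_fls (inverse ?f)"
    by (subst fls_inverse_fps_to_fls) (auto simp: subdegree_eq_0)
  \<comment> \<open>With t = 1/T one has 1/(t - d) = T/(1 - d T), which has a zero at
    infinity.\<close>
  have "fls_X_inv - fls_const d = fls_X_inv * fps_to_fls ?f"
    by (simp add: algebra_simps fls_times_fps_to_fls)
      (metis fls_inverse_X fls_X_nonzero left_inverse mult.commute mult.left_commute mult.right_neutral)
  then have "inverse (fls_X_inv - fls_const d) = fls_X * fps_to_fls (inverse ?f)"
    by (simp only: inverse_mult_distrib fls_inverse_X_inv inv)
  then have eq: "expand_infinity (pole d a) = fps_to_fls ((fps_X * inverse ?f) ^ a)"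
    by (simp add: expand_infinity_def at_inf.laurent_subst_pole fps_to_fls_power fls_times_fps_to_fls)
  show ?thesis
    unfolding eq using assms by (cases "i = 0") (simp_all add: fps_nth_power_0)
qed

subsection \<open>The partial fraction basis\<close>

text \<open>Coordinates in the partial fraction basis, read off from the principal part at
  \<open>z p\<close> and, for powers of t, from the polynomial part at infinity. They give
  independence here and serve again for the injectivity of \<open>eta0\<close>.\<close>

fun rat_coeff :: "(nat \<Rightarrow> complex) \<Rightarrow> rat_index \<Rightarrow> ratfun \<Rightarrow> complex" where
  "rat_coeff z (Pole p a) u = fls_nth (expand_at (z p) u) (- int a)"
| "rat_coeff z (Mono a) u = fls_nth (expand_infinity u) (- int a)"

lemma rat_coeff_linear:
  "rat_coeff z i (u + v) = rat_coeff z i u + rat_coeff z i v"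
  "rat_coeff z i (rat_scale c u) = c * rat_coeff z i u"
  by (cases i; simp add: expand_at_add expand_at_scale expand_infinity_add expand_infinity_scale)+

lemma rat_indices_iff [simp]:
  "Pole p a \<in> rat_indices n \<longleftrightarrow> p \<in> {1..n} \<and> 0 < a" "Mono a \<in> rat_indices n"
  by (auto simp: rat_indices_def)

lemma rat_coeff_basis:
  assumes "inj_on z {1..n}" "i \<in> rat_indices n" "j \<in> rat_indices n"
  shows "rat_coeff z i (rat_basis z j) = (if i = j then 1 else 0)"
proof (cases i)
  case i: (Pole p a)
  then have a: "- int a < 0" "p \<in> {1..n}" using assms by auto
  show ?thesis
  proof (cases j)
    case j: (Pole q b)
    show ?thesis
    proof (cases "p = q")
      case True
      then show ?thesis by (simp add: i j expand_at_pole_self)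
    next
      case False
      have "q \<in> {1..n}" using assms j by simp
      then have "z p \<noteq> z q" using a False inj_onD[OF assms(1)] by blast
      from expand_at_pole_other(1)[OF this a(1)] show ?thesis using False by (simp add: i j)
    qed
  next
    case (Mono b)
    then show ?thesis using expand_at_mono(1)[OF a(1)] by (simp add: i)
  qed
next
  case i: (Mono a)
  show ?thesis
  proof (cases j)
    case (Pole q b)
    then have "0 < b" using assms by simp
    then show ?thesis by (simp add: i Pole expand_infinity_pole)
  next
    case (Mono b)
    then show ?thesis by (simp add: i expand_infinity_mono)
  qed
qed

lemma rat_coeff_sum: "rat_coeff z i (\<Sum>x\<in>A. rat_scale (c x) (f x)) = (\<Sum>x\<in>A. c x * rat_coeff z i (f x))"
proof (induction A rule: infinite_finite_induct)
  case (insert x F)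
  then show ?case by (simp add: rat_coeff_linear)
qed (cases i; simp)+

lemma rat_basis_inj:
  assumes "inj_on z {1..n}"
  shows "inj_on (rat_basis z) (rat_indices n)"
proof (rule inj_onI)
  fix i j assume "i \<in> rat_indices n" "j \<in> rat_indices n" "rat_basis z i = rat_basis z j"
  then show "i = j"
    using rat_coeff_basis[OF assms, of i i] rat_coeff_basis[OF assms, of i j] by (auto split: if_splits)
qed

lemma rat_basis_independent:
  assumes "inj_on z {1..n}"
  shows "rat.independent (rat_basis z ` rat_indices n)"
  unfolding rat.independent_explicit_module
proof (intro allI impI)
  fix t u v assume t: "finite t" "t \<subseteq> rat_basis z ` rat_indices n" "(\<Sum>v\<in>t. rat_scale (u v) v) = 0" "v \<in> t"
  then obtain i where i: "i \<in> rat_indices n" "v = rat_basis z i" by blast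
  have "0 = rat_coeff z i (\<Sum>v\<in>t. rat_scale (u v) v)"
    unfolding t(3) by (cases i) simp_all
  also have "\<dots> = (\<Sum>w\<in>t. u w * rat_coeff z i w)" by (rule rat_coeff_sum)
  also have "\<dots> = (\<Sum>w\<in>t. if w = v then u w else 0)"
  proof (rule sum.cong)
    fix w assume "w \<in> t"
    then obtain j where "j \<in> rat_indices n" "w = rat_basis z j" using t(2) by blast
    then show "u w * rat_coeff z i w = (if w = v then u w else 0)"
      using rat_coeff_basis[OF assms i(1), of j] rat_basis_inj[OF assms] i by (auto dest: inj_onD)
  qed simp
  also have "\<dots> = u v" using t(1,4) by simp
  finally show "u v = 0" by simp
qed

abbreviation rat_span :: "nat \<Rightarrow> (nat \<Rightarrow> complex) \<Rightarrow> ratfun set" where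
  "rat_span n z \<equiv> rat.span (rat_basis z ` rat_indices n)"

lemma rat_scale_mult_left: "rat_scale c u * v = rat_scale c (u * v)"
  and rat_scale_mult_right: "v * rat_scale c u = rat_scale c (v * u)"
  by (simp_all add: rat_scale_def mult_ac)

lemma rat_scale_to_fract: "rat_scale c (to_fract p) = to_fract (smult c p)"
  by (simp add: rat_scale_def flip: to_fract_mult)

lemma pole_Suc: "pole c (Suc a) = pole c 1 * pole c a"
  by (simp add: pole_def)

lemma pole_0 [simp]: "pole c 0 = 1"
  by (simp add: pole_def One_fract_def)

lemma mono_t_0 [simp]: "mono_t 0 = 1"
  by (simp add: mono_t_def)

lemma mono_t_Suc: "mono_t (Suc a) = mono_t 1 * mono_t a"
  by (simp add: mono_t_def mult_monom flip: to_fract_mult)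

lemma mono_pole: "mono_t 1 * pole c 1 = 1 + rat_scale c (pole c 1)"
proof -
  have "[:- c, 1:] \<noteq> 0" by simp
  then show ?thesis
    by (simp add: mono_t_def pole_def rat_scale_def to_fract_def One_fract_def eq_fract monom_Suc monom_0 del: pCons_eq_0_iff)
qed

lemma pole_pole_1:
  assumes "c \<noteq> d"
  shows "pole c 1 * pole d 1 = rat_scale (1 / (c - d)) (pole c 1 - pole d 1)"
proof -
  have "[:1 / (c - d):] * ([:- d, 1:] - [:- c, 1:]) = 1"
    using assms by (simp add: field_simps one_pCons)
  then show ?thesis
    by (simp add: pole_def rat_scale_def to_fract_def eq_fract mult_ac)
qed

text \<open>Each step multiplies by 1/(t - d). This raises the poles at d, and only 1/((t - c)(t -
  d)) has to be split again.\<close>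

lemma pole_pole:
  assumes "c \<noteq> d"
  shows "pole c 1 * pole d a = rat_scale (1 / (c - d) ^ a) (pole c 1)
    - (\<Sum>l=1..a. rat_scale (1 / (c - d) ^ l) (pole d (a - l + 1)))"
proof (induction a)
  case (Suc a)
  have "pole c 1 * pole d (Suc a) = pole d 1 * (pole c 1 * pole d a)"
    by (simp only: pole_Suc[of d a] mult_ac)
  also have "\<dots> = rat_scale (1 / (c - d) ^ a) (pole c 1 * pole d 1)
      - (\<Sum>l=1..a. rat_scale (1 / (c - d) ^ l) (pole d (Suc a - l + 1)))"
    unfolding Suc.IH right_diff_distrib sum_distrib_left rat_scale_mult_right
    by (intro arg_cong2[of _ _ _ _ "(-)"] sum.cong arg_cong2[of _ _ _ _ rat_scale])
      (auto simp: mult.commute Suc_diff_le pole_Suc[of d "Suc _"])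
  also have "rat_scale (1 / (c - d) ^ a) (pole c 1 * pole d 1)
      = rat_scale (1 / (c - d) ^ Suc a) (pole c 1) - rat_scale (1 / (c - d) ^ Suc a) (pole d 1)"
    unfolding pole_pole_1[OF assms] by (simp add: rat.scale_right_diff_distrib field_simps)
  finally show ?case by (simp add: algebra_simps)
qed simp

text \<open>Repeated use of t/(t - c) = 1 + c/(t - c).\<close>

lemma mono_t_pole:
  "mono_t a * pole c 1 = rat_scale (c ^ a) (pole c 1) + (\<Sum>l<a. rat_scale (c ^ l) (mono_t (a - 1 - l)))"
proof (induction a)
  case (Suc a)
  have "mono_t (Suc a) * pole c 1 = mono_t 1 * (mono_t a * pole c 1)"
    by (simp add: mono_t_Suc[of a] mult.assoc)
  also have "\<dots> = rat_scale (c ^ a) (mono_t 1 * pole c 1) + (\<Sum>l<a. rat_scale (c ^ l) (mono_t (a - l)))"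
    unfolding Suc.IH distrib_left sum_distrib_left rat_scale_mult_right
  proof (intro arg_cong2[of _ _ _ _ "(+)"] refl sum.cong arg_cong2[of _ _ _ _ rat_scale])
    fix l assume "l \<in> {..<a}"
    then have "a - l = Suc (a - 1 - l)" by auto
    then show "mono_t 1 * mono_t (a - 1 - l) = mono_t (a - l)"
      using mono_t_Suc[of "a - 1 - l"] by simp
  qed
  also have "rat_scale (c ^ a) (mono_t 1 * pole c 1) = rat_scale (c ^ Suc a) (pole c 1) + rat_scale (c ^ a) (mono_t 0)"
    unfolding mono_pole by (simp add: rat.scale_right_distrib mult.commute)
  finally show ?case by (simp add: algebra_simps)
qed simp

lemma rat_basis_in_span: "i \<in> rat_indices n \<Longrightarrow> rat_basis z i \<in> rat_span n z"
  by (intro rat.span_base imageI)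

lemma pole_in_span: "p \<in> {1..n} \<Longrightarrow> 0 < a \<Longrightarrow> pole (z p) a \<in> rat_span n z"
  using rat_basis_in_span[of "Pole p a" n z] by auto

lemma mono_t_in_span: "mono_t a \<in> rat_span n z"
  using rat_basis_in_span[of "Mono a" n z] by auto

lemma rat_span_mult_pole:
  assumes "inj_on z {1..n}" "p \<in> {1..n}" "u \<in> rat_span n z"
  shows "pole (z p) 1 * u \<in> rat_span n z"
  using assms(3)
proof (induction rule: rat.span_induct)
  case base
  show ?case
    by (auto simp: rat.subspace_def distrib_left rat_scale_mult_right
        intro: rat.span_zero rat.span_add rat.span_scale)
next
  case (step u)
  then obtain i where i: "i \<in> rat_indices n" "u = rat_basis z i" by blast
  show ?case
  proof (cases i)
    case (Pole q b)
    then have q: "q \<in> {1..n}" "0 < b" "u = pole (z q) b" using i by auto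
    show ?thesis
    proof (cases "p = q")
      case True
      then show ?thesis using q pole_in_span[of q n "Suc b" z] by (simp add: pole_Suc[of _ b])
    next
      case False
      then have "z p \<noteq> z q" using assms q by (auto dest: inj_onD)
      then show ?thesis unfolding q(3) pole_pole[OF \<open>z p \<noteq> z q\<close>]
        by (intro rat.span_diff rat.span_sum rat.span_scale pole_in_span q(1) assms(2)) auto
    qed
  next
    case (Mono b)
    show ?thesis
      unfolding i(2) Mono rat_basis.simps mult.commute[of "pole (z p) 1"] mono_t_pole
      by (intro rat.span_add rat.span_sum rat.span_scale pole_in_span mono_t_in_span assms(2)) auto
  qed
qed

lemma to_fract_in_span: "to_fract p \<in> rat_span n z"
proof -
  have "p = (\<Sum>i\<le>degree p. smult (coeff p i) (monom 1 i))"
    using poly_as_sum_of_monoms[of p] by (simp add: smult_monom)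
  then have "to_fract p = (\<Sum>i\<le>degree p. rat_scale (coeff p i) (mono_t i))"
    by (metis (mono_tags, lifting) mono_t_def rat_scale_to_fract sum.cong to_fract_sum)
  then show ?thesis by (simp add: rat.span_sum rat.span_scale mono_t_in_span)
qed

section \<open>Regular functions as the span of the partial fractions\<close>

lemma Omega0_add: "u \<in> Omega0 n z \<Longrightarrow> v \<in> Omega0 n z \<Longrightarrow> u + v \<in> Omega0 n z"
proof -
  assume "u \<in> Omega0 n z" "v \<in> Omega0 n z"
  then obtain p q p' q' where "u = Fract p q" "q \<noteq> 0" "\<forall>t. t \<notin> z ` {1..n} \<longrightarrow> poly q t \<noteq> 0"
    "v = Fract p' q'" "q' \<noteq> 0" "\<forall>t. t \<notin> z ` {1..n} \<longrightarrow> poly q' t \<noteq> 0"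
    unfolding Omega0_def by blast
  then have "u + v = Fract (p * q' + p' * q) (q * q')" "q * q' \<noteq> 0" "\<forall>t. t \<notin> z ` {1..n} \<longrightarrow> poly (q * q') t \<noteq> 0"
    by simp_all
  then show ?thesis unfolding Omega0_def by blast
qed

lemma Omega0_scale: "u \<in> Omega0 n z \<Longrightarrow> rat_scale c u \<in> Omega0 n z"
proof -
  assume "u \<in> Omega0 n z"
  then obtain p q where "u = Fract p q" "q \<noteq> 0" "\<forall>t. t \<notin> z ` {1..n} \<longrightarrow> poly q t \<noteq> 0"
    unfolding Omega0_def by blast
  moreover from this have "rat_scale c u = Fract (smult c p) q"
    by (simp add: rat_scale_def to_fract_def)
  ultimately show ?thesis unfolding Omega0_def by blast
qed

lemma Omega0_eq_span:
  assumes "inj_on z {1..n}"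
  shows "Omega0 n z = rat_span n z"
proof (intro equalityI subsetI)
  fix u assume "u \<in> rat_span n z"
  then show "u \<in> Omega0 n z"
  proof (induction rule: rat.span_induct)
    case base
    have "(0 :: ratfun) \<in> Omega0 n z"
      unfolding Omega0_def by (intro CollectI exI[of _ 0] exI[of _ 1]) (simp add: fract_collapse)
    then show ?case by (auto simp: rat.subspace_def Omega0_add Omega0_scale)
  next
    case (step u)
    then obtain i where i: "i \<in> rat_indices n" "u = rat_basis z i" by blast
    show ?case
    proof (cases i)
      case (Pole p a)
      then have "u = Fract 1 ([:- z p, 1:] ^ a)" "p \<in> {1..n}" using i by (auto simp: pole_def)
      then show ?thesis unfolding Omega0_def
        by (intro CollectI exI[of _ 1] exI[of _ "[:- z p, 1:] ^ a"]) (auto simp: poly_power)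
    next
      case (Mono a)
      then have "u = Fract (monom 1 a) 1" using i by (simp add: mono_t_def to_fract_def)
      then show ?thesis unfolding Omega0_def
        by (intro CollectI exI[of _ "monom 1 a"] exI[of _ 1]) simp
    qed
  qed
next
  fix u assume "u \<in> Omega0 n z"
  then obtain p q where u: "u = Fract p q" and q: "q \<noteq> 0" "\<forall>t. t \<notin> z ` {1..n} \<longrightarrow> poly q t \<noteq> 0"
    unfolding Omega0_def by blast
  \<comment> \<open>The denominator is removed one linear factor at a time; once it has no root
    among the \<open>z i\<close>, it has no root at all and is constant.\<close>
  from q have "Fract p q \<in> rat_span n z"
  proof (induction q rule: poly_root_induct[where P = "\<lambda>t. t \<in> z ` {1..n}"])
    case (no_roots q)
    then have "poly q r \<noteq> 0" for r by blast
    then obtain c where c: "q = [:c:]" "c \<noteq> 0" using no_roots_const by blast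
    have "Fract p q = rat_scale (1 / c) (to_fract p)"
      using c by (simp add: rat_scale_def to_fract_def eq_fract)
    then show ?case by (simp add: rat.span_scale to_fract_in_span)
  next
    case (root a q)
    then obtain i where i: "i \<in> {1..n}" "a = z i" by blast
    have "q \<noteq> 0" "\<forall>t. t \<notin> z ` {1..n} \<longrightarrow> poly q t \<noteq> 0" using root.prems by auto
    then have "Fract p q \<in> rat_span n z" by (rule root.IH)
    then have *: "rat_scale (- 1) (pole (z i) 1 * Fract p q) \<in> rat_span n z"
      by (intro rat.span_scale rat_span_mult_pole assms i)
    \<comment> \<open>The induction rule splits off a - t instead of t - a, hence the sign.\<close>
    have "Fract p ([:a, -1:] * q) = rat_scale (- 1) (pole (z i) 1 * Fract p q)"
    proof -
      have "[:a, -1:] * q = - ([:- z i, 1:] * q)" "[:- 1:] * p = - p" by (simp_all add: i(2))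
      then show ?thesis
        using minus_fract_cancel[of "- p" "[:- z i, 1:] * q"]
        by (simp add: rat_scale_def to_fract_def pole_def del: mult_pCons_left)
    qed
    then show ?case using * by simp
  qed simp
  then show "u \<in> rat_span n z" using u by simp
qed

subsection \<open>The derivation\<close>

lemma rat_deriv_Fract:
  assumes "q \<noteq> 0"
  shows "rat_deriv (Fract p q) = Fract (pderiv p * q - p * pderiv q) (q ^ 2)"
proof -
  obtain p' q' where pq: "quot_of_fract (Fract p q) = (p', q')" by fastforce
  then have q': "q' \<noteq> 0" using snd_quot_of_fract_nonzero[of "Fract p q"] by simp
  have "Fract p' q' = Fract p q" using Fract_quot_of_fract[of "Fract p q"] pq by simp
  then have e: "p' * q = p * q'" using assms q' by (simp add: eq_fract)
  then have "pderiv (p' * q) = pderiv (p * q')" by simp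
  then have d: "p' * pderiv q + q * pderiv p' = p * pderiv q' + q' * pderiv p"
    by (simp add: pderiv_mult)
  have "(pderiv p' * q' - p' * pderiv q') * q ^ 2 = (pderiv p * q - p * pderiv q) * q' ^ 2"
    using e d by algebra
  then show ?thesis
    using assms q' pq by (simp add: rat_deriv_def eq_fract)
qed

lemma rat_deriv_add: "rat_deriv (u + v) = rat_deriv u + rat_deriv v"
proof -
  obtain p q p' q' where *: "u = Fract p q" "q \<noteq> 0" "v = Fract p' q'" "q' \<noteq> 0"
    by (metis Fract_cases)
  then show ?thesis
    by (simp add: rat_deriv_Fract eq_fract pderiv_mult pderiv_add power2_eq_square algebra_simps)
qed

lemma rat_deriv_scale: "rat_deriv (rat_scale c u) = rat_scale c (rat_deriv u)"
proof -
  obtain p q where *: "u = Fract p q" "q \<noteq> 0"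
    by (metis Fract_cases)
  then have "rat_scale c u = Fract (smult c p) q" "rat_scale c (Fract x y) = Fract (smult c x) y" for x y
    by (simp_all add: rat_scale_def to_fract_def)
  then show ?thesis using *
    by (simp add: rat_deriv_Fract pderiv_smult smult_diff_right)
qed

lemma rat_deriv_pole: "rat_deriv (pole c a) = rat_scale (- of_nat a) (pole c (a + 1))"
proof (cases a)
  case 0
  have "rat_deriv (Fract 1 1) = 0"
    by (subst rat_deriv_Fract) (simp_all add: fract_collapse)
  then show ?thesis unfolding 0 pole_0 One_fract_def by simp
next
  case (Suc b)
  define x where "x = [:- c, 1:]"
  have x: "x \<noteq> 0" "pderiv x = 1" by (simp_all add: x_def pderiv_pCons)
  have "pderiv (x ^ a) = smult (of_nat a) (x ^ b)"
    unfolding Suc by (subst pderiv_power_Suc) (simp add: x)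
  then have "rat_deriv (pole c a) = Fract (- smult (of_nat a) (x ^ b)) ((x ^ a) ^ 2)"
    using x by (simp add: pole_def rat_deriv_Fract flip: x_def)
  also have "\<dots> = Fract (smult (- of_nat a) 1) (x ^ (a + 1))"
    using x by (simp add: eq_fract Suc power2_eq_square algebra_simps flip: smult_minus_left)
  finally show ?thesis
    by (simp add: pole_def rat_scale_def to_fract_def flip: x_def)
qed

lemma rat_deriv_mono_t: "rat_deriv (mono_t a) = rat_scale (of_nat a) (mono_t (a - 1))"
  by (simp add: mono_t_def to_fract_def rat_deriv_Fract pderiv_monom rat_scale_def smult_monom)

subsection \<open>Linear extension along the partial fraction basis\<close>

abbreviation rat_repr :: "nat \<Rightarrow> (nat \<Rightarrow> complex) \<Rightarrow> ratfun \<Rightarrow> rat_index \<Rightarrow> complex" where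
  "rat_repr n z u i \<equiv> rat.representation (rat_basis z ` rat_indices n) u (rat_basis z i)"

lemma finite_rat_repr:
  assumes "inj_on z {1..n}"
  shows "finite {i \<in> rat_indices n. rat_repr n z u i \<noteq> 0}"
proof -
  have "rat_basis z ` {i \<in> rat_indices n. rat_repr n z u i \<noteq> 0}
      \<subseteq> {b. rat.representation (rat_basis z ` rat_indices n) u b \<noteq> 0}" by auto
  then have "finite (rat_basis z ` {i \<in> rat_indices n. rat_repr n z u i \<noteq> 0})"
    using rat.finite_representation finite_subset by blast
  moreover have "inj_on (rat_basis z) {i \<in> rat_indices n. rat_repr n z u i \<noteq> 0}"
    using rat_basis_inj[OF assms] by (rule inj_on_subset) auto
  ultimately show ?thesis by (rule finite_imageD)
qed

lemma rat_lift_superset: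
  assumes "finite I" "I \<subseteq> rat_indices n" "{i \<in> rat_indices n. rat_repr n z u i \<noteq> 0} \<subseteq> I"
  shows "rat_lift n z h u = (\<Sum>i\<in>I. pm_scale (rat_repr n z u i) (h i))"
  unfolding rat_lift_def Let_def using assms
  by (intro sum.mono_neutral_left) auto

lemma rat_lift_add:
  assumes z: "inj_on z {1..n}" and u: "u \<in> rat_span n z" and v: "v \<in> rat_span n z"
  shows "rat_lift n z h (u + v) = rat_lift n z h u + rat_lift n z h v"
proof -
  let ?N = "\<lambda>u. {i \<in> rat_indices n. rat_repr n z u i \<noteq> 0}"
  let ?I = "?N (u + v) \<union> ?N u \<union> ?N v"
  have I: "finite ?I" "?I \<subseteq> rat_indices n" using finite_rat_repr[OF z] by auto
  show ?thesis
    by (subst (1 2 3) rat_lift_superset[OF I])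
      (auto simp: rat.representation_add[OF rat_basis_independent[OF z] v u] pm.scale_left_distrib sum.distrib)
qed

lemma rat_lift_scale:
  assumes z: "inj_on z {1..n}" and u: "u \<in> rat_span n z"
  shows "rat_lift n z h (rat_scale c u) = pm_scale c (rat_lift n z h u)"
proof -
  let ?N = "\<lambda>u. {i \<in> rat_indices n. rat_repr n z u i \<noteq> 0}"
  let ?I = "?N (rat_scale c u) \<union> ?N u"
  have I: "finite ?I" "?I \<subseteq> rat_indices n" using finite_rat_repr[OF z] by auto
  show ?thesis
    by (subst (1 2) rat_lift_superset[OF I])
      (auto simp: rat.representation_scale[OF rat_basis_independent[OF z] u] pm.scale_sum_right)
qed

lemma rat_lift_diff:
  assumes z: "inj_on z {1..n}" and u: "u \<in> rat_span n z" and v: "v \<in> rat_span n z"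
  shows "rat_lift n z h (u - v) = rat_lift n z h u - rat_lift n z h v"
  using rat_lift_add[OF z rat.span_diff[OF u v] v, of h] by simp

lemma rat_lift_zero [simp]: "rat_lift n z h 0 = 0"
  by (simp add: rat_lift_def rat.representation_zero)

lemma rat_lift_sum:
  assumes z: "inj_on z {1..n}" and "\<And>i. i \<in> A \<Longrightarrow> f i \<in> rat_span n z"
  shows "rat_lift n z h (\<Sum>i\<in>A. f i) = (\<Sum>i\<in>A. rat_lift n z h (f i))"
  using assms(2)
  by (induction A rule: infinite_finite_induct) (auto simp: rat_lift_add[OF z] rat.span_sum)

lemma rat_lift_basis:
  assumes z: "inj_on z {1..n}" and i: "i \<in> rat_indices n"
  shows "rat_lift n z h (rat_basis z i) = h i"
proof -
  have *: "rat_repr n z (rat_basis z i) j = (if j = i then 1 else 0)" if "j \<in> rat_indices n" for j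
    using rat.representation_basis[OF rat_basis_independent[OF z], of "rat_basis z i"] i that
      rat_basis_inj[OF z] by (auto dest: inj_onD)
  have "rat_lift n z h (rat_basis z i) = (\<Sum>j\<in>{i}. pm_scale (rat_repr n z (rat_basis z i) j) (h j))"
    using i * by (intro rat_lift_superset) (auto split: if_splits)
  then show ?thesis by (simp add: * i)
qed

lemma rat_lift_keys:
  assumes "\<And>i. i \<in> rat_indices n \<Longrightarrow> Poly_Mapping.keys (h i) \<subseteq> A"
  shows "Poly_Mapping.keys (rat_lift n z h u) \<subseteq> A"
proof
  fix a assume "a \<in> Poly_Mapping.keys (rat_lift n z h u)"
  then have "(\<Sum>i | i \<in> rat_indices n \<and> rat_repr n z u i \<noteq> 0. rat_repr n z u i * Poly_Mapping.lookup (h i) a) \<noteq> 0"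
    by (simp add: rat_lift_def in_keys_iff lookup_sum)
  from sum.not_neutral_contains_not_neutral[OF this] obtain i where
    "i \<in> {i. i \<in> rat_indices n \<and> rat_repr n z u i \<noteq> 0}" "rat_repr n z u i * Poly_Mapping.lookup (h i) a \<noteq> 0" .
  then have "i \<in> rat_indices n" "a \<in> Poly_Mapping.keys (h i)" by (simp_all add: in_keys_iff)
  then show "a \<in> A" using assms by blast
qed

text \<open>The functionals \<open>L i\<close> descend to the quotient by \<open>R\<close> and are
  dual to the images \<open>h i\<close> up to nonzero factors, so they read off the coordinates of
  \<open>d\<close>.\<close>

lemma rat_lift_inj_mod:
  assumes z: "inj_on z {1..n}" and d: "d \<in> rat_span n z" and R: "rat_lift n z h d \<in> R"
    and L: "\<And>i. i \<in> rat_indices n \<Longrightarrow> functional_linear (L i)"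
      "\<And>i x. i \<in> rat_indices n \<Longrightarrow> x \<in> R \<Longrightarrow> L i x = 0"
      "\<And>i j. i \<in> rat_indices n \<Longrightarrow> j \<in> rat_indices n \<Longrightarrow> L i (h j) = (if i = j then c i else 0)"
      "\<And>i. i \<in> rat_indices n \<Longrightarrow> c i \<noteq> 0"
  shows "d = 0"
proof -
  have repr0: "rat_repr n z d i = 0" if i: "i \<in> rat_indices n" for i
  proof -
    interpret linear_functional "L i"
      using L(1)[OF i] by (rule linear_functional.intro)
    let ?N = "{i \<in> rat_indices n. rat_repr n z d i \<noteq> 0}"
    have "0 = L i (rat_lift n z h d)" using L(2)[OF i R] by simp
    also have "\<dots> = (\<Sum>j\<in>?N. rat_repr n z d j * L i (h j))"
      by (simp add: rat_lift_def sum scale)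
    also have "\<dots> = (\<Sum>j\<in>?N. if j = i then rat_repr n z d i * c i else 0)"
      using L(3)[OF i] by (intro sum.cong) auto
    also have "\<dots> = rat_repr n z d i * c i"
      using finite_rat_repr[OF z, of d] i by (simp add: sum.delta)
    finally show ?thesis using L(4)[OF i] by simp
  qed
  have "rat.representation (rat_basis z ` rat_indices n) d b = 0" for b
  proof (cases "b \<in> rat_basis z ` rat_indices n")
    case True
    then show ?thesis using repr0 by auto
  next
    case False
    then show ?thesis using rat.representation_ne_zero by blast
  qed
  then show ?thesis
    using rat.sum_nonzero_representation_eq[OF rat_basis_independent[OF z] d] by simp
qed

subsection \<open>Cosets\<close>

lemma coset_eq_iff:
  fixes R :: "('b \<Rightarrow>\<^sub>0 complex) set"
  assumes "pm.subspace R"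
  shows "a +o R = b +o R \<longleftrightarrow> a - b \<in> R"
proof
  assume "a +o R = b +o R"
  moreover have "a \<in> a +o R" using pm.subspace_0[OF assms] by (force simp: elt_set_plus_def)
  ultimately obtain r where "r \<in> R" "a = b + r" by (auto simp: elt_set_plus_def)
  then show "a - b \<in> R" by simp
next
  assume ab: "a - b \<in> R"
  have "x +o R \<subseteq> y +o R" if "x - y \<in> R" for x y
  proof
    fix t assume "t \<in> x +o R"
    then obtain r where "r \<in> R" "t = x + r" by (auto simp: elt_set_plus_def)
    then have "t = y + ((x - y) + r)" "(x - y) + r \<in> R" using that pm.subspace_add[OF assms] by auto
    then show "t \<in> y +o R" unfolding elt_set_plus_def by blast
  qed
  moreover have "b - a \<in> R" using pm.subspace_neg[OF assms ab] by simp
  ultimately show "a +o R = b +o R" using ab by blast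
qed

lemma coset_linear:
  fixes R :: "('b \<Rightarrow>\<^sub>0 complex) set"
  assumes R: "pm.subspace R"
  shows "(pm_scale c a + b) +o R = pm_scale c ` (a +o R) + (b +o R)"
proof (intro equalityI subsetI)
  fix t assume "t \<in> (pm_scale c a + b) +o R"
  then obtain r where r: "r \<in> R" "t = pm_scale c a + b + r" by (auto simp: elt_set_plus_def)
  \<comment> \<open>All of \<open>r\<close> goes into the second coset, because for c = 0 the first
    one shrinks to a point.\<close>
  have "a \<in> a +o R" using pm.subspace_0[OF R] by (force simp: elt_set_plus_def)
  moreover have "b + r \<in> b +o R" using r by (auto simp: elt_set_plus_def)
  ultimately have "pm_scale c a + (b + r) \<in> pm_scale c ` (a +o R) + (b +o R)"
    by (intro set_plus_intro imageI)
  then show "t \<in> pm_scale c ` (a +o R) + (b +o R)" using r by (simp add: add.assoc)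
next
  fix t assume "t \<in> pm_scale c ` (a +o R) + (b +o R)"
  then obtain r r' where r: "r \<in> R" "r' \<in> R" "t = pm_scale c (a + r) + (b + r')"
    by (auto simp: elt_set_plus_def set_plus_def)
  have "pm_scale c r + r' \<in> R" using r by (intro pm.subspace_add[OF R] pm.subspace_scale[OF R])
  moreover have "t = (pm_scale c a + b) + (pm_scale c r + r')"
    using r(3) by (simp add: pm.scale_right_distrib)
  ultimately show "t \<in> (pm_scale c a + b) +o R" by (auto simp: elt_set_plus_def)
qed

lemma linear_to_cosets_rat_lift:
  assumes z: "inj_on z {1..n}" and R: "pm.subspace R"
    and h: "\<And>i. i \<in> rat_indices n \<Longrightarrow> Poly_Mapping.keys (h i) \<subseteq> A"
  shows "linear_to_cosets (Omega0 n z) {x +o R | x. Poly_Mapping.keys x \<subseteq> A} (\<lambda>u. rat_lift n z h u +o R)"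
  unfolding linear_to_cosets_def Omega0_eq_span[OF z]
proof (intro conjI allI ballI)
  show "(\<lambda>u. rat_lift n z h u +o R) \<in> rat_span n z \<rightarrow> {x +o R |x. Poly_Mapping.keys x \<subseteq> A}"
  proof -
    have "Poly_Mapping.keys (rat_lift n z h u) \<subseteq> A" for u
      by (rule rat_lift_keys) (rule h)
    then show ?thesis by blast
  qed
  fix c u u' assume "u \<in> rat_span n z" "u' \<in> rat_span n z"
  then show "rat_lift n z h (rat_scale c u + u') +o R
      = pm_scale c ` (rat_lift n z h u +o R) + (rat_lift n z h u' +o R)"
    by (simp add: rat_lift_add[OF z] rat_lift_scale[OF z] rat.span_scale coset_linear[OF R])
qed

subsection \<open>Tensor products of contragradient modules\<close>

locale tensor =
  fixes n :: nat and z :: "nat \<Rightarrow> complex" and k :: complex and m :: "nat \<Rightarrow> complex"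
begin

abbreviation F :: "family set" where "F \<equiv> families n k m"
abbreviation R0 :: "(family \<Rightarrow>\<^sub>0 complex) set" where "R0 \<equiv> rel_C0 n k m"
abbreviation R1 :: "(sl2_fun \<times> family \<Rightarrow>\<^sub>0 complex) set" where "R1 \<equiv> rel_C1 n z k m"

lemma subspace_R0: "pm.subspace R0"
  unfolding rel_C0_def by (rule pm.subspace_span)

lemma subspace_R1: "pm.subspace R1"
  unfolding rel_C1_def by (rule pm.subspace_span)

lemma F_upd: "w \<in> F \<Longrightarrow> j \<in> {1..n+1} \<Longrightarrow> a \<in> verma_dual k (m j) \<Longrightarrow> w(j := a) \<in> F"
  by (auto simp: families_def PiE_iff extensional_def)

lemma F_mem: "w \<in> F \<Longrightarrow> j \<in> {1..n+1} \<Longrightarrow> w j \<in> verma_dual k (m j)"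
  by (auto simp: families_def)

definition eqv :: "(family \<Rightarrow>\<^sub>0 complex) \<Rightarrow> (family \<Rightarrow>\<^sub>0 complex) \<Rightarrow> bool" (infix "\<approx>" 50) where
  "x \<approx> y \<longleftrightarrow> x - y \<in> R0"

lemma eqv_refl [simp]: "x \<approx> x"
  by (simp add: eqv_def pm.subspace_0[OF subspace_R0])

lemma eqv_sym: "x \<approx> y \<Longrightarrow> y \<approx> x"
  unfolding eqv_def using pm.subspace_neg[OF subspace_R0] by fastforce

lemma eqv_trans [trans]: "x \<approx> y \<Longrightarrow> y \<approx> v \<Longrightarrow> x \<approx> v"
  unfolding eqv_def using pm.subspace_add[OF subspace_R0] by fastforce

lemma eq_eqv_trans [trans]: "x = y \<Longrightarrow> y \<approx> v \<Longrightarrow> x \<approx> v"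
  and eqv_eq_trans [trans]: "x \<approx> y \<Longrightarrow> y = v \<Longrightarrow> x \<approx> v"
  by simp_all

lemma eqv_add: "x \<approx> y \<Longrightarrow> x' \<approx> y' \<Longrightarrow> x + x' \<approx> y + y'"
  unfolding eqv_def using pm.subspace_add[OF subspace_R0, of "x - y" "x' - y'"] by (simp add: algebra_simps)

lemma eqv_diff: "x \<approx> y \<Longrightarrow> x' \<approx> y' \<Longrightarrow> x - x' \<approx> y - y'"
  unfolding eqv_def using pm.subspace_diff[OF subspace_R0, of "x - y" "x' - y'"] by (simp add: algebra_simps)

lemma eqv_scale: "x \<approx> y \<Longrightarrow> pm_scale c x \<approx> pm_scale c y"
  unfolding eqv_def using pm.subspace_scale[OF subspace_R0, of "x - y" c] by (simp add: pm.scale_right_diff_distrib)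

lemma eqv_sum: "(\<And>i. i \<in> I \<Longrightarrow> f i \<approx> g i) \<Longrightarrow> (\<Sum>i\<in>I. f i) \<approx> (\<Sum>i\<in>I. g i)"
  by (induction I rule: infinite_finite_induct) (auto simp: eqv_add)

context
  fixes w :: family and j :: nat
  assumes w: "w \<in> F" and j: "j \<in> {1..n+1}"
begin

lemma tensor_add:
  assumes "a \<in> verma_dual k (m j)" "b \<in> verma_dual k (m j)"
  shows "unit (w(j := (\<lambda>x. a x + b x))) \<approx> unit (w(j := a)) + unit (w(j := b))"
proof -
  have "unit (w(j := (\<lambda>x. a x + b x))) - unit (w(j := a)) - unit (w(j := b)) \<in> R0"
    unfolding rel_C0_def by (rule pm.span_base) (use w j assms in blast)
  then show ?thesis by (simp add: eqv_def algebra_simps)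
qed

lemma tensor_scale:
  assumes "a \<in> verma_dual k (m j)"
  shows "unit (w(j := (\<lambda>x. c * a x))) \<approx> pm_scale c (unit (w(j := a)))"
proof -
  have "unit (w(j := (\<lambda>x. c * a x))) - Poly_Mapping.single (w(j := a)) c \<in> R0"
    unfolding rel_C0_def by (rule pm.span_base) (use w j assms in blast)
  then show ?thesis by (simp add: eqv_def)
qed

lemma tensor_zero: "unit (w(j := (\<lambda>x. 0))) \<approx> 0"
  using tensor_scale[OF verma_dual_zero, of 0] by simp

lemma tensor_sum:
  assumes "\<And>i. i \<in> I \<Longrightarrow> f i \<in> verma_dual k (m j)"
  shows "unit (w(j := (\<lambda>x. \<Sum>i\<in>I. f i x))) \<approx> (\<Sum>i\<in>I. unit (w(j := f i)))"
  using assms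
proof (induction I rule: infinite_finite_induct)
  case (insert i I)
  have "unit (w(j := (\<lambda>x. f i x + (\<Sum>i\<in>I. f i x)))) \<approx> unit (w(j := f i)) + unit (w(j := (\<lambda>x. \<Sum>i\<in>I. f i x)))"
    using insert.prems by (intro tensor_add verma_dual_sum) auto
  also have "\<dots> \<approx> unit (w(j := f i)) + (\<Sum>i\<in>I. unit (w(j := f i)))"
    using insert.IH insert.prems by (intro eqv_add eqv_refl) blast
  finally show ?case unfolding sum.insert[OF insert.hyps] .
qed (use tensor_zero in simp_all)

lemma tensor_diff:
  assumes "a \<in> verma_dual k (m j)" "b \<in> verma_dual k (m j)"
  shows "unit (w(j := (\<lambda>x. a x - b x))) \<approx> unit (w(j := a)) - unit (w(j := b))"
proof -
  have "unit (w(j := (\<lambda>x. a x + -1 * b x))) \<approx> unit (w(j := a)) + unit (w(j := (\<lambda>x. -1 * b x)))"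
    using assms by (intro tensor_add verma_dual_scale)
  also have "\<dots> \<approx> unit (w(j := a)) + pm_scale (-1) (unit (w(j := b)))"
    using assms by (intro eqv_add tensor_scale) auto
  finally show ?thesis by (simp del: pm_scale_single)
qed

end

subsection \<open>The differential on cosets\<close>

text \<open>Infinity becomes the index \<open>n + 1\<close>, so that the whole action is one uniform
  sum.\<close>

definition act_at :: "nat \<Rightarrow> sl2_fun \<Rightarrow> functional \<Rightarrow> functional" where
  "act_at j g \<phi> = (if j \<le> n then series_act (\<lambda>a. expand_at (z j) (g a)) \<phi>
     else series_act (pi_series (\<lambda>a. expand_infinity (g a))) \<phi>)"

lemma fun_act_eq: "fun_act n z g w = (\<Sum>j=1..n+1. unit (w(j := act_at j g (w j))))"
  by (simp add: fun_act_def act_at_def)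

lemma act_at_verma_dual: "\<phi> \<in> verma_dual k M \<Longrightarrow> act_at j g \<phi> \<in> verma_dual k M"
  by (simp add: act_at_def series_act_verma_dual)

lemma pi_series_simps: "pi_series A sl_e = A sl_f" "pi_series A sl_f = A sl_e" "pi_series A sl_h = - A sl_h"
  by (simp_all add: pi_series_def)

lemma series_part_uminus: "series_part a (- L) \<phi> x = - series_part a L \<phi> x"
  by (simp add: series_part_def Sum_any.expand_set sum_negf)

lemma act_at_add_left:
  assumes "\<phi> \<in> verma_dual k M"
  shows "act_at j (\<lambda>a. g a + g' a) \<phi> = (\<lambda>x. act_at j g \<phi> x + act_at j g' \<phi> x)"
  by (simp add: act_at_def series_act_parts pi_series_simps expand_at_add expand_infinity_add
      series_part_uminus series_part_add[OF assms] del: add_uminus_conv_diff minus_add_distrib) (simp add: algebra_simps)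

lemma act_at_scale_left:
  assumes "\<phi> \<in> verma_dual k M"
  shows "act_at j (\<lambda>a. rat_scale c (g a)) \<phi> = (\<lambda>x. c * act_at j g \<phi> x)"
  by (simp add: act_at_def series_act_parts pi_series_simps expand_at_scale expand_infinity_scale
      series_part_uminus series_part_scale[OF assms]) (simp add: algebra_simps)

lemma act_at_add_right:
  assumes "\<phi> \<in> verma_dual k M" "\<psi> \<in> verma_dual k M"
  shows "act_at j g (\<lambda>x. \<phi> x + \<psi> x) = (\<lambda>x. act_at j g \<phi> x + act_at j g \<psi> x)"
  by (simp add: act_at_def series_act_parts series_part_add_right[OF assms]) (simp add: algebra_simps)

lemma act_at_scale_right: "act_at j g (\<lambda>x. c * \<phi> x) = (\<lambda>x. c * act_at j g \<phi> x)"
  by (simp add: act_at_def series_act_parts series_part_scale_right) (simp add: algebra_simps)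

abbreviation D :: "(sl2_fun \<times> family \<Rightarrow>\<^sub>0 complex) \<Rightarrow> (family \<Rightarrow>\<^sub>0 complex)" where
  "D \<equiv> pm_lift (\<lambda>(g, w). fun_act n z g w)"

text \<open>The action on each factor is linear both in the Lie algebra element and in the
  functional, so multilinearity relations go to multilinearity relations.\<close>

lemma D_rel: "x \<in> R1 \<Longrightarrow> D x \<in> R0"
  unfolding rel_C1_def
proof (induction rule: pm.span_induct)
  case base
  show ?case
    by (auto simp: pm.subspace_def pm_lift_add pm_lift_scale intro: pm.subspace_0[OF subspace_R0]
        pm.subspace_add[OF subspace_R0] pm.subspace_scale[OF subspace_R0])
next
  case (step x)
  from step consider
      g g' w where "x = unit ((\<lambda>a. g a + g' a), w) - unit (g, w) - unit (g', w)" "w \<in> F"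
    | g c w where "x = unit ((\<lambda>a. rat_scale c (g a)), w) - Poly_Mapping.single (g, w) c" "w \<in> F"
    | g w j a b where "x = unit (g, w(j := (\<lambda>x. a x + b x))) - unit (g, w(j := a)) - unit (g, w(j := b))"
        "w \<in> F" "j \<in> {1..n+1}" "a \<in> verma_dual k (m j)" "b \<in> verma_dual k (m j)"
    | g w j a c where "x = unit (g, w(j := (\<lambda>x. c * a x))) - Poly_Mapping.single (g, w(j := a)) c"
        "w \<in> F" "j \<in> {1..n+1}" "a \<in> verma_dual k (m j)"
    by (elim UnE CollectE exE conjE) blast+
  then have "D x \<approx> 0"
  proof cases
    case 1
    note x = 1(1) and w = 1(2)
    have "fun_act n z (\<lambda>a. g a + g' a) w \<approx> fun_act n z g w + fun_act n z g' w"
      unfolding fun_act_eq sum.distrib[symmetric]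
    proof (rule eqv_sum)
      fix j assume j: "j \<in> {1..n+1}"
      show "unit (w(j := act_at j (\<lambda>a. g a + g' a) (w j))) \<approx> unit (w(j := act_at j g (w j))) + unit (w(j := act_at j g' (w j)))"
        unfolding act_at_add_left[OF F_mem[OF w j]]
        by (intro tensor_add w j act_at_verma_dual F_mem)
    qed
    then show ?thesis unfolding x by (simp add: pm_lift_diff pm_lift_add eqv_def algebra_simps)
  next
    case 2
    note x = 2(1) and w = 2(2)
    have "fun_act n z (\<lambda>a. rat_scale c (g a)) w \<approx> pm_scale c (fun_act n z g w)"
      unfolding fun_act_eq pm.scale_sum_right
    proof (rule eqv_sum)
      fix j assume j: "j \<in> {1..n+1}"
      show "unit (w(j := act_at j (\<lambda>a. rat_scale c (g a)) (w j))) \<approx> pm_scale c (unit (w(j := act_at j g (w j))))"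
        unfolding act_at_scale_left[OF F_mem[OF w j]]
        by (intro tensor_scale w j act_at_verma_dual F_mem)
    qed
    then show ?thesis unfolding x by (simp add: pm_lift_diff eqv_def)
  next
    case 3
    note x = 3(1) and w = 3(2) and j = 3(3) and a = 3(4) and b = 3(5)
    have "fun_act n z g (w(j := (\<lambda>x. a x + b x))) \<approx> fun_act n z g (w(j := a)) + fun_act n z g (w(j := b))"
      unfolding fun_act_eq sum.distrib[symmetric]
    proof (rule eqv_sum)
      fix i assume i: "i \<in> {1..n+1}"
      show "unit ((w(j := (\<lambda>x. a x + b x)))(i := act_at i g ((w(j := (\<lambda>x. a x + b x))) i)))
        \<approx> unit ((w(j := a))(i := act_at i g ((w(j := a)) i))) + unit ((w(j := b))(i := act_at i g ((w(j := b)) i)))"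
      proof (cases "i = j")
        case True
        then show ?thesis
          using tensor_add[OF w j act_at_verma_dual[OF a] act_at_verma_dual[OF b]]
          by (simp add: act_at_add_right[OF a b])
      next
        case False
        \<comment> \<open>The action changes factor \<open>i\<close> and the relation concerns
          factor \<open>j\<close>; the updates commute, so the relation is used over the family
          already changed at \<open>i\<close>.\<close>
        have "w(i := act_at i g (w i)) \<in> F" by (intro F_upd w i act_at_verma_dual F_mem)
        from tensor_add[OF this j a b] show ?thesis using False by (simp add: fun_upd_twist)
      qed
    qed
    then show ?thesis unfolding x by (simp add: pm_lift_diff pm_lift_add eqv_def algebra_simps)
  next
    case 4
    note x = 4(1) and w = 4(2) and j = 4(3) and a = 4(4)
    have "fun_act n z g (w(j := (\<lambda>x. c * a x))) \<approx> pm_scale c (fun_act n z g (w(j := a)))"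
      unfolding fun_act_eq pm.scale_sum_right
    proof (rule eqv_sum)
      fix i assume i: "i \<in> {1..n+1}"
      show "unit ((w(j := (\<lambda>x. c * a x)))(i := act_at i g ((w(j := (\<lambda>x. c * a x))) i)))
        \<approx> pm_scale c (unit ((w(j := a))(i := act_at i g ((w(j := a)) i))))"
      proof (cases "i = j")
        case True
        then show ?thesis
          using tensor_scale[OF w j act_at_verma_dual[OF a], of c]
          by (simp add: act_at_scale_right del: pm_scale_single)
      next
        case False
        have "w(i := act_at i g (w i)) \<in> F" by (intro F_upd w i act_at_verma_dual F_mem)
        from tensor_scale[OF this j a, of c] show ?thesis using False
          by (simp add: fun_upd_twist del: pm_scale_single)
      qed
    qed
    then show ?thesis unfolding x by (simp add: pm_lift_diff eqv_def)
  qed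
  then show ?case by (simp add: eqv_def)
qed

text \<open>By \<open>D_rel\<close> all representatives have the same image, so
  \<open>the_elem\<close> is applied to a singleton.\<close>

lemma dCE_coset: "dCE n z k m (r +o R1) = D r +o R0"
proof -
  have "(\<lambda>x. D x +o R0) ` (r +o R1) = {D r +o R0}"
  proof (intro equalityI subsetI)
    fix t assume "t \<in> (\<lambda>x. D x +o R0) ` (r +o R1)"
    then obtain s where s: "s \<in> R1" "t = D (r + s) +o R0" by (auto simp: elt_set_plus_def)
    then show "t \<in> {D r +o R0}"
      using D_rel[OF s(1)] by (simp add: coset_eq_iff[OF subspace_R0] pm_lift_add)
  next
    fix t assume "t \<in> {D r +o R0}"
    moreover have "r \<in> r +o R1" using pm.subspace_0[OF subspace_R1] by (force simp: elt_set_plus_def)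
    ultimately show "t \<in> (\<lambda>x. D x +o R0) ` (r +o R1)" by blast
  qed
  then show ?thesis by (simp add: dCE_def)
qed

end

lemma Phi_verma_dual: "Phi s k m F \<in> verma_dual k m"
  by (rule verma_dual_homogI[OF Phi_verma_fun Phi_homog])

lemma Dsum_verma_dual: "Dsum s k m N \<in> verma_dual k m"
  by (rule verma_dual_homogI[OF Dsum_verma_fun Dsum_homog])

context tensor
begin

abbreviation V :: "nat \<Rightarrow> functional" where "V j \<equiv> vac True k (m j)"
abbreviation w0 :: family where "w0 \<equiv> vacuum n k m"
abbreviation P :: "nat \<Rightarrow> nat \<Rightarrow> (family \<Rightarrow>\<^sub>0 complex)" where
  "P j a \<equiv> unit (w0(j := D1 True k (m j) a))"
abbreviation E :: "nat \<Rightarrow> (family \<Rightarrow>\<^sub>0 complex)" where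
  "E a \<equiv> unit (w0(n + 1 := D1 False k (m (n + 1)) a))"

text \<open>The common form of \<open>eta0\<close> on poles and on powers of t, with
  \<open>q\<close> the distinguished factor.\<close>

abbreviation shape :: "nat \<Rightarrow> nat \<Rightarrow> ratfun \<Rightarrow> (nat \<Rightarrow> ratfun) \<Rightarrow> (nat \<Rightarrow> ratfun) \<Rightarrow>
    (nat \<Rightarrow> functional) \<Rightarrow> (nat \<Rightarrow> functional) \<Rightarrow> (sl2_fun \<times> family \<Rightarrow>\<^sub>0 complex)" where
  "shape q N uf ue uh \<phi> \<psi> \<equiv> unit (sl2_tensor sl_f uf, w0) - (\<Sum>l=1..N. unit (sl2_tensor sl_e (ue l), w0(q := \<phi> l))
        + unit (sl2_tensor sl_h (uh l), w0(q := \<psi> l)))"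

lemma w0_eq: "j \<in> {1..n+1} \<Longrightarrow> w0 j = V j"
  by (simp add: vacuum_def vac_eq[of _ _ True])

lemma w0_F: "w0 \<in> F"
  by (auto simp: families_def vacuum_def vac_eq[of _ _ True] Phi_verma_dual)

lemma w0_upd_V: "j \<in> {1..n+1} \<Longrightarrow> w0(j := V j) = w0"
  using w0_eq by (metis fun_upd_triv)

lemma act_at_tensor:
  "j \<le> n \<Longrightarrow> act_at j (sl2_tensor x u) \<phi> = series_part x (expand_at (z j) u) \<phi>"
  "act_at (n + 1) (sl2_tensor sl_e u) \<phi> = series_part sl_f (expand_infinity u) \<phi>"
  "act_at (n + 1) (sl2_tensor sl_f u) \<phi> = series_part sl_e (expand_infinity u) \<phi>"
  "act_at (n + 1) (sl2_tensor sl_h u) \<phi> = (\<lambda>x. - series_part sl_h (expand_infinity u) \<phi> x)"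
proof -
  show "j \<le> n \<Longrightarrow> act_at j (sl2_tensor x u) \<phi> = series_part x (expand_at (z j) u) \<phi>"
    by (cases x) (simp_all add: act_at_def series_act_parts sl2_tensor_def fun_eq_iff)
qed (simp_all add: act_at_def series_act_parts sl2_tensor_def fun_eq_iff pi_series_simps series_part_uminus)

text \<open>At infinity a zero is demanded, as (t - z_p)^-a has one. That factor then contributes
  nothing, which is why \<open>val\<close> is 0 there.\<close>

definition reg :: "nat \<Rightarrow> ratfun \<Rightarrow> bool" where
  "reg j u \<longleftrightarrow> (if j \<le> n then \<forall>i<0. fls_nth (expand_at (z j) u) i = 0
     else \<forall>i\<le>0. fls_nth (expand_infinity u) i = 0)"

definition val :: "ratfun \<Rightarrow> nat \<Rightarrow> complex" where
  "val u j = (if j \<le> n then fls_nth (expand_at (z j) u) 0 else 0)"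

lemma act_at_reg:
  assumes j: "j \<in> {1..n+1}" and r: "reg j u"
  shows "act_at j (sl2_tensor sl_e u) (V j) = (\<lambda>x. 0)"
    "act_at j (sl2_tensor sl_f u) (V j) = (\<lambda>x. val u j * m j * D1 True k (m j) 0 x)"
    "act_at j (sl2_tensor sl_h u) (V j) = (\<lambda>x. val u j * m j * V j x)"
proof -
  have "act_at j (sl2_tensor sl_e u) (V j) = (\<lambda>x. 0)
    \<and> act_at j (sl2_tensor sl_f u) (V j) = (\<lambda>x. val u j * m j * D1 True k (m j) 0 x)
    \<and> act_at j (sl2_tensor sl_h u) (V j) = (\<lambda>x. val u j * m j * V j x)"
  proof (cases "j \<le> n")
    case True
    then have "\<And>i. i < 0 \<Longrightarrow> fls_nth (expand_at (z j) u) i = 0" using r by (simp add: reg_def)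
    then show ?thesis
      using True by (simp add: act_at_tensor series_part_vac val_def fun_eq_iff)
  next
    case False
    then have jn: "j = n + 1" using j by simp
    have *: "\<And>i. i < 0 \<Longrightarrow> fls_nth (expand_infinity u) i = 0" "fls_nth (expand_infinity u) 0 = 0"
      using r False by (simp_all add: reg_def)
    show ?thesis
      unfolding jn act_at_tensor using * by (simp add: series_part_vac val_def fun_eq_iff)
  qed
  then show "act_at j (sl2_tensor sl_e u) (V j) = (\<lambda>x. 0)"
    "act_at j (sl2_tensor sl_f u) (V j) = (\<lambda>x. val u j * m j * D1 True k (m j) 0 x)"
    "act_at j (sl2_tensor sl_h u) (V j) = (\<lambda>x. val u j * m j * V j x)"
    by blast+
qed

section \<open>The action on tensors with one distinguished factor\<close>

context
  fixes q :: nat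
  assumes q: "q \<in> {1..n+1}"
begin

abbreviation others :: "nat set" where "others \<equiv> {1..n+1} - {q}"

lemma fun_act_split:
  "fun_act n z g (w0(q := \<phi>)) = unit (w0(q := act_at q g \<phi>))
     + (\<Sum>j\<in>others. unit ((w0(q := \<phi>))(j := act_at j g (V j))))"
proof -
  have "fun_act n z g (w0(q := \<phi>)) = unit ((w0(q := \<phi>))(q := act_at q g ((w0(q := \<phi>)) q)))
     + (\<Sum>j\<in>others. unit ((w0(q := \<phi>))(j := act_at j g ((w0(q := \<phi>)) j))))"
    unfolding fun_act_eq by (rule sum.remove) (use q in auto)
  also have "(\<Sum>j\<in>others. unit ((w0(q := \<phi>))(j := act_at j g ((w0(q := \<phi>)) j))))
      = (\<Sum>j\<in>others. unit ((w0(q := \<phi>))(j := act_at j g (V j))))"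
    by (intro sum.cong) (auto simp: w0_eq)
  finally show ?thesis by (simp only: fun_upd_upd fun_upd_same)
qed

lemma fun_act_e:
  assumes \<phi>: "\<phi> \<in> verma_dual k (m q)" and r: "\<And>j. j \<in> others \<Longrightarrow> reg j u"
  shows "fun_act n z (sl2_tensor sl_e u) (w0(q := \<phi>)) \<approx> unit (w0(q := act_at q (sl2_tensor sl_e u) \<phi>))"
proof -
  have "(\<Sum>j\<in>others. unit ((w0(q := \<phi>))(j := act_at j (sl2_tensor sl_e u) (V j)))) \<approx> (\<Sum>j\<in>others. 0)"
    using r by (intro eqv_sum) (auto simp: act_at_reg intro!: tensor_zero F_upd w0_F q \<phi>)
  from eqv_add[OF eqv_refl this] show ?thesis
    unfolding fun_act_split by simp
qed

lemma fun_act_h: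
  assumes \<phi>: "\<phi> \<in> verma_dual k (m q)" and r: "\<And>j. j \<in> others \<Longrightarrow> reg j u"
  shows "fun_act n z (sl2_tensor sl_h u) (w0(q := \<phi>)) \<approx> unit (w0(q := act_at q (sl2_tensor sl_h u) \<phi>))
    + (\<Sum>j\<in>others. pm_scale (val u j * m j) (unit (w0(q := \<phi>))))"
proof -
  have "(\<Sum>j\<in>others. unit ((w0(q := \<phi>))(j := act_at j (sl2_tensor sl_h u) (V j))))
      \<approx> (\<Sum>j\<in>others. pm_scale (val u j * m j) (unit (w0(q := \<phi>))))"
  proof (rule eqv_sum)
    fix j assume j: "j \<in> others"
    then have j': "j \<in> {1..n+1}" "j \<noteq> q" by auto
    have "unit ((w0(q := \<phi>))(j := (\<lambda>x. (val u j * m j) * V j x)))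
        \<approx> pm_scale (val u j * m j) (unit ((w0(q := \<phi>))(j := V j)))"
      by (intro tensor_scale F_upd w0_F q \<phi> j' Phi_verma_dual)
    moreover have "(w0(q := \<phi>))(j := V j) = w0(q := \<phi>)"
      using w0_upd_V[OF j'(1)] j'(2) by (metis fun_upd_twist)
    ultimately show "unit ((w0(q := \<phi>))(j := act_at j (sl2_tensor sl_h u) (V j)))
      \<approx> pm_scale (val u j * m j) (unit (w0(q := \<phi>)))"
      by (simp only: act_at_reg(3)[OF j'(1) r[OF j]])
  qed
  from eqv_add[OF eqv_refl this] show ?thesis
    unfolding fun_act_split .
qed

lemma fun_act_f:
  assumes r: "\<And>j. j \<in> others \<Longrightarrow> reg j u"
  shows "fun_act n z (sl2_tensor sl_f u) w0 \<approx> unit (w0(q := act_at q (sl2_tensor sl_f u) (V q)))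
    + (\<Sum>j\<in>others. pm_scale (val u j * m j) (P j 0))"
proof -
  have "(\<Sum>j\<in>others. unit (w0(j := act_at j (sl2_tensor sl_f u) (V j))))
      \<approx> (\<Sum>j\<in>others. pm_scale (val u j * m j) (P j 0))"
  proof (rule eqv_sum)
    fix j assume j: "j \<in> others"
    then have j': "j \<in> {1..n+1}" by auto
    show "unit (w0(j := act_at j (sl2_tensor sl_f u) (V j))) \<approx> pm_scale (val u j * m j) (P j 0)"
      unfolding act_at_reg(2)[OF j' r[OF j]]
      by (intro tensor_scale w0_F j' Phi_verma_dual)
  qed
  from eqv_add[OF eqv_refl this] show ?thesis
    using fun_act_split[of "sl2_tensor sl_f u" "V q"] unfolding w0_upd_V[OF q] by simp
qed

text \<open>All functions involved are regular at the points other than the \<open>q\<close>-th, where only their values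
  matter; the hypothesis \<open>key\<close> is the action on the \<open>q\<close>-th tensor factor.\<close>

lemma D_eta0_shape:
  assumes \<phi>: "\<And>l. \<phi> l \<in> verma_dual k (m q)" and \<psi>: "\<And>l. \<psi> l \<in> verma_dual k (m q)"
    and \<psi>0: "\<psi>0 \<in> verma_dual k (m q)"
    and rf: "\<And>j. j \<in> others \<Longrightarrow> reg j uf"
    and re: "\<And>j l. j \<in> others \<Longrightarrow> l \<in> {1..N} \<Longrightarrow> reg j (ue l)"
    and rh: "\<And>j l. j \<in> others \<Longrightarrow> l \<in> {1..N} \<Longrightarrow> reg j (uh l)"
    and key: "\<And>x. act_at q (sl2_tensor sl_f uf) (V q) x
      - (\<Sum>l=1..N. act_at q (sl2_tensor sl_e (ue l)) (\<phi> l) x + act_at q (sl2_tensor sl_h (uh l)) (\<psi> l) x) = c * \<psi>0 x"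
  shows "D (shape q N uf ue uh \<phi> \<psi>)
    \<approx> pm_scale c (unit (w0(q := \<psi>0)))
      + (\<Sum>j\<in>others. pm_scale (val uf j * m j) (P j 0)
          - (\<Sum>l=1..N. pm_scale (val (uh l) j * m j) (unit (w0(q := \<psi> l)))))"
proof -
  let ?af = "act_at q (sl2_tensor sl_f uf) (V q)"
  let ?ae = "\<lambda>l. act_at q (sl2_tensor sl_e (ue l)) (\<phi> l)"
  let ?ah = "\<lambda>l. act_at q (sl2_tensor sl_h (uh l)) (\<psi> l)"
  let ?of = "\<Sum>j\<in>others. pm_scale (val uf j * m j) (P j 0)"
  let ?oh = "\<lambda>l. \<Sum>j\<in>others. pm_scale (val (uh l) j * m j) (unit (w0(q := \<psi> l)))"
  have vf: "?af \<in> verma_dual k (m q)" "\<And>l. ?ae l \<in> verma_dual k (m q)" "\<And>l. ?ah l \<in> verma_dual k (m q)"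
    by (intro act_at_verma_dual Phi_verma_dual \<phi> \<psi>)+
  have f: "fun_act n z (sl2_tensor sl_f uf) w0 \<approx> unit (w0(q := ?af)) + ?of"
    by (rule fun_act_f) (rule rf)
  have e: "fun_act n z (sl2_tensor sl_e (ue l)) (w0(q := \<phi> l)) \<approx> unit (w0(q := ?ae l))" if "l \<in> {1..N}" for l
    by (rule fun_act_e[OF \<phi>[of l]]) (rule re[OF _ that])
  have h: "fun_act n z (sl2_tensor sl_h (uh l)) (w0(q := \<psi> l)) \<approx> unit (w0(q := ?ah l)) + ?oh l" if "l \<in> {1..N}" for l
    by (rule fun_act_h[OF \<psi>[of l]]) (rule rh[OF _ that])
  have eh: "(\<Sum>l=1..N. fun_act n z (sl2_tensor sl_e (ue l)) (w0(q := \<phi> l)) + fun_act n z (sl2_tensor sl_h (uh l)) (w0(q := \<psi> l)))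
      \<approx> (\<Sum>l=1..N. unit (w0(q := ?ae l)) + (unit (w0(q := ?ah l)) + ?oh l))"
    by (rule eqv_sum) (rule eqv_add[OF e h])
  have "D (shape q N uf ue uh \<phi> \<psi>)
    = fun_act n z (sl2_tensor sl_f uf) w0 - (\<Sum>l=1..N. fun_act n z (sl2_tensor sl_e (ue l)) (w0(q := \<phi> l))
        + fun_act n z (sl2_tensor sl_h (uh l)) (w0(q := \<psi> l)))"
    by (simp add: pm_lift_diff pm_lift_sum pm_lift_add)
  also have "\<dots> \<approx> (unit (w0(q := ?af)) + ?of)
      - (\<Sum>l=1..N. unit (w0(q := ?ae l)) + (unit (w0(q := ?ah l)) + ?oh l))"
    by (rule eqv_diff[OF f eh])
  also have "\<dots> = (unit (w0(q := ?af)) - (\<Sum>l=1..N. unit (w0(q := ?ae l)) + unit (w0(q := ?ah l))))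
      + (?of - (\<Sum>l=1..N. ?oh l))"
  proof -
    have *: "a + b - (s + (t + u)) = (a - (s + t)) + (b - u)" for a b s t u :: "family \<Rightarrow>\<^sub>0 complex"
      by (simp add: algebra_simps)
    show ?thesis unfolding sum.distrib by (rule *)
  qed
  also have "\<dots> \<approx> pm_scale c (unit (w0(q := \<psi>0))) + (?of - (\<Sum>l=1..N. ?oh l))"
  proof (rule eqv_add[OF _ eqv_refl], rule eqv_trans[OF eqv_sym])
    have "unit (w0(q := (\<lambda>x. ?af x - (\<Sum>l=1..N. ?ae l x + ?ah l x))))
        \<approx> unit (w0(q := ?af)) - unit (w0(q := (\<lambda>x. \<Sum>l=1..N. ?ae l x + ?ah l x)))"
      by (intro tensor_diff w0_F q verma_dual_sum verma_dual_add vf)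
    also have "\<dots> \<approx> unit (w0(q := ?af)) - (\<Sum>l=1..N. unit (w0(q := (\<lambda>x. ?ae l x + ?ah l x))))"
      by (intro eqv_diff eqv_refl tensor_sum w0_F q verma_dual_add vf)
    also have "\<dots> \<approx> unit (w0(q := ?af)) - (\<Sum>l=1..N. unit (w0(q := ?ae l)) + unit (w0(q := ?ah l)))"
      by (intro eqv_diff eqv_refl eqv_sum tensor_add w0_F q vf)
    finally show "unit (w0(q := (\<lambda>x. ?af x - (\<Sum>l=1..N. ?ae l x + ?ah l x))))
      \<approx> unit (w0(q := ?af)) - (\<Sum>l=1..N. unit (w0(q := ?ae l)) + unit (w0(q := ?ah l)))" .
    show "unit (w0(q := (\<lambda>x. ?af x - (\<Sum>l=1..N. ?ae l x + ?ah l x)))) \<approx> pm_scale c (unit (w0(q := \<psi>0)))"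
      unfolding key by (intro tensor_scale w0_F q \<psi>0)
  qed
  also have "?of - (\<Sum>l=1..N. ?oh l) = (\<Sum>j\<in>others. pm_scale (val uf j * m j) (P j 0)
          - (\<Sum>l=1..N. pm_scale (val (uh l) j * m j) (unit (w0(q := \<psi> l)))))"
    by (subst sum.swap) (simp add: sum_subtractf)
  finally show ?thesis .
qed

end

section \<open>The two maps on basis elements\<close>

lemma eta1_Pole: "eta1_basis n k m (Pole p a) = pm_scale (- (k + 2)) (P p (a - 1))"
  using dual_vec_one[of True "a - 1"] by (simp add: lead_def low_def)

lemma eta1_Mono: "eta1_basis n k m (Mono a) = pm_scale (k + 2) (E (a + 1))"
  using dual_vec_one[of False "a + 1"] by (simp add: lead_def low_def)

lemma eta0_Pole: "eta0_basis n z k m (Pole p a) =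
  unit (sl2_tensor sl_f (pole (z p) a), w0) - (\<Sum>l=1..a. unit (sl2_tensor sl_e (pole (z p) l), w0(p := Dsum True k (m p) (a - l)))
        + unit (sl2_tensor sl_h (pole (z p) l), w0(p := D1 True k (m p) (a - l))))"
proof -
  have "(\<lambda>x. 2 * (\<Sum>(i, j)\<in>{(i, j). i + j = N \<and> j \<le> i}. dual_vec k (m p) [down sl_f i, down sl_f j] x))
      = Dsum True k (m p) N" for N
    unfolding Dsum_def pair_set_def using dual_vec_two[of True]
    by (intro ext arg_cong2[of _ _ _ _ "(*)"] refl sum.cong) (auto simp: low_def lead_def)
  moreover have "dual_vec k (m p) [down sl_f i] = D1 True k (m p) i" for i
    using dual_vec_one[of True i] by (simp add: low_def lead_def)
  ultimately show ?thesis by simp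
qed

lemma eta0_Mono: "eta0_basis n z k m (Mono a) =
  unit (sl2_tensor sl_f (mono_t a), w0) - (\<Sum>l=1..a - 1. unit (sl2_tensor sl_e (mono_t (l - 1)), w0(n + 1 := Dsum False k (m (n + 1)) (a - l + 1)))
        + unit (sl2_tensor sl_h (mono_t l), w0(n + 1 := D1 False k (m (n + 1)) (a - l))))"
proof -
  have D: "(\<lambda>x. 2 * (\<Sum>(i, j)\<in>{(i, j). i + j = N \<and> j \<le> i \<and> 1 \<le> j}. dual_vec k (m (n + 1)) [down sl_e i, down sl_e j] x))
      = Dsum False k (m (n + 1)) N" for N
    unfolding Dsum_def pair_set_def using dual_vec_two[of False]
    by (intro ext arg_cong2[of _ _ _ _ "(*)"] refl sum.cong) (auto simp: low_def lead_def)
  have d: "dual_vec k (m (n + 1)) [down sl_e i] = D1 False k (m (n + 1)) i" if "1 \<le> i" for i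
    using dual_vec_one[of False i] that by (simp add: low_def lead_def)
  show ?thesis
    unfolding eta0_basis.simps D
  \<comment> \<open>The index is shifted by one, so that the sum has the range 1..a - low of
    \<open>key_identity\<close>.\<close>
  proof (intro arg_cong2[of _ _ _ _ "(-)"] refl sum.reindex_bij_witness[of _ "\<lambda>l. l - 1" "\<lambda>l. l + 1"])
    fix l assume l: "l \<in> {l. l + 2 \<le> a}"
    then have "a - (l + 1) + 1 = a - l" "a - l - 1 = a - (l + 1)" "1 \<le> a - (l + 1)" by auto
    then show "unit (sl2_tensor sl_e (mono_t (l + 1 - 1)), w0(n + 1 := Dsum False k (m (n + 1)) (a - (l + 1) + 1)))
        + unit (sl2_tensor sl_h (mono_t (l + 1)), w0(n + 1 := D1 False k (m (n + 1)) (a - (l + 1))))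
      = unit (sl2_tensor sl_e (mono_t l), w0(n + 1 := Dsum False k (m (n + 1)) (a - l)))
        + unit (sl2_tensor sl_h (mono_t (l + 1)), w0(n + 1 := dual_vec k (m (n + 1)) [down sl_e (a - l - 1)]))"
      using d by simp
  qed auto
qed

end

locale tensor_inj = tensor +
  assumes z_inj: "inj_on z {1..n}"
    and kappa: "k + 2 \<noteq> 0"
    and m_sum: "m (n + 1) = (\<Sum>j=1..n. m j) - 2"
begin

lemma point_neq: "i \<in> {1..n} \<Longrightarrow> j \<in> {1..n} \<Longrightarrow> i \<noteq> j \<Longrightarrow> z i \<noteq> z j"
  using z_inj by (auto dest: inj_onD)

lemma reg_pole:
  assumes "p \<in> {1..n}" "j \<in> {1..n+1} - {p}" "0 < a"
  shows "reg j (pole (z p) a)"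
  using assms expand_at_pole_other(1)[OF point_neq[of j p]] by (auto simp: reg_def expand_infinity_pole)

lemma val_pole:
  assumes "p \<in> {1..n}" "j \<in> {1..n} - {p}"
  shows "val (pole (z p) a) j = 1 / (z j - z p) ^ a"
  using assms expand_at_pole_other(2)[OF point_neq[of j p]] by (auto simp: val_def)

lemma val_inf [simp]: "val u (n + 1) = 0"
  by (simp add: val_def)

lemma reg_mono: "j \<in> {1..n+1} - {n+1} \<Longrightarrow> reg j (mono_t a)"
  using expand_at_mono(1) by (auto simp: reg_def)

lemma val_mono: "j \<in> {1..n} \<Longrightarrow> val (mono_t a) j = z j ^ a"
  by (simp add: val_def expand_at_mono)

lemma act_at_pole:
  assumes "p \<in> {1..n}"
  shows "act_at p (sl2_tensor x (pole (z p) a)) \<phi> y = contra_act (loop x (- int a)) \<phi> y"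
proof -
  have "p \<le> n" using assms by simp
  then show ?thesis
    unfolding act_at_tensor(1)[OF \<open>p \<le> n\<close>]
    using series_part_monomial[OF expand_at_pole_self, of x "z p" a \<phi> y] by simp
qed

lemma act_at_mono:
  "act_at (n + 1) (sl2_tensor sl_e (mono_t a)) \<phi> y = contra_act (loop sl_f (- int a)) \<phi> y"
  "act_at (n + 1) (sl2_tensor sl_f (mono_t a)) \<phi> y = contra_act (loop sl_e (- int a)) \<phi> y"
  "act_at (n + 1) (sl2_tensor sl_h (mono_t a)) \<phi> y = - contra_act (loop sl_h (- int a)) \<phi> y"
  unfolding act_at_tensor using series_part_monomial[OF expand_infinity_mono, of _ a \<phi> y] by simp_all

lemma D_eta0_Pole:
  assumes p: "p \<in> {1..n}" and a: "0 < a"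
  shows "D (eta0_basis n z k m (Pole p a)) \<approx> pm_scale (m p + of_nat a * (k + 2)) (P p a)
    + (\<Sum>j\<in>{1..n} - {p}. pm_scale (m j) (pm_scale (1 / (z j - z p) ^ a) (P j 0)
        - (\<Sum>l=1..a. pm_scale (1 / (z j - z p) ^ l) (P p (a - l)))))"
proof -
  have q: "p \<in> {1..n+1}" using p by simp
  have key: "act_at p (sl2_tensor sl_f (pole (z p) a)) (V p) x
      - (\<Sum>l=1..a. act_at p (sl2_tensor sl_e (pole (z p) l)) (Dsum True k (m p) (a - l)) x
          + act_at p (sl2_tensor sl_h (pole (z p) l)) (D1 True k (m p) (a - l)) x)
      = (m p + of_nat a * (k + 2)) * D1 True k (m p) a x" for x
    using key_identity[of True a k "m p" x]
    by (simp add: act_at_pole[OF p] low_def lead_def opp_def sg_def algebra_simps)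
  have "D (eta0_basis n z k m (Pole p a)) \<approx> pm_scale (m p + of_nat a * (k + 2)) (P p a)
    + (\<Sum>j\<in>{1..n+1} - {p}. pm_scale (val (pole (z p) a) j * m j) (P j 0)
          - (\<Sum>l=1..a. pm_scale (val (pole (z p) l) j * m j) (P p (a - l))))"
    unfolding eta0_Pole
    by (rule D_eta0_shape[OF q Dsum_verma_dual Phi_verma_dual Phi_verma_dual _ _ _ key])
      (use p a in \<open>auto intro!: reg_pole\<close>)
  also have "(\<Sum>j\<in>{1..n+1} - {p}. pm_scale (val (pole (z p) a) j * m j) (P j 0)
          - (\<Sum>l=1..a. pm_scale (val (pole (z p) l) j * m j) (P p (a - l))))
      = (\<Sum>j\<in>{1..n} - {p}. pm_scale (val (pole (z p) a) j * m j) (P j 0)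
          - (\<Sum>l=1..a. pm_scale (val (pole (z p) l) j * m j) (P p (a - l))))"
    using p by (intro sum.mono_neutral_right) (auto simp: val_def)
  also have "\<dots> = (\<Sum>j\<in>{1..n} - {p}. pm_scale (m j) (pm_scale (1 / (z j - z p) ^ a) (P j 0)
        - (\<Sum>l=1..a. pm_scale (1 / (z j - z p) ^ l) (P p (a - l)))))"
    by (intro sum.cong refl) (simp add: val_pole[OF p] pm.scale_right_diff_distrib pm.scale_sum_right mult.commute)
  finally show ?thesis .
qed

text \<open>Since \<pi> exchanges \<open>e\<close> and \<open>f\<close>, this is
  \<open>key_identity\<close> without \<open>s\<close>, whose constant -m + a k + 2 (a - 1) equals a
  (k + 2) - (m + 2). For a = 0 the function is constant and acts at infinity by \<open>e\<close>,
  which annihilates the dual of the generating vector.\<close>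

lemma D_eta0_Mono:
  "D (eta0_basis n z k m (Mono a)) \<approx> (if a = 0 then 0 else pm_scale (of_nat a * (k + 2) - (m (n + 1) + 2)) (E a))
    + (\<Sum>j=1..n. pm_scale (m j) (pm_scale (z j ^ a) (P j 0) - (\<Sum>l=1..a - 1. pm_scale (z j ^ l) (E (a - l)))))"
proof -
  have q: "n + 1 \<in> {1..n+1}" by simp
  let ?c = "if a = 0 then 0 else of_nat a * (k + 2) - (m (n + 1) + 2)"
  have vac: "vac True k (m (n + 1)) = vac False k (m (n + 1))" using vac_indep[of False] by simp
  have key: "act_at (n + 1) (sl2_tensor sl_f (mono_t a)) (V (n + 1)) x
      - (\<Sum>l=1..a - 1. act_at (n + 1) (sl2_tensor sl_e (mono_t (l - 1))) (Dsum False k (m (n + 1)) (a - l + 1)) x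
          + act_at (n + 1) (sl2_tensor sl_h (mono_t l)) (D1 False k (m (n + 1)) (a - l)) x)
      = ?c * D1 False k (m (n + 1)) a x" for x
  proof (cases "a = 0")
    case True
    then show ?thesis
      using contra_vac(1)[of 0 True k "m (n + 1)" x] act_at_mono(2)[of 0 "V (n + 1)" x] by simp
  next
    case False
    have "(\<Sum>l=1..a - 1. act_at (n + 1) (sl2_tensor sl_e (mono_t (l - 1))) (Dsum False k (m (n + 1)) (a - l + 1)) x
          + act_at (n + 1) (sl2_tensor sl_h (mono_t l)) (D1 False k (m (n + 1)) (a - l)) x)
      = (\<Sum>l=1..a - 1. contra_act (loop sl_f (1 - int l)) (Dsum False k (m (n + 1)) (a - l + 1)) x
          - contra_act (loop sl_h (- int l)) (D1 False k (m (n + 1)) (a - l)) x)"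
      unfolding act_at_mono by (intro sum.cong) (auto simp: of_nat_diff)
    moreover have "(of_nat (a - 1) :: complex) = of_nat a - 1" using False by (simp add: of_nat_diff)
    ultimately show ?thesis
      using key_identity[of False a k "m (n + 1)" x] False unfolding vac act_at_mono(2)
      by (simp add: low_def lead_def opp_def sg_def algebra_simps)
  qed
  have "D (eta0_basis n z k m (Mono a)) \<approx> pm_scale ?c (E a)
    + (\<Sum>j\<in>{1..n+1} - {n+1}. pm_scale (val (mono_t a) j * m j) (P j 0)
          - (\<Sum>l=1..a - 1. pm_scale (val (mono_t l) j * m j) (E (a - l))))"
    unfolding eta0_Mono
    by (rule D_eta0_shape[OF q Dsum_verma_dual Phi_verma_dual Phi_verma_dual _ _ _ key])
      (rule reg_mono; assumption)+
  also have "{1..n+1} - {n+1} = {1..n}" by auto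
  also have "(\<Sum>j=1..n. pm_scale (val (mono_t a) j * m j) (P j 0)
          - (\<Sum>l=1..a - 1. pm_scale (val (mono_t l) j * m j) (E (a - l))))
     = (\<Sum>j=1..n. pm_scale (m j) (pm_scale (z j ^ a) (P j 0) - (\<Sum>l=1..a - 1. pm_scale (z j ^ l) (E (a - l)))))"
    by (intro sum.cong refl) (simp add: val_mono pm.scale_right_diff_distrib pm.scale_sum_right mult.commute)
  also have "pm_scale ?c (E a) = (if a = 0 then 0 else pm_scale (of_nat a * (k + 2) - (m (n + 1) + 2)) (E a))"
    by (cases "a = 0") (simp_all only: if_True if_False pm.scale_zero_left refl)
  finally show ?thesis .
qed

section \<open>The twisted differential in the partial fraction basis\<close>

abbreviation eta1_lift :: "ratfun \<Rightarrow> (family \<Rightarrow>\<^sub>0 complex)" where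
  "eta1_lift \<equiv> rat_lift n z (eta1_basis n k m)"

lemma lift_pole: "p \<in> {1..n} \<Longrightarrow> 0 < a \<Longrightarrow> eta1_lift (pole (z p) a) = pm_scale (- (k + 2)) (P p (a - 1))"
  using rat_lift_basis[OF z_inj, of "Pole p a" "eta1_basis n k m"] by (simp only: rat_indices_iff rat_basis.simps eta1_Pole)

lemma lift_mono: "eta1_lift (mono_t a) = pm_scale (k + 2) (E (a + 1))"
  using rat_lift_basis[OF z_inj, of "Mono a" "eta1_basis n k m"] by (simp only: rat_indices_iff rat_basis.simps eta1_Mono)

lemma dR_eq: "dR n z m (k + 2) u = rat_deriv u + rat_scale (- 1 / (k + 2)) (\<Sum>i=1..n. rat_scale (m i) (pole (z i) 1 * u))"
  by (simp add: dR_def alpha_def rat_scale_mult_left sum_distrib_right)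

lemma dR_add: "dR n z m (k + 2) (u + v) = dR n z m (k + 2) u + dR n z m (k + 2) v"
  by (simp add: dR_def rat_deriv_add distrib_left)

lemma dR_scale: "dR n z m (k + 2) (rat_scale c u) = rat_scale c (dR n z m (k + 2) u)"
  by (simp add: dR_def rat_deriv_scale rat_scale_mult_right rat.scale_right_distrib)

lemma alpha_part_in_span:
  assumes "u \<in> rat_span n z"
  shows "(\<Sum>i=1..n. rat_scale (m i) (pole (z i) 1 * u)) \<in> rat_span n z"
  by (intro rat.span_sum rat.span_scale rat_span_mult_pole z_inj assms)

lemma dR_in_span: "u \<in> rat_span n z \<Longrightarrow> dR n z m (k + 2) u \<in> rat_span n z"
proof (induction rule: rat.span_induct)
  case base
  have "dR n z m (k + 2) 0 = 0" using dR_scale[of 0 0] by simp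
  then show ?case by (auto simp: rat.subspace_def dR_add dR_scale rat.span_zero rat.span_add rat.span_scale)
next
  case (step u)
  then obtain i where i: "i \<in> rat_indices n" "u = rat_basis z i" by blast
  have "rat_deriv u \<in> rat_span n z"
    using i by (cases i) (auto simp: rat_deriv_pole rat_deriv_mono_t intro!: rat.span_scale pole_in_span mono_t_in_span rat.span_neg)
  moreover have "u \<in> rat_span n z" using i rat_basis_in_span by blast
  ultimately show ?case
    unfolding dR_eq by (intro rat.span_add rat.span_scale alpha_part_in_span)
qed

lemma lift_dR:
  assumes u: "u \<in> rat_span n z" and d: "rat_deriv u \<in> rat_span n z"
  shows "eta1_lift (dR n z m (k + 2) u) = eta1_lift (rat_deriv u)
    + (\<Sum>i=1..n. pm_scale (m i) (pm_scale (- 1 / (k + 2)) (eta1_lift (pole (z i) 1 * u))))"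
proof -
  have s: "pole (z i) 1 * u \<in> rat_span n z" if "i \<in> {1..n}" for i
    by (rule rat_span_mult_pole[OF z_inj that u])
  have "eta1_lift (\<Sum>i=1..n. rat_scale (m i) (pole (z i) 1 * u)) = (\<Sum>i=1..n. pm_scale (m i) (eta1_lift (pole (z i) 1 * u)))"
    using s by (subst rat_lift_sum[OF z_inj]) (auto intro!: rat.span_scale sum.cong simp: rat_lift_scale[OF z_inj])
  then show ?thesis
    unfolding dR_eq
    by (simp only: rat_lift_add[OF z_inj d rat.span_scale[OF alpha_part_in_span[OF u]]]
        rat_lift_scale[OF z_inj alpha_part_in_span[OF u]])
      (simp add: pm.scale_sum_right mult.commute)
qed

text \<open>The factor -1/\<kappa> of \<alpha> cancels the -\<kappa> of \<open>eta1\<close>.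
  Differentiation gives a \<kappa>, the summand of \<alpha> at \<open>z p\<close> gives
  \<open>m p\<close>, and the other summands are expanded by \<open>pole_pole\<close>.\<close>

lemma lift_dR_Pole:
  assumes p: "p \<in> {1..n}" and a: "0 < a"
  shows "eta1_lift (dR n z m (k + 2) (pole (z p) a)) = pm_scale (m p + of_nat a * (k + 2)) (P p a)
    + (\<Sum>j\<in>{1..n} - {p}. pm_scale (m j) (pm_scale (1 / (z j - z p) ^ a) (P j 0)
        - (\<Sum>l=1..a. pm_scale (1 / (z j - z p) ^ l) (P p (a - l)))))"
proof -
  have u: "pole (z p) a \<in> rat_span n z" using p a by (rule pole_in_span)
  have d: "rat_deriv (pole (z p) a) \<in> rat_span n z"
    unfolding rat_deriv_pole using p by (intro rat.span_scale pole_in_span) auto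
  have D: "eta1_lift (rat_deriv (pole (z p) a)) = pm_scale (of_nat a * (k + 2)) (P p a)"
  proof -
    have s: "pole (z p) (a + 1) \<in> rat_span n z" using p by (intro pole_in_span) auto
    have "eta1_lift (pole (z p) (a + 1)) = pm_scale (- (k + 2)) (P p a)"
      using lift_pole[OF p, of "a + 1"] by simp
    then show ?thesis
      unfolding rat_deriv_pole rat_lift_scale[OF z_inj s] by (simp add: algebra_simps)
  qed
  have k: "- 1 / (k + 2) * - (k + 2) = 1"
  proof -
    have "- 1 / x * - x = 1" if "x \<noteq> 0" for x :: complex using that by simp
    then show ?thesis using kappa .
  qed
  have self: "pm_scale (- 1 / (k + 2)) (eta1_lift (pole (z p) 1 * pole (z p) a)) = P p a"
  proof -
    have "pole (z p) 1 * pole (z p) a = pole (z p) (a + 1)" by (simp add: pole_Suc[of _ a])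
    moreover have "eta1_lift (pole (z p) (a + 1)) = pm_scale (- (k + 2)) (P p a)"
      using lift_pole[OF p, of "a + 1"] by simp
    ultimately show ?thesis by (simp only: pm.scale_scale k pm.scale_one)
  qed
  have other: "pm_scale (- 1 / (k + 2)) (eta1_lift (pole (z j) 1 * pole (z p) a))
      = pm_scale (1 / (z j - z p) ^ a) (P j 0) - (\<Sum>l=1..a. pm_scale (1 / (z j - z p) ^ l) (P p (a - l)))"
    if j: "j \<in> {1..n} - {p}" for j
  proof -
    have jn: "j \<in> {1..n}" and ne: "z j \<noteq> z p" using j p point_neq by auto
    have s1: "pole (z j) 1 \<in> rat_span n z" using jn by (intro pole_in_span) auto
    have s2: "pole (z p) (a - l + 1) \<in> rat_span n z" for l using p by (intro pole_in_span) auto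
    have s3: "(\<Sum>l=1..a. rat_scale (1 / (z j - z p) ^ l) (pole (z p) (a - l + 1))) \<in> rat_span n z"
      by (intro rat.span_sum rat.span_scale s2)
    have "eta1_lift (pole (z j) 1 * pole (z p) a)
      = pm_scale (1 / (z j - z p) ^ a) (eta1_lift (pole (z j) 1))
        - (\<Sum>l=1..a. pm_scale (1 / (z j - z p) ^ l) (eta1_lift (pole (z p) (a - l + 1))))"
      unfolding pole_pole[OF ne] rat_lift_diff[OF z_inj rat.span_scale[OF s1] s3] rat_lift_scale[OF z_inj s1]
      by (subst rat_lift_sum[OF z_inj]) (auto intro!: rat.span_scale s2[simplified] simp: rat_lift_scale[OF z_inj s2[simplified]])
    also have "\<dots> = pm_scale (- (k + 2)) (pm_scale (1 / (z j - z p) ^ a) (P j 0)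
        - (\<Sum>l=1..a. pm_scale (1 / (z j - z p) ^ l) (P p (a - l))))"
      using lift_pole[OF jn, of 1] lift_pole[OF p]
      by (simp add: pm.scale_right_diff_distrib pm.scale_sum_right mult.commute)
    finally show ?thesis
      using k by (simp only: pm.scale_scale pm.scale_one)
  qed
  have "(\<Sum>i=1..n. pm_scale (m i) (pm_scale (- 1 / (k + 2)) (eta1_lift (pole (z i) 1 * pole (z p) a))))
     = pm_scale (m p) (P p a) + (\<Sum>j\<in>{1..n} - {p}. pm_scale (m j) (pm_scale (1 / (z j - z p) ^ a) (P j 0)
        - (\<Sum>l=1..a. pm_scale (1 / (z j - z p) ^ l) (P p (a - l)))))"
    using other self p by (subst sum.remove[of _ p]) (auto intro!: sum.cong simp del: pm_scale_single)
  then show ?thesis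
    unfolding lift_dR[OF u d] D by (simp add: pm.scale_left_distrib add_ac del: pm_scale_single)
qed

lemma lift_dR_Mono:
  "eta1_lift (dR n z m (k + 2) (mono_t a)) = (if a = 0 then 0 else pm_scale (of_nat a * (k + 2) - (m (n + 1) + 2)) (E a))
    + (\<Sum>j=1..n. pm_scale (m j) (pm_scale (z j ^ a) (P j 0) - (\<Sum>l=1..a - 1. pm_scale (z j ^ l) (E (a - l)))))"
proof -
  have d: "rat_deriv (mono_t a) \<in> rat_span n z"
    unfolding rat_deriv_mono_t by (intro rat.span_scale mono_t_in_span)
  have D: "eta1_lift (rat_deriv (mono_t a)) = (if a = 0 then 0 else pm_scale (of_nat a * (k + 2)) (E a))"
    unfolding rat_deriv_mono_t rat_lift_scale[OF z_inj mono_t_in_span] lift_mono by auto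
  have k: "- 1 / (k + 2) * - (k + 2) = 1"
  proof -
    have "- 1 / x * - x = 1" if "x \<noteq> 0" for x :: complex using that by simp
    then show ?thesis using kappa .
  qed
  \<comment> \<open>The term with t^(a-1) arises from every point with the same coefficient and is
    split off; for a = 0 there is none.\<close>
  let ?e = "if a = 0 then 0 else E a"
  have other: "pm_scale (- 1 / (k + 2)) (eta1_lift (pole (z j) 1 * mono_t a))
      = pm_scale (z j ^ a) (P j 0) - (\<Sum>l=1..a - 1. pm_scale (z j ^ l) (E (a - l))) - ?e"
    if j: "j \<in> {1..n}" for j
  proof -
    have s1: "pole (z j) 1 \<in> rat_span n z" using j by (intro pole_in_span) auto
    have s3: "(\<Sum>l<a. rat_scale (z j ^ l) (mono_t (a - 1 - l))) \<in> rat_span n z"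
      by (intro rat.span_sum rat.span_scale mono_t_in_span)
    have "eta1_lift (pole (z j) 1 * mono_t a) = pm_scale (z j ^ a) (eta1_lift (pole (z j) 1))
        + (\<Sum>l<a. pm_scale (z j ^ l) (eta1_lift (mono_t (a - 1 - l))))"
      unfolding mult.commute[of "pole (z j) 1"] mono_t_pole
        rat_lift_add[OF z_inj rat.span_scale[OF s1] s3] rat_lift_scale[OF z_inj s1]
      by (subst rat_lift_sum[OF z_inj]) (auto intro!: rat.span_scale mono_t_in_span simp: rat_lift_scale[OF z_inj mono_t_in_span])
    also have "\<dots> = pm_scale (- (k + 2)) (pm_scale (z j ^ a) (P j 0) - (\<Sum>l<a. pm_scale (z j ^ l) (E (a - 1 - l + 1))))"
      unfolding lift_mono lift_pole[OF j zero_less_one] diff_self_eq_0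
    proof -
      show "pm_scale b (pm_scale (- K) x) + (\<Sum>l<a. pm_scale (c l) (pm_scale K (y l)))
          = pm_scale (- K) (pm_scale b x - (\<Sum>l<a. pm_scale (c l) (y l)))"
        for b K c and x :: "family \<Rightarrow>\<^sub>0 complex" and y
        by (simp add: pm.scale_right_diff_distrib pm.scale_sum_right mult.commute sum_negf)
    qed
    also have "(\<Sum>l<a. pm_scale (z j ^ l) (E (a - 1 - l + 1))) = (\<Sum>l<a. pm_scale (z j ^ l) (E (a - l)))"
      by (intro sum.cong refl arg_cong2[of _ _ _ _ pm_scale] arg_cong[of _ _ E]) auto
    also have "(\<Sum>l<a. pm_scale (z j ^ l) (E (a - l))) = ?e + (\<Sum>l=1..a - 1. pm_scale (z j ^ l) (E (a - l)))"
    proof (cases a)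
      case (Suc b)
      have "{..<a} = insert 0 {1..a - 1}" using Suc by auto
      then show ?thesis using Suc by simp
    qed simp
    finally have "eta1_lift (pole (z j) 1 * mono_t a) = pm_scale (- (k + 2)) (pm_scale (z j ^ a) (P j 0)
      - (?e + (\<Sum>l=1..a - 1. pm_scale (z j ^ l) (E (a - l)))))" .
    then show ?thesis
      using k by (simp only: pm.scale_scale pm.scale_one) (simp add: algebra_simps)
  qed
  have "(\<Sum>i=1..n. pm_scale (m i) (pm_scale (- 1 / (k + 2)) (eta1_lift (pole (z i) 1 * mono_t a))))
     = (\<Sum>j=1..n. pm_scale (m j) (pm_scale (z j ^ a) (P j 0) - (\<Sum>l=1..a - 1. pm_scale (z j ^ l) (E (a - l)))))
       - (\<Sum>j=1..n. pm_scale (m j) ?e)"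
    unfolding sum_subtractf[symmetric] pm.scale_right_diff_distrib[symmetric]
    by (intro sum.cong refl arg_cong2[of _ _ _ _ pm_scale] other)
  \<comment> \<open>Here the value of \<open>m (n + 1)\<close> enters: the top terms of all points
    together must match the constant found at infinity.\<close>
  moreover have "(\<Sum>j=1..n. pm_scale (m j) ?e) = pm_scale (m (n + 1) + 2) ?e"
    using m_sum by (simp only: pm.scale_sum_left[symmetric]) simp
  ultimately show ?thesis
    unfolding lift_dR[OF mono_t_in_span d] D
    by (simp add: pm.scale_left_diff_distrib del: pm_scale_single)
qed

lemma D_eta0_eqv:
  assumes "u \<in> rat_span n z"
  shows "D (rat_lift n z (eta0_basis n z k m) u) \<approx> eta1_lift (dR n z m (k + 2) u)"
proof -
  let ?f = "\<lambda>u. D (rat_lift n z (eta0_basis n z k m) u)" and ?g = "\<lambda>u. eta1_lift (dR n z m (k + 2) u)"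
  \<comment> \<open>Membership is carried along because linearity of \<open>rat_lift\<close> is
    available on the span.\<close>
  have "u \<in> rat_span n z \<and> ?f u \<approx> ?g u"
    using assms
  proof (induction rule: rat.span_induct)
    case base
    have "dR n z m (k + 2) 0 = 0" using dR_scale[of 0 0] by simp
    then have "?f 0 \<approx> ?g 0" by simp
    moreover have "?f (u + v) \<approx> ?g (u + v)"
      if "u \<in> rat_span n z" "v \<in> rat_span n z" "?f u \<approx> ?g u" "?f v \<approx> ?g v" for u v
      using eqv_add[OF that(3,4)] that(1,2)
      by (simp add: rat_lift_add[OF z_inj] pm_lift_add dR_add dR_in_span)
    moreover have "?f (rat_scale c u) \<approx> ?g (rat_scale c u)"
      if "u \<in> rat_span n z" "?f u \<approx> ?g u" for u c
      using eqv_scale[OF that(2), of c] that(1)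
      by (simp add: rat_lift_scale[OF z_inj] pm_lift_scale dR_scale dR_in_span)
    ultimately show ?case
      unfolding rat.subspace_def mem_Collect_eq by (intro conjI ballI allI) (auto intro: rat.span_zero rat.span_add rat.span_scale)
  next
    case (step u)
    then obtain i where i: "i \<in> rat_indices n" "u = rat_basis z i" by blast
    have "?f u \<approx> ?g u"
      unfolding i(2) rat_lift_basis[OF z_inj i(1)]
    proof (cases i)
      case (Pole p a)
      then have "p \<in> {1..n}" "0 < a" using i by auto
      then show "D (eta0_basis n z k m i) \<approx> ?g (rat_basis z i)"
        unfolding Pole rat_basis.simps lift_dR_Pole[OF \<open>p \<in> {1..n}\<close> \<open>0 < a\<close>] by (rule D_eta0_Pole)
    next
      case (Mono a)
      show "D (eta0_basis n z k m i) \<approx> ?g (rat_basis z i)"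
        unfolding Mono rat_basis.simps lift_dR_Mono by (rule D_eta0_Mono)
    qed
    then show ?case using i rat_basis_in_span by blast
  qed
  then show ?thesis ..
qed

subsection \<open>Injectivity\<close>

text \<open>Pairing with a pure tensor of vectors; being multilinear in the family, it is well
  defined modulo the relations.\<close>

definition ev :: "(nat \<Rightarrow> words) \<Rightarrow> family \<Rightarrow> complex" where
  "ev y w = (\<Prod>j\<in>{1..n+1}. w j (y j))"

lemma ev_upd:
  assumes "j \<in> {1..n+1}"
  shows "ev y (w(j := a)) = a (y j) * (\<Prod>i\<in>{1..n+1} - {j}. w i (y i))"
proof -
  have "ev y (w(j := a)) = (w(j := a)) j (y j) * (\<Prod>i\<in>{1..n+1} - {j}. (w(j := a)) i (y i))"
    unfolding ev_def using assms by (intro prod.remove) auto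
  also have "(\<Prod>i\<in>{1..n+1} - {j}. (w(j := a)) i (y i)) = (\<Prod>i\<in>{1..n+1} - {j}. w i (y i))"
    by (intro prod.cong) auto
  finally show ?thesis by (simp only: fun_upd_same)
qed

lemma ev_R0: "x \<in> R0 \<Longrightarrow> pm_eval (ev y) x = 0"
  unfolding rel_C0_def
proof (induction rule: pm.span_induct)
  case base
  show ?case by (auto simp: pm.subspace_def pm_eval_add pm_eval_scale)
next
  case (step x)
  then show ?case by (auto simp: pm_eval_diff ev_upd distrib_right simp del: One_nat_def)
qed

text \<open>The \<open>f\<close>-component paired with the generating vectors suffices for
  \<open>eta0\<close>, whose only term with \<open>f\<close> carries the basis function
  itself.\<close>

definition ev1 :: "rat_index \<Rightarrow> sl2_fun \<times> family \<Rightarrow> complex" where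
  "ev1 i = (\<lambda>(g, w). rat_coeff z i (g sl_f) * ev (\<lambda>_. unit []) w)"

lemma ev1_R1: "x \<in> R1 \<Longrightarrow> pm_eval (ev1 i) x = 0"
  unfolding rel_C1_def
proof (induction rule: pm.span_induct)
  case base
  show ?case by (auto simp: pm.subspace_def pm_eval_add pm_eval_scale)
next
  case (step x)
  then show ?case
    by (auto simp: pm_eval_diff ev1_def ev_upd rat_coeff_linear distrib_right distrib_left mult.left_commute simp del: One_nat_def)
qed

definition test_words :: "rat_index \<Rightarrow> nat \<Rightarrow> words" where
  "test_words i = (case i of Pole p a \<Rightarrow> (\<lambda>j. if j = p then unit [down sl_f (a - 1)] else unit [])
     | Mono a \<Rightarrow> (\<lambda>j. if j = n + 1 then unit [down sl_e (a + 1)] else unit []))"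

lemma Phi_test: "negL x \<Longrightarrow> Phi s k M v (unit [x]) = of_bool (v = [x])" "Phi s k M v (unit []) = of_bool (v = [])"
  using Phi_srt[of s "[x]" k M v] Phi_srt[of s "[]" k M v] by auto

lemma ev_w0_upd:
  assumes q: "q \<in> {1..n+1}" and r: "r \<in> {1..n+1}" and x: "negL x"
  shows "ev (\<lambda>j. if j = r then unit [x] else unit []) (w0(q := Phi s k (m q) [y])) = of_bool (q = r \<and> x = y)"
proof (cases "q = r")
  case True
  have *: "(\<Prod>i\<in>{1..n+1} - {q}. w0 i (if i = r then unit [x] else unit [])) = 1"
    by (intro prod.neutral) (auto simp: w0_eq True Phi_test)
  show ?thesis unfolding ev_upd[OF q] * using True x by (auto simp: Phi_test)
next
  case False
  then show ?thesis unfolding ev_upd[OF q] by (simp add: Phi_test)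
qed

lemma ev_eta1:
  assumes "i \<in> rat_indices n" "j \<in> rat_indices n"
  shows "pm_eval (ev (test_words i)) (eta1_basis n k m j)
    = (if i = j then (case i of Pole _ _ \<Rightarrow> - (k + 2) | Mono _ \<Rightarrow> k + 2) else 0)"
proof -
  obtain r x where i: "test_words i = (\<lambda>j. if j = r then unit [x] else unit [])" "r \<in> {1..n+1}" "negL x"
    and ri: "(case i of Pole p a \<Rightarrow> r = p \<and> x = down sl_f (a - 1) | Mono a \<Rightarrow> r = n + 1 \<and> x = down sl_e (a + 1))"
  proof (cases i)
    case (Pole p a)
    then show ?thesis using assms(1)
      by (intro that[of p "down sl_f (a - 1)"]) (auto simp: test_words_def negL_down)
  next
    case (Mono a)
    then show ?thesis
      by (intro that[of "n + 1" "down sl_e (a + 1)"]) (auto simp: test_words_def negL_down)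
  qed
  show ?thesis
  proof (cases j)
    case (Pole q b)
    then have q: "q \<in> {1..n+1}" "0 < b" "q \<noteq> n + 1" using assms by auto
    show ?thesis
      unfolding Pole eta1_Pole pm_eval_scale pm_eval_single i(1) ev_w0_upd[OF q(1) i(2,3)]
      using ri q assms(1) by (cases i) (auto simp: lead_def)
  next
    case (Mono b)
    have q: "n + 1 \<in> {1..n+1}" by simp
    show ?thesis
      unfolding Mono eta1_Mono pm_eval_scale pm_eval_single i(1) ev_w0_upd[OF q i(2,3)]
      using ri assms(1) by (cases i) (auto simp: lead_def)
  qed
qed

lemma ev_w0: "ev (\<lambda>_. unit []) w0 = 1"
  unfolding ev_def by (intro prod.neutral) (auto simp: w0_eq simp del: One_nat_def)

lemma rat_coeff_0: "rat_coeff z i 0 = 0"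
  by (cases i) simp_all

lemma ev1_eta0:
  assumes "i \<in> rat_indices n" "j \<in> rat_indices n"
  shows "pm_eval (ev1 i) (eta0_basis n z k m j) = (if i = j then 1 else 0)"
proof (cases j)
  case (Pole p a)
  have "pm_eval (ev1 i) (eta0_basis n z k m j) = rat_coeff z i (rat_basis z j)"
    unfolding Pole eta0_Pole
    by (simp add: pm_eval_diff pm_eval_sum pm_eval_add ev1_def sl2_tensor_def rat_coeff_0 ev_w0)
  then show ?thesis using rat_coeff_basis[OF z_inj assms] by simp
next
  case (Mono a)
  have "pm_eval (ev1 i) (eta0_basis n z k m j) = rat_coeff z i (rat_basis z j)"
    unfolding Mono eta0_Mono
    by (simp add: pm_eval_diff pm_eval_sum pm_eval_add ev1_def sl2_tensor_def rat_coeff_0 ev_w0)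
  then show ?thesis using rat_coeff_basis[OF z_inj assms] by simp
qed

lemma eta1_inj: "inj_on (eta1 n z k m) (rat_span n z)"
proof (rule inj_onI)
  fix u v assume u: "u \<in> rat_span n z" and v: "v \<in> rat_span n z" and "eta1 n z k m u = eta1 n z k m v"
  then have "eta1_lift (u - v) \<in> R0"
    by (simp add: eta1_def coset_eq_iff[OF subspace_R0] rat_lift_diff[OF z_inj])
  then have "u - v = 0"
    by (rule rat_lift_inj_mod[OF z_inj rat.span_diff[OF u v], where L = "\<lambda>i. pm_eval (ev (test_words i))"
          and c = "\<lambda>i. case i of Pole _ _ \<Rightarrow> - (k + 2) | Mono _ \<Rightarrow> k + 2"])
      (auto simp: linear_pm_eval ev_R0 ev_eta1 kappa neg_eq_iff_add_eq_0 eq_neg_iff_add_eq_0 split: rat_index.splits dest: arg_cong[of _ _ uminus])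
  then show "u = v" by simp
qed

lemma eta0_inj: "inj_on (eta0 n z k m) (rat_span n z)"
proof (rule inj_onI)
  fix u v assume u: "u \<in> rat_span n z" and v: "v \<in> rat_span n z" and "eta0 n z k m u = eta0 n z k m v"
  then have "rat_lift n z (eta0_basis n z k m) (u - v) \<in> R1"
    by (simp add: eta0_def coset_eq_iff[OF subspace_R1] rat_lift_diff[OF z_inj])
  then have "u - v = 0"
    by (rule rat_lift_inj_mod[OF z_inj rat.span_diff[OF u v], where L = "\<lambda>i. pm_eval (ev1 i)" and c = "\<lambda>_. 1"])
      (auto simp: linear_pm_eval ev1_R1 ev1_eta0)
  then show "u = v" by simp
qed

section \<open>The values lie in the chain complex\<close>

lemma keys_eta1:
  assumes "i \<in> rat_indices n"
  shows "Poly_Mapping.keys (eta1_basis n k m i) \<subseteq> F"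
proof (cases i)
  case (Pole p a)
  then have "p \<in> {1..n+1}" using assms by auto
  then show ?thesis unfolding Pole eta1_Pole by (auto intro!: F_upd w0_F Phi_verma_dual simp del: One_nat_def)
next
  case (Mono a)
  have "n + 1 \<in> {1..n+1}" by simp
  then show ?thesis unfolding Mono eta1_Mono by (auto intro!: F_upd w0_F Phi_verma_dual simp del: One_nat_def)
qed

lemma sl2_tensor_mem: "u \<in> rat_span n z \<Longrightarrow> sl2_tensor x u \<in> sl2_U n z"
  using rat.span_zero by (auto simp: sl2_U_def sl2_tensor_def Omega0_eq_span[OF z_inj])

lemma keys_eta0_shape:
  assumes q: "q \<in> {1..n+1}" and "uf \<in> rat_span n z" "\<And>l. l \<in> {1..N} \<Longrightarrow> ue l \<in> rat_span n z \<and> uh l \<in> rat_span n z"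
    and "\<And>l. \<phi> l \<in> verma_dual k (m q)" "\<And>l. \<psi> l \<in> verma_dual k (m q)"
  shows "Poly_Mapping.keys (shape q N uf ue uh \<phi> \<psi>) \<subseteq> sl2_U n z \<times> F"
proof
  fix t assume "t \<in> Poly_Mapping.keys (shape q N uf ue uh \<phi> \<psi>)"
  then consider "t = (sl2_tensor sl_f uf, w0)"
    | l where "l \<in> {1..N}" "t = (sl2_tensor sl_e (ue l), w0(q := \<phi> l)) \<or> t = (sl2_tensor sl_h (uh l), w0(q := \<psi> l))"
  proof (elim keys_diffE)
    assume "t \<in> Poly_Mapping.keys (\<Sum>l=1..N. unit (sl2_tensor sl_e (ue l), w0(q := \<phi> l))
        + unit (sl2_tensor sl_h (uh l), w0(q := \<psi> l)))"
    then have "(\<Sum>l=1..N. Poly_Mapping.lookup (unit (sl2_tensor sl_e (ue l), w0(q := \<phi> l))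
        + unit (sl2_tensor sl_h (uh l), w0(q := \<psi> l))) t) \<noteq> 0"
      by (simp add: in_keys_iff lookup_sum)
    from sum.not_neutral_contains_not_neutral[OF this] obtain l where l: "l \<in> {1..N}"
      "Poly_Mapping.lookup (unit (sl2_tensor sl_e (ue l), w0(q := \<phi> l))
        + unit (sl2_tensor sl_h (uh l), w0(q := \<psi> l))) t \<noteq> 0" .
    then have "t = (sl2_tensor sl_e (ue l), w0(q := \<phi> l)) \<or> t = (sl2_tensor sl_h (uh l), w0(q := \<psi> l))"
      by (auto simp: lookup_add lookup_single when_def split: if_splits)
    then show ?thesis using that(2) l(1) by blast
  qed (use that(1) in auto)
  then show "t \<in> sl2_U n z \<times> F"
  proof cases
    case 1
    then show ?thesis using assms(2) sl2_tensor_mem w0_F by auto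
  next
    case 2
    then show ?thesis using assms(3)[OF 2(1)] sl2_tensor_mem F_upd[OF w0_F q assms(4)] F_upd[OF w0_F q assms(5)] by auto
  qed
qed

lemma keys_eta0:
  assumes "i \<in> rat_indices n"
  shows "Poly_Mapping.keys (eta0_basis n z k m i) \<subseteq> sl2_U n z \<times> F"
proof (cases i)
  case (Pole p a)
  then have p: "p \<in> {1..n}" "p \<in> {1..n+1}" "0 < a" using assms by auto
  show ?thesis unfolding Pole eta0_Pole
    by (rule keys_eta0_shape[OF p(2) pole_in_span[OF p(1,3)] _ Dsum_verma_dual Phi_verma_dual])
      (use pole_in_span[OF p(1)] in auto)
next
  case (Mono a)
  have q: "n + 1 \<in> {1..n+1}" by simp
  show ?thesis unfolding Mono eta0_Mono
    by (rule keys_eta0_shape[OF q mono_t_in_span _ Dsum_verma_dual Phi_verma_dual])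
      (use mono_t_in_span in blast)
qed

end

theorem theorem4p1:
  fixes n :: nat and z m :: "nat \<Rightarrow> complex" and k :: complex
  assumes "inj_on z {1..n}"
    and "k + 2 \<noteq> 0"
    and "m (n + 1) = (\<Sum>j=1..n. m j) - 2"
  shows "linear_to_cosets (Omega0 n z) (C1 n z k m) (eta0 n z k m)
    \<and> linear_to_cosets (Omega1 n z) (C0 n k m) (eta1 n z k m)
    \<and> (\<forall>u\<in>Omega0 n z. dR n z m (k + 2) u \<in> Omega1 n z
          \<and> dCE n z k m (eta0 n z k m u) = eta1 n z k m (dR n z m (k + 2) u))
    \<and> inj_on (eta0 n z k m) (Omega0 n z)
    \<and> inj_on (eta1 n z k m) (Omega1 n z)"
proof -
  interpret tensor_inj n z k m
    using assms by unfold_locales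
  note span = Omega0_eq_span[OF assms(1)]
  have "linear_to_cosets (Omega0 n z) (C1 n z k m) (eta0 n z k m)"
    using linear_to_cosets_rat_lift[OF assms(1) subspace_R1 keys_eta0]
    by (simp add: C1_def eta0_def[abs_def])
  moreover have "linear_to_cosets (Omega1 n z) (C0 n k m) (eta1 n z k m)"
    using linear_to_cosets_rat_lift[OF assms(1) subspace_R0 keys_eta1]
    by (simp add: C0_def eta1_def[abs_def] Omega1_def)
  moreover have "dR n z m (k + 2) u \<in> Omega1 n z"
    "dCE n z k m (eta0 n z k m u) = eta1 n z k m (dR n z m (k + 2) u)" if "u \<in> Omega0 n z" for u
    using dR_in_span[of u] D_eta0_eqv[of u] that unfolding span Omega1_def
    by (simp_all add: eta0_def eta1_def dCE_coset coset_eq_iff[OF subspace_R0] eqv_def)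
  ultimately show ?thesis
    using eta0_inj eta1_inj unfolding span Omega1_def by blast
qed

end
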